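(* Let $T$ be in $I(Q)$. (i) Only the eigenvalue $1$ can be mixed. (ii) The eigenvectors corresponding to eigenvalue $-1$ are necessarily space-like. $T$ is orientation-preserving if and only if the multiplicity of the eigenvalue $-1$ is even. Equivalently, $T$ is orientation-preserving if and only if $\det T = 1$. (iii) Suppose $T$ has a time-like eigenvector. Then $T$ is semisimple, and its characteristic polynomial $\chi_T(x)$ has the form $$\chi_T(x) = (x-1)^l(x+1)^m\chi_{oT}(x),\qquad \chi_{oT}(x)=\prod_{j=1}^{s}(x^2-2a_jx+1)^{r_j},\quad |a_j|<1.$$ Here the $a_j$'s are distinct, and $l\ge 1$. Let $k=\sum_{j=1}^s r_j+[\frac m2]$. $T$ is called a $k$-rotatory elliptic if $m$ is even, and a $k$-rotatory elliptic inversion if $m$ is odd. (iv) $T$ can have only one pair of real eigenvalues $(r,r^{-1})$, $r\neq \pm 1$. Such $r$ is necessarily positive. The eigenspaces corresponding to $r$, $r^{-1}$ are $1$-dimensional, and are light-like. Suppose this is the case (that is, $T$ has such a pair of eigenvalues). Then $T$ is semisimple, and its characteristic polynomial $\chi_T(x)$ has the form $$\chi_T(x) = (x-1)^l(x+1)^m\chi_{oT}(x),\qquad \chi_{oT}(x)=(x-r)(x-r^{-1})\prod_{j=1}^{s}(x^2-2a_jx+1)^{r_j},\quad |a_j|<1.$$ Here the $a_j$'s are distinct. Let $k=\sum_{j=1}^s r_j+[\frac m2]$. $T$ is called a $k$-rotatory hyperbolic if $m$ is even, and a $k$-rotatory hyperbolic inversion if $m$ is odd. (v) Suppose $T$ is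 not semisimple. Then $T$ has a $1$-dimensional light-like eigenspace with eigenvalue $1$. Let $T=T_sT_u$ be its Jordan decomposition, $T_u\neq \mathrm{Id}$. The characteristic polynomial $\chi_T(x)$ has the form $$\chi_T(x) = (x-1)^l(x+1)^m\chi_{oT}(x),\qquad \chi_{oT}(x)=\prod_{j=1}^{s}(x^2-2a_jx+1)^{r_j},\quad |a_j|<1.$$ Here the $a_j$'s are distinct, and $l\ge 3$. Let $k=\sum_{j=1}^s r_j+[\frac m2]$. $T$ is called a $k$-rotatory parabolic if $m$ is even, and a $k$-rotatory parabolic inversion if $m$ is odd. $T_s$ is elliptic, and the minimal polynomial of $T_u$ is $(x-1)^3$. (vi) Every $T\in I(Q)$ satisfies either (iii), or (iv), or (v).
   Context: $\mathbb{V}$ is a real vector space of dimension $n+1$ equipped with a quadratic form $Q$ of signature $(1,n)$ (one positive, $n$ negative), and $O(Q)$ is its full isometry group. The hyperboloid $\{v\in\mathbb{V}: Q(v)=1\}$ has two components; one of them is the model of the hyperbolic space $\mathbb{H}^n$. $I(Q)$ is the subgroup of $O(Q)$ preserving this component, and it is identified with the full isometry group $I(\mathbb{H}^n)$; "orientation-preserving" refers to the action on $\mathbb{H}^n$. A vector $v\in\mathbb{V}$ is time-like (resp. space-like, light-like) if $Q(v)>0$ (resp. $Q(v)<0$, $Q(v)=0$); a subspace $\mathbb{W}$ is time-like (resp. space-like, light-like) if $Q|_{\mathbb{W}}>0$ (resp. $Q|_{\mathbb{W}}<0$, $Q|_{\mathbb{W}}=0$). $T$ is also regarded as an operator on the complexification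 of $\mathbb{V}$. An eigenvalue $\lambda$ of $T$ is pure if the corresponding eigenspace $\{v: (T-\lambda)v=0\}$ coincides with the generalized eigenspace $\{v: (T-\lambda)^{n+1}v=0\}$; otherwise it is mixed. $T$ is semisimple if every $T$-invariant subspace has a $T$-invariant complement, and unipotent if all its eigenvalues are $1$. The Jordan decomposition is the unique decomposition $T=T_sT_u$ with $T_s$ semisimple, $T_u$ unipotent, and $T_s,T_u$ commuting; for $T\in O(Q)$ both $T_s$ and $T_u$ are in $O(Q)$. An element is called elliptic if it is a $k$-rotatory elliptic or a $k$-rotatory elliptic inversion for some $k$, as defined in (iii). $[\cdot]$ denotes the integer part.
   Formalization: In (v), "a 1-dimensional light-like eigenspace with eigenvalue 1" is read as a 1-dimensional light-like subspace of eigenvectors for 1; the whole eigenspace can be larger (a parabolic translation of H^3 has a 2-dimensional eigenspace for 1). *)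

theory Defs
  imports "HOL-Analysis.Analysis" "Jordan_Normal_Form.Char_Poly"
begin

text \<open>
  The ambient space is a type of class \<open>euclidean_space\<close>, i.e. a finite-dimensional real vector
  space. Its built-in inner product is unrelated to \<open>Q\<close>: it only supplies the canonical topology
  and one fixed basis in which matrices of operators are written.
\<close>

section \<open>Quadratic forms and isometries\<close>

definition polar_form :: "('a::real_vector \<Rightarrow> real) \<Rightarrow> 'a \<Rightarrow> 'a \<Rightarrow> real" where
  "polar_form Q u v = (Q (u + v) - Q u - Q v) / 2"

definition quadratic_form :: "('a::real_vector \<Rightarrow> real) \<Rightarrow> bool" where
  "quadratic_form Q \<longleftrightarrow> (\<forall>c v. Q (c *\<^sub>R v) = c\<^sup>2 * Q v) \<and> bilinear (polar_form Q)"

text \<open>Signature \<open>(p, q)\<close>: there is a \<open>Q\<close>-orthogonal basis \<open>P \<union> N\<close> with \<open>p\<close> vectors on which \<open>Q\<close> is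
  positive and \<open>q\<close> vectors on which it is negative.\<close>

definition has_signature :: "('a::euclidean_space \<Rightarrow> real) \<Rightarrow> nat \<Rightarrow> nat \<Rightarrow> bool" where
  "has_signature Q p q \<longleftrightarrow>
     (\<exists>P N. P \<inter> N = {} \<and> independent (P \<union> N) \<and> span (P \<union> N) = UNIV \<and>
        card P = p \<and> card N = q \<and>
        pairwise (\<lambda>u v. polar_form Q u v = 0) (P \<union> N) \<and>
        (\<forall>v\<in>P. Q v > 0) \<and> (\<forall>v\<in>N. Q v < 0))"

definition time_like :: "('a \<Rightarrow> real) \<Rightarrow> 'a \<Rightarrow> bool" where
  "time_like Q v \<longleftrightarrow> Q v > 0"

definition space_like :: "('a \<Rightarrow> real) \<Rightarrow> 'a \<Rightarrow> bool" where
  "space_like Q v \<longleftrightarrow> Q v < 0"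

definition light_like_space :: "('a \<Rightarrow> real) \<Rightarrow> 'a set \<Rightarrow> bool" where
  "light_like_space Q W \<longleftrightarrow> (\<forall>v\<in>W. Q v = 0)"

definition isometry_group :: "('a::real_vector \<Rightarrow> real) \<Rightarrow> ('a \<Rightarrow> 'a) set" where
  "isometry_group Q = {T. linear T \<and> bij T \<and> (\<forall>v. Q (T v) = Q v)}"

text \<open>\<open>I(Q)\<close>, where \<open>H\<close> is the chosen component of the hyperboloid \<open>{v. Q v = 1}\<close>.\<close>

definition hyp_isometries :: "('a::real_vector \<Rightarrow> real) \<Rightarrow> 'a set \<Rightarrow> ('a \<Rightarrow> 'a) set" where
  "hyp_isometries Q H = {T \<in> isometry_group Q. T ` H = H}"

section \<open>Determinant and characteristic polynomial of an operator\<close>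

definition basis_list :: "'a::euclidean_space list" where
  "basis_list = (SOME bs. distinct bs \<and> set bs = Basis)"

definition op_mat :: "('a::euclidean_space \<Rightarrow> 'a) \<Rightarrow> real mat" where
  "op_mat T = mat DIM('a) DIM('a) (\<lambda>(i, j). T (basis_list ! j) \<bullet> (basis_list ! i))"

definition op_det :: "('a::euclidean_space \<Rightarrow> 'a) \<Rightarrow> real" where
  "op_det T = Determinant.det (op_mat T)"

definition op_char_poly :: "('a::euclidean_space \<Rightarrow> 'a) \<Rightarrow> real poly" where
  "op_char_poly T = char_poly (op_mat T)"

definition poly_op :: "real poly \<Rightarrow> ('a::real_vector \<Rightarrow> 'a) \<Rightarrow> 'a \<Rightarrow> 'a" where
  "poly_op p T v = (\<Sum>i\<le>degree p. coeff p i *\<^sub>R (T ^^ i) v)"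

definition is_minimal_poly :: "('a::real_vector \<Rightarrow> 'a) \<Rightarrow> real poly \<Rightarrow> bool" where
  "is_minimal_poly T p \<longleftrightarrow>
     lead_coeff p = 1 \<and> (\<forall>v. poly_op p T v = 0) \<and>
     (\<forall>q. (\<forall>v. poly_op q T v = 0) \<longrightarrow> p dvd q)"

section \<open>Eigenvalues on the complexification\<close>

text \<open>The pair \<open>(x, y)\<close> stands for the vector \<open>x + \<i> y\<close> of the complexification.\<close>

definition cscale :: "complex \<Rightarrow> 'a::real_vector \<times> 'a \<Rightarrow> 'a \<times> 'a" where
  "cscale c z = (Re c *\<^sub>R fst z - Im c *\<^sub>R snd z, Re c *\<^sub>R snd z + Im c *\<^sub>R fst z)"

definition cop :: "('a \<Rightarrow> 'a) \<Rightarrow> 'a \<times> 'a \<Rightarrow> 'a \<times> 'a" where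
  "cop T z = (T (fst z), T (snd z))"

definition ceigenspace :: "('a::euclidean_space \<Rightarrow> 'a) \<Rightarrow> complex \<Rightarrow> ('a \<times> 'a) set" where
  "ceigenspace T c = {z. cop T z - cscale c z = 0}"

definition gen_ceigenspace :: "('a::euclidean_space \<Rightarrow> 'a) \<Rightarrow> complex \<Rightarrow> ('a \<times> 'a) set" where
  "gen_ceigenspace T c = {z. ((\<lambda>w. cop T w - cscale c w) ^^ DIM('a)) z = 0}"

definition is_eigenvalue :: "('a::euclidean_space \<Rightarrow> 'a) \<Rightarrow> complex \<Rightarrow> bool" where
  "is_eigenvalue T c \<longleftrightarrow> (\<exists>z\<in>ceigenspace T c. z \<noteq> 0)"

definition pure_eigenvalue :: "('a::euclidean_space \<Rightarrow> 'a) \<Rightarrow> complex \<Rightarrow> bool" where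
  "pure_eigenvalue T c \<longleftrightarrow> is_eigenvalue T c \<and> ceigenspace T c = gen_ceigenspace T c"

definition mixed_eigenvalue :: "('a::euclidean_space \<Rightarrow> 'a) \<Rightarrow> complex \<Rightarrow> bool" where
  "mixed_eigenvalue T c \<longleftrightarrow> is_eigenvalue T c \<and> \<not> pure_eigenvalue T c"

definition real_eigenspace :: "('a::real_vector \<Rightarrow> 'a) \<Rightarrow> real \<Rightarrow> 'a set" where
  "real_eigenspace T c = {v. T v = c *\<^sub>R v}"

definition has_time_like_eigenvector :: "('a::real_vector \<Rightarrow> real) \<Rightarrow> ('a \<Rightarrow> 'a) \<Rightarrow> bool" where
  "has_time_like_eigenvector Q T \<longleftrightarrow>
     (\<exists>c. \<exists>v\<in>real_eigenspace T c. v \<noteq> 0 \<and> time_like Q v)"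

definition has_real_eigenvalue_pair :: "('a::euclidean_space \<Rightarrow> 'a) \<Rightarrow> real \<Rightarrow> bool" where
  "has_real_eigenvalue_pair T r \<longleftrightarrow>
     r \<noteq> 1 \<and> r \<noteq> -1 \<and> is_eigenvalue T (of_real r) \<and> is_eigenvalue T (of_real (inverse r))"

section \<open>Jordan decomposition\<close>

definition semisimple_op :: "('a::real_vector \<Rightarrow> 'a) \<Rightarrow> bool" where
  "semisimple_op T \<longleftrightarrow>
     (\<forall>W. subspace W \<and> T ` W \<subseteq> W \<longrightarrow>
        (\<exists>U. subspace U \<and> T ` U \<subseteq> U \<and> W \<inter> U = {0} \<and> {w + u | w u. w \<in> W \<and> u \<in> U} = UNIV))"

definition unipotent_op :: "('a::euclidean_space \<Rightarrow> 'a) \<Rightarrow> bool" where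
  "unipotent_op T \<longleftrightarrow> (\<forall>c. is_eigenvalue T c \<longrightarrow> c = 1)"

definition jordan_decomposition ::
    "('a::euclidean_space \<Rightarrow> 'a) \<Rightarrow> ('a \<Rightarrow> 'a) \<Rightarrow> ('a \<Rightarrow> 'a) \<Rightarrow> bool" where
  "jordan_decomposition T Ts Tu \<longleftrightarrow>
     linear Ts \<and> linear Tu \<and> semisimple_op Ts \<and> unipotent_op Tu \<and>
     T = Ts \<circ> Tu \<and> Ts \<circ> Tu = Tu \<circ> Ts"

section \<open>Orientation of hyperbolic space\<close>

definition tangent_space :: "('a::real_vector \<Rightarrow> real) \<Rightarrow> 'a \<Rightarrow> 'a set" where
  "tangent_space Q p = {v. polar_form Q p v = 0}"

text \<open>A tangent frame at \<open>p\<close> is an ordered basis \<open>b 0, \<dots>, b (n - 1)\<close> of the tangent space at \<open>p\<close>,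
  where \<open>n = DIM('a) - 1\<close>; the remaining values of \<open>b\<close> are fixed to \<open>0\<close> so that frames form a
  subspace of the topological space \<open>'a \<times> (nat \<Rightarrow> 'a)\<close>.\<close>

definition tangent_frames :: "('a::euclidean_space \<Rightarrow> real) \<Rightarrow> 'a set \<Rightarrow> ('a \<times> (nat \<Rightarrow> 'a)) set" where
  "tangent_frames Q H =
     {(p, b). p \<in> H \<and> inj_on b {..<DIM('a) - 1} \<and> independent (b ` {..<DIM('a) - 1}) \<and>
        span (b ` {..<DIM('a) - 1}) = tangent_space Q p \<and> (\<forall>i\<ge>DIM('a) - 1. b i = 0)}"

text \<open>An orientation of \<open>H\<close>, as of any manifold: every tangent frame gets a sign, two frames at the
  same point get the same sign iff the change-of-basis matrix has positive determinant, and the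
  sign depends continuously on the frame.\<close>

definition is_orientation ::
    "('a::euclidean_space \<Rightarrow> real) \<Rightarrow> 'a set \<Rightarrow> ('a \<times> (nat \<Rightarrow> 'a) \<Rightarrow> real) \<Rightarrow> bool" where
  "is_orientation Q H \<sigma> \<longleftrightarrow>
     \<sigma> ` tangent_frames Q H \<subseteq> {-1, 1} \<and>
     continuous_on (tangent_frames Q H) \<sigma> \<and>
     (\<forall>p b c. \<forall>M \<in> carrier_mat (DIM('a) - 1) (DIM('a) - 1).
        (p, b) \<in> tangent_frames Q H \<and> (p, c) \<in> tangent_frames Q H \<and>
        (\<forall>j<DIM('a) - 1. c j = (\<Sum>i<DIM('a) - 1. M $$ (i, j) *\<^sub>R b i)) \<longrightarrow>
        \<sigma> (p, c) = sgn (Determinant.det M) * \<sigma> (p, b))"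

text \<open>Since \<open>T\<close> is linear, the differential at \<open>p\<close> of its action on \<open>H\<close> is the restriction of \<open>T\<close> to
  the tangent space, so the action maps the frame \<open>(p, b)\<close> to \<open>(T p, T \<circ> b)\<close>. As \<open>H\<close> is connected,
  it has exactly two orientations \<open>\<sigma>\<close> and \<open>- \<sigma>\<close>, and \<open>T\<close> preserves one iff it preserves the other.\<close>

definition orientation_preserving :: "('a::euclidean_space \<Rightarrow> real) \<Rightarrow> 'a set \<Rightarrow> ('a \<Rightarrow> 'a) \<Rightarrow> bool" where
  "orientation_preserving Q H T \<longleftrightarrow>
     (\<exists>\<sigma>. is_orientation Q H \<sigma> \<and> (\<forall>(p, b) \<in> tangent_frames Q H. \<sigma> (T p, T \<circ> b) = \<sigma> (p, b)))"

section \<open>Types of isometries\<close>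

text \<open>The factor \<open>\<Prod>\<^sub>j (x\<^sup>2 - 2 a\<^sub>j x + 1)^r\<^sub>j\<close> and the conditions on its parameters; \<open>r\<^sub>j \<ge> 1\<close> is implicit
  in the \<open>r\<^sub>j\<close> being multiplicities.\<close>

definition rotation_poly :: "nat \<Rightarrow> (nat \<Rightarrow> real) \<Rightarrow> (nat \<Rightarrow> nat) \<Rightarrow> real poly" where
  "rotation_poly s a r = (\<Prod>j=1..s. [:1, - 2 * a j, 1:] ^ r j)"

definition rotation_data :: "nat \<Rightarrow> (nat \<Rightarrow> real) \<Rightarrow> (nat \<Rightarrow> nat) \<Rightarrow> bool" where
  "rotation_data s a r \<longleftrightarrow> inj_on a {1..s} \<and> (\<forall>j\<in>{1..s}. \<bar>a j\<bar> < 1 \<and> r j \<ge> 1)"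

definition elliptic_form ::
    "('a::euclidean_space \<Rightarrow> 'a) \<Rightarrow> nat \<Rightarrow> nat \<Rightarrow> nat \<Rightarrow> (nat \<Rightarrow> real) \<Rightarrow> (nat \<Rightarrow> nat) \<Rightarrow> bool" where
  "elliptic_form T l m s a r \<longleftrightarrow>
     rotation_data s a r \<and> l \<ge> 1 \<and>
     op_char_poly T = [:-1, 1:] ^ l * [:1, 1:] ^ m * rotation_poly s a r"

definition hyperbolic_form ::
    "('a::euclidean_space \<Rightarrow> 'a) \<Rightarrow> real \<Rightarrow> nat \<Rightarrow> nat \<Rightarrow> nat \<Rightarrow> (nat \<Rightarrow> real) \<Rightarrow> (nat \<Rightarrow> nat) \<Rightarrow> bool" where
  "hyperbolic_form T \<rho> l m s a r \<longleftrightarrow>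
     rotation_data s a r \<and>
     op_char_poly T =
       [:-1, 1:] ^ l * [:1, 1:] ^ m * ([:- \<rho>, 1:] * [:- inverse \<rho>, 1:] * rotation_poly s a r)"

definition parabolic_form ::
    "('a::euclidean_space \<Rightarrow> 'a) \<Rightarrow> nat \<Rightarrow> nat \<Rightarrow> nat \<Rightarrow> (nat \<Rightarrow> real) \<Rightarrow> (nat \<Rightarrow> nat) \<Rightarrow> bool" where
  "parabolic_form T l m s a r \<longleftrightarrow>
     rotation_data s a r \<and> l \<ge> 3 \<and>
     op_char_poly T = [:-1, 1:] ^ l * [:1, 1:] ^ m * rotation_poly s a r"

definition rotation_number :: "nat \<Rightarrow> nat \<Rightarrow> (nat \<Rightarrow> nat) \<Rightarrow> nat" where
  "rotation_number m s r = (\<Sum>j=1..s. r j) + m div 2"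

definition rotatory_elliptic ::
    "('a::euclidean_space \<Rightarrow> real) \<Rightarrow> 'a set \<Rightarrow> nat \<Rightarrow> ('a \<Rightarrow> 'a) \<Rightarrow> bool" where
  "rotatory_elliptic Q H k T \<longleftrightarrow>
     T \<in> hyp_isometries Q H \<and> has_time_like_eigenvector Q T \<and>
     (\<exists>l m s a r. elliptic_form T l m s a r \<and> k = rotation_number m s r \<and> even m)"

definition rotatory_elliptic_inversion ::
    "('a::euclidean_space \<Rightarrow> real) \<Rightarrow> 'a set \<Rightarrow> nat \<Rightarrow> ('a \<Rightarrow> 'a) \<Rightarrow> bool" where
  "rotatory_elliptic_inversion Q H k T \<longleftrightarrow>
     T \<in> hyp_isometries Q H \<and> has_time_like_eigenvector Q T \<and>
     (\<exists>l m s a r. elliptic_form T l m s a r \<and> k = rotation_number m s r \<and> odd m)"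

definition elliptic :: "('a::euclidean_space \<Rightarrow> real) \<Rightarrow> 'a set \<Rightarrow> ('a \<Rightarrow> 'a) \<Rightarrow> bool" where
  "elliptic Q H T \<longleftrightarrow>
     (\<exists>k. rotatory_elliptic Q H k T \<or> rotatory_elliptic_inversion Q H k T)"

definition rotatory_hyperbolic ::
    "('a::euclidean_space \<Rightarrow> real) \<Rightarrow> 'a set \<Rightarrow> nat \<Rightarrow> ('a \<Rightarrow> 'a) \<Rightarrow> bool" where
  "rotatory_hyperbolic Q H k T \<longleftrightarrow>
     T \<in> hyp_isometries Q H \<and>
     (\<exists>\<rho> l m s a r. has_real_eigenvalue_pair T \<rho> \<and> hyperbolic_form T \<rho> l m s a r \<and>
        k = rotation_number m s r \<and> even m)"

definition rotatory_hyperbolic_inversion ::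
    "('a::euclidean_space \<Rightarrow> real) \<Rightarrow> 'a set \<Rightarrow> nat \<Rightarrow> ('a \<Rightarrow> 'a) \<Rightarrow> bool" where
  "rotatory_hyperbolic_inversion Q H k T \<longleftrightarrow>
     T \<in> hyp_isometries Q H \<and>
     (\<exists>\<rho> l m s a r. has_real_eigenvalue_pair T \<rho> \<and> hyperbolic_form T \<rho> l m s a r \<and>
        k = rotation_number m s r \<and> odd m)"

definition rotatory_parabolic ::
    "('a::euclidean_space \<Rightarrow> real) \<Rightarrow> 'a set \<Rightarrow> nat \<Rightarrow> ('a \<Rightarrow> 'a) \<Rightarrow> bool" where
  "rotatory_parabolic Q H k T \<longleftrightarrow>
     T \<in> hyp_isometries Q H \<and> \<not> semisimple_op T \<and>
     (\<exists>l m s a r. parabolic_form T l m s a r \<and> k = rotation_number m s r \<and> even m)"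

definition rotatory_parabolic_inversion ::
    "('a::euclidean_space \<Rightarrow> real) \<Rightarrow> 'a set \<Rightarrow> nat \<Rightarrow> ('a \<Rightarrow> 'a) \<Rightarrow> bool" where
  "rotatory_parabolic_inversion Q H k T \<longleftrightarrow>
     T \<in> hyp_isometries Q H \<and> \<not> semisimple_op T \<and>
     (\<exists>l m s a r. parabolic_form T l m s a r \<and> k = rotation_number m s r \<and> odd m)"

end

theory Submission
  imports Defs
begin

text \<open>
  Brouwer's theorem on a compact convex slice of the closed positive cone gives an eigenvector of \<open>T\<close>
  there, which separates the three types. If it is time-like, it is fixed, and reflecting the sign of \<open>Q\<close>
  on its orthogonal complement yields an invariant inner product. If it is light-like with eigenvalue
  \<open>r \<noteq> 1\<close>, it pairs with an eigenvector for \<open>1 / r\<close>, and \<open>Q\<close> is definite on the complement of the two.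
  If it is light-like and fixed and no time-like vector is fixed, then \<open>T\<close> is an isometry with a time-like
  fixed vector, composed with a commuting transvection; these two factors are the Jordan decomposition.
  The shape of \<open>\<chi>\<close> follows from the location of the complex eigenvalues, and uniqueness of the
  Jordan decomposition from the primary decomposition of the complexification.
\<close>

section \<open>Polynomial functional calculus\<close>

text \<open>Since \<open>B\<close> is indefinite, the orthogonal complement of an invariant subspace
  that meets the light cone need not be a complement. Semisimplicity is therefore proved with the
  positive definite \<open>pos_form h\<close>, \<open>h\<close> time-like: it suffices that the
  adjoint of \<open>T\<close> for this form preserves every \<open>T\<close>-invariant subspace. If
  \<open>T\<close> fixes \<open>h\<close>, the adjoint is the inverse of \<open>T\<close>. In the
  hyperbolic case \<open>h = u + w\<close> is moved; the adjoint is \<open>T\<close> on the plane of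
  \<open>u\<close> and \<open>w\<close> and the inverse of \<open>T\<close> on its orthogonal
  complement. That it preserves invariant subspaces rests on the two real eigenvalues being simple
  roots of the characteristic polynomial. In the parabolic case the transvection is read off from a
  vector \<open>v\<close> that pairs to 1 with the fixed light-like \<open>u\<close> and whose
  displacement \<open>T v - v\<close> is orthogonal to all displacements of vectors orthogonal to
  \<open>u\<close>. On those vectors \<open>- B\<close> is only semidefinite, hence a projection
  lemma for semidefinite forms.\<close>

locale linear_endo = Modules.module scale
  for scale :: "'f::comm_ring_1 \<Rightarrow> 'b::ab_group_add \<Rightarrow> 'b" (infixr \<open>*\<^sub>F\<close> 75) +
  fixes A :: "'b \<Rightarrow> 'b"
  assumes endo_add: "A (x + y) = A x + A y"
    and endo_scale: "A (c *\<^sub>F x) = c *\<^sub>F A x"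
begin

lemma endo_zero: "A 0 = 0"
  using endo_add[of 0 0] by simp

lemma endo_sum: "A (sum f I) = (\<Sum>i\<in>I. A (f i))"
  by (induction I rule: infinite_finite_induct) (auto simp: endo_zero endo_add)

text \<open>The sum of \<open>poly_op\<close>, for an arbitrary scalar action: it serves for
  \<open>T\<close> over the reals and for \<open>cop T\<close> over the complex numbers, which act
  on pairs through \<open>cscale\<close>.\<close>

definition gpoly :: "'f poly \<Rightarrow> 'b \<Rightarrow> 'b" where
  "gpoly p v = (\<Sum>i\<le>degree p. coeff p i *\<^sub>F (A ^^ i) v)"

lemma gpoly_eq_sum:
  assumes "degree p \<le> n"
  shows "gpoly p v = (\<Sum>i\<le>n. coeff p i *\<^sub>F (A ^^ i) v)"
  unfolding gpoly_def using assms
  by (intro sum.mono_neutral_left) (auto simp: coeff_eq_0)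

lemma gpoly_0 [simp]: "gpoly 0 v = 0"
  by (simp add: gpoly_def)

lemma gpoly_pCons: "gpoly (pCons c p) v = c *\<^sub>F v + A (gpoly p v)"
proof -
  have "gpoly (pCons c p) v = (\<Sum>i\<le>Suc (degree p). coeff (pCons c p) i *\<^sub>F (A ^^ i) v)"
    by (rule gpoly_eq_sum) (simp add: degree_pCons_le)
  also have "\<dots> = c *\<^sub>F v + (\<Sum>i\<le>degree p. coeff p i *\<^sub>F A ((A ^^ i) v))"
    by (subst sum.atMost_Suc_shift) simp
  also have "(\<Sum>i\<le>degree p. coeff p i *\<^sub>F A ((A ^^ i) v)) = A (gpoly p v)"
    by (simp add: gpoly_def endo_sum endo_scale)
  finally show ?thesis .
qed

lemma gpoly_1 [simp]: "gpoly 1 v = v"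
  by (simp add: one_pCons gpoly_pCons endo_zero)

lemma gpoly_add: "gpoly (p + q) v = gpoly p v + gpoly q v"
proof -
  let ?n = "max (degree p) (degree q)"
  have "gpoly (p + q) v = (\<Sum>i\<le>?n. coeff (p + q) i *\<^sub>F (A ^^ i) v)"
    by (rule gpoly_eq_sum) (simp add: degree_add_le_max)
  moreover have "gpoly p v = (\<Sum>i\<le>?n. coeff p i *\<^sub>F (A ^^ i) v)"
    by (rule gpoly_eq_sum) simp
  moreover have "gpoly q v = (\<Sum>i\<le>?n. coeff q i *\<^sub>F (A ^^ i) v)"
    by (rule gpoly_eq_sum) simp
  ultimately show ?thesis
    by (simp add: scale_left_distrib sum.distrib)
qed

lemma gpoly_sum: "gpoly (sum f I) v = (\<Sum>i\<in>I. gpoly (f i) v)"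
  by (induction I rule: infinite_finite_induct) (auto simp: gpoly_add)

lemma gpoly_smult: "gpoly (Polynomial.smult c p) v = c *\<^sub>F gpoly p v"
  using gpoly_eq_sum[of "Polynomial.smult c p" "degree p" v]
  by (simp add: degree_smult_le gpoly_def scale_sum_right)

lemma gpoly_mult: "gpoly (p * q) v = gpoly p (gpoly q v)"
  by (induction p) (auto simp: gpoly_pCons gpoly_add gpoly_smult endo_zero)

lemma gpoly_vadd: "gpoly p (v + w) = gpoly p v + gpoly p w"
  by (induction p) (auto simp: gpoly_pCons endo_add scale_right_distrib)

lemma gpoly_vscale: "gpoly p (c *\<^sub>F v) = c *\<^sub>F gpoly p v"
  by (induction p) (auto simp: gpoly_pCons endo_scale scale_right_distrib mult.commute)

lemma gpoly_vzero [simp]: "gpoly p 0 = 0"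
  by (induction p) (auto simp: gpoly_pCons endo_zero)

lemma gpoly_vsum: "gpoly p (sum f I) = (\<Sum>i\<in>I. gpoly p (f i))"
  by (induction I rule: infinite_finite_induct) (auto simp: gpoly_vadd)

lemma gpoly_eigenvector: "A v = c *\<^sub>F v \<Longrightarrow> gpoly p v = poly p c *\<^sub>F v"
  by (induction p) (auto simp: gpoly_pCons endo_scale scale_left_distrib mult.commute)

lemma gpoly_linear: "gpoly [:- c, 1:] v = A v - c *\<^sub>F v"
  by (simp add: gpoly_pCons endo_zero)

lemma gpoly_linear_power: "gpoly ([:- c, 1:] ^ k) v = ((\<lambda>w. A w - c *\<^sub>F w) ^^ k) v"
proof (induction k)
  case (Suc k)
  show ?case
    by (simp only: power_Suc gpoly_mult gpoly_linear Suc.IH funpow.simps comp_apply)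
qed simp

lemma gpoly_mem:
  assumes "0 \<in> W" "\<And>x y. x \<in> W \<Longrightarrow> y \<in> W \<Longrightarrow> x + y \<in> W" "\<And>c x. x \<in> W \<Longrightarrow> c *\<^sub>F x \<in> W"
    "\<And>x. x \<in> W \<Longrightarrow> A x \<in> W" "v \<in> W"
  shows "gpoly p v \<in> W"
  by (induction p) (auto simp: gpoly_pCons assms)

end

text \<open>Primary decomposition as an induction rule. Splitting the full power \<open>l\<close> of
  one root off \<open>p\<close> leaves a coprime cofactor \<open>g\<close> of smaller degree, and a
  Bezout identity writes \<open>v\<close> as a vector killed by \<open>g\<close> plus one killed by
  \<open>l\<close>.\<close>

lemma primary_decomposition_induct:
  fixes scale :: "complex \<Rightarrow> 'b::ab_group_add \<Rightarrow> 'b"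
  assumes "linear_endo scale A" "p \<noteq> 0" "linear_endo.gpoly scale A p v = 0"
    and add: "\<And>x y. P x \<Longrightarrow> P y \<Longrightarrow> P (x + y)"
    and prim: "\<And>c k w. ((\<lambda>w. A w - scale c w) ^^ k) w = 0 \<Longrightarrow> P w"
  shows "P v"
proof -
  interpret linear_endo scale A by fact
  from assms(2,3) show ?thesis
  proof (induction "degree p" arbitrary: p v rule: less_induct)
    case less
    show ?case
    proof (cases "degree p = 0")
      case True
      then obtain a where p: "p = [:a:]" using degree_eq_zeroE by blast
      with less.prems have "a \<noteq> 0" "scale a v = 0" by (auto simp: gpoly_pCons endo_zero)
      then have "scale (inverse a * a) v = 0" unfolding scale_scale[symmetric] by simp
      then have "v = 0" using \<open>a \<noteq> 0\<close> by simp
      then show ?thesis using prim[of 0 0 v] by simp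
    next
      case False
      then obtain c where "poly p c = 0"
        using fundamental_theorem_of_algebra[of p] by (auto simp: constant_degree)
      define k where "k = order c p"
      define l where "l = [:- c, 1:] ^ k"
      obtain g where g: "p = l * g" "\<not> [:- c, 1:] dvd g"
        unfolding l_def k_def using order_decomp[OF less.prems(1), of c] by blast
      have "k \<noteq> 0" using \<open>poly p c = 0\<close> less.prems(1) unfolding k_def by (simp add: order_root)
      have "g \<noteq> 0" using g less.prems by auto
      have deg: "degree g < degree p"
        unfolding g(1) using \<open>g \<noteq> 0\<close> \<open>k \<noteq> 0\<close>
        by (simp add: l_def degree_mult_eq degree_power_eq)
      \<comment> \<open>Source of the Bezout coefficients: \<open>y\<close> vanishes at
        \<open>c\<close>, so \<open>y ^ k\<close> is a multiple of \<open>l\<close>, while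
        \<open>1 - y ^ k\<close> is a multiple of \<open>1 - y\<close> and hence of
        \<open>g\<close>.\<close>
      define y where "y = 1 - [:inverse (poly g c):] * g"
      have "poly y c = 0" using g(2) by (simp add: y_def poly_eq_0_iff_dvd)
      then obtain h where "y = [:- c, 1:] * h" by (metis poly_eq_0_iff_dvd dvdE)
      then have "y ^ k = h ^ k * l" by (simp only: l_def power_mult_distrib mult.commute)
      moreover have "1 - y ^ k = ([:inverse (poly g c):] * (\<Sum>i<k. y ^ i)) * g"
        unfolding one_diff_power_eq y_def by (simp add: ac_simps)
      ultimately obtain a b where ab: "a * l + b * g = 1"
        by (metis diff_add_cancel add.commute)
      have v: "v = gpoly (a * l) v + gpoly (b * g) v"
        by (metis ab gpoly_1 gpoly_add)
      have "gpoly g (gpoly (a * l) v) = gpoly a (gpoly p v)"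
        by (simp add: g(1) flip: gpoly_mult) (simp add: ac_simps)
      then have "gpoly g (gpoly (a * l) v) = 0" using less.prems by simp
      then have 1: "P (gpoly (a * l) v)" using less.hyps[OF deg \<open>g \<noteq> 0\<close>] by blast
      have "gpoly l (gpoly (b * g) v) = gpoly b (gpoly p v)"
        by (simp add: g(1) flip: gpoly_mult) (simp add: ac_simps)
      then have "gpoly l (gpoly (b * g) v) = 0" using less.prems by simp
      then have "P (gpoly (b * g) v)" unfolding l_def gpoly_linear_power by (rule prim)
      with 1 add v show ?thesis by metis
    qed
  qed
qed

section \<open>Operators on the complexification\<close>

lemma linear_endo_real: "linear T \<Longrightarrow> linear_endo scaleR T"
  by unfold_locales (auto simp: linear_add linear_scale scaleR_left_distrib scaleR_right_distrib)

lemma linear_endo_complex: "linear T \<Longrightarrow> linear_endo cscale (cop T)"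
  by unfold_locales
    (auto simp: linear_add linear_diff linear_scale cscale_def cop_def algebra_simps)

lemma cop_compose: "cop (S \<circ> T) z = cop S (cop T z)"
  by (simp add: cop_def)

lemma poly_op_eq_gpoly: "linear T \<Longrightarrow> poly_op p T = linear_endo.gpoly scaleR T p"
  by (intro ext) (simp add: poly_op_def linear_endo.gpoly_def linear_endo_real)

text \<open>This carries the Cayley-Hamilton theorem from \<open>T\<close> over to
  \<open>cop T\<close>.\<close>

lemma poly_op_complexify:
  assumes "linear T"
  shows "linear_endo.gpoly cscale (cop T) (map_poly of_real p) (x, y) = (poly_op p T x, poly_op p T y)"
proof -
  interpret c: linear_endo cscale "cop T" by (rule linear_endo_complex[OF assms])
  interpret r: linear_endo scaleR T by (rule linear_endo_real[OF assms])
  show ?thesis unfolding poly_op_eq_gpoly[OF assms]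
  proof (induction p)
    case (pCons a p)
    then show ?case
      by (simp add: of_real_hom.map_poly_pCons_hom c.gpoly_pCons r.gpoly_pCons)
        (simp add: cop_def cscale_def)
  qed (simp add: zero_prod_def)
qed

section \<open>Coordinates, determinants and characteristic polynomials\<close>

lemma basis_list: "distinct (basis_list :: 'a::euclidean_space list)"
  "set (basis_list :: 'a list) = Basis"
proof -
  have "\<exists>bs :: 'a list. distinct bs \<and> set bs = Basis"
    using finite_distinct_list[OF finite_Basis] by blast
  from someI_ex[OF this] show "distinct (basis_list :: 'a list)" "set (basis_list :: 'a list) = Basis"
    unfolding basis_list_def by auto
qed

lemma length_basis_list: "length (basis_list :: 'a::euclidean_space list) = DIM('a)"
  using distinct_card[OF basis_list(1)[where 'a = 'a]] by (simp add: basis_list(2))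

lemma basis_list_nth_Basis: "i < DIM('a) \<Longrightarrow> (basis_list ! i :: 'a::euclidean_space) \<in> Basis"
  using nth_mem[of i "basis_list :: 'a list"] by (simp add: basis_list length_basis_list)

lemma inner_basis_list:
  assumes "i < DIM('a)" "j < DIM('a)"
  shows "inner (basis_list ! i :: 'a::euclidean_space) (basis_list ! j) = (if i = j then 1 else 0)"
  using assms
  by (simp add: inner_Basis basis_list_nth_Basis nth_eq_iff_index_eq basis_list length_basis_list)

lemma sum_basis_list:
  "(\<Sum>i<DIM('a). f (basis_list ! i :: 'a::euclidean_space)) = (\<Sum>b\<in>Basis. f b)"
proof -
  have "bij_betw ((!) (basis_list :: 'a list)) {..<DIM('a)} Basis"
    by (rule bij_betw_nth) (simp_all add: length_basis_list basis_list)
  then show ?thesis by (rule sum.reindex_bij_betw)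
qed

lemma basis_list_representation:
  "(\<Sum>i<DIM('a). inner v (basis_list ! i) *\<^sub>R (basis_list ! i)) = (v :: 'a::euclidean_space)"
  using sum_basis_list[of "\<lambda>b. inner v b *\<^sub>R b"] by (simp add: euclidean_representation)

lemma inner_sum_basis_list:
  "i < DIM('a) \<Longrightarrow> inner (\<Sum>j<DIM('a). c j *\<^sub>R basis_list ! j :: 'a::euclidean_space) (basis_list ! i) = c i"
  by (simp add: inner_sum_left inner_basis_list if_distrib cong: if_cong)

lemma op_mat_carrier [simp]:
  "op_mat (T :: 'a::euclidean_space \<Rightarrow> 'a) \<in> carrier_mat DIM('a) DIM('a)"
  by (simp add: op_mat_def)

lemma op_mat_index [simp]:
  "i < DIM('a) \<Longrightarrow> j < DIM('a) \<Longrightarrow>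
    op_mat (T :: 'a::euclidean_space \<Rightarrow> 'a) $$ (i, j) = inner (T (basis_list ! j)) (basis_list ! i)"
  by (simp add: op_mat_def)

lemma op_mat_dims [simp]:
  "dim_row (op_mat (T :: 'a::euclidean_space \<Rightarrow> 'a)) = DIM('a)"
  "dim_col (op_mat (T :: 'a::euclidean_space \<Rightarrow> 'a)) = DIM('a)"
  by (simp_all add: op_mat_def)

lemma op_mat_column:
  "j < DIM('a) \<Longrightarrow> (\<Sum>i<DIM('a). op_mat T $$ (i, j) *\<^sub>R basis_list ! i) = T (basis_list ! j :: 'a::euclidean_space)"
  using basis_list_representation[of "T (basis_list ! j)"] by simp

lemma linear_eq_sum_basis_list:
  assumes "linear (T :: 'a::euclidean_space \<Rightarrow> 'b::real_vector)"
  shows "T v = (\<Sum>i<DIM('a). inner v (basis_list ! i) *\<^sub>R T (basis_list ! i))"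
  using arg_cong[OF basis_list_representation[of v], of T]
  by (simp add: linear_sum[OF assms] linear_scale[OF assms])

lemma char_poly_matrix_op_mat_index:
  assumes "i < DIM('a)" "j < DIM('a)"
  shows "char_poly_matrix (op_mat (T :: 'a::euclidean_space \<Rightarrow> 'a)) $$ (i, j) =
    (if i = j then [:0, 1:] else 0) + [:- op_mat T $$ (i, j):]"
  using assms by (auto simp: char_poly_matrix_def)

text \<open>The columns of \<open>x I - T\<close>, with \<open>x\<close> acting as \<open>T\<close>, annihilate the basis; multiplication by the
  adjugate replaces \<open>x I - T\<close> by its determinant.\<close>

theorem op_cayley_hamilton:
  fixes T :: "'a::euclidean_space \<Rightarrow> 'a"
  assumes "linear T"
  shows "poly_op (op_char_poly T) T v = 0"
proof -
  interpret linear_endo scaleR T by (rule linear_endo_real[OF assms])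
  let ?N = "DIM('a)" and ?b = "\<lambda>i. basis_list ! i :: 'a"
  define C where "C = char_poly_matrix (op_mat T)"
  have C: "C \<in> carrier_mat ?N ?N" unfolding C_def by simp
  note adj = adj_mat[OF C]
  have col: "(\<Sum>i<?N. gpoly (C $$ (i, j)) (?b i)) = 0" if j: "j < ?N" for j
  proof -
    have "gpoly (C $$ (i, j)) (?b i) = (if i = j then T (?b j) else 0) - op_mat T $$ (i, j) *\<^sub>R ?b i"
      if "i < ?N" for i
      using that j unfolding C_def char_poly_matrix_op_mat_index[OF that j]
      by (auto simp: gpoly_add gpoly_pCons endo_zero)
    then have "(\<Sum>i<?N. gpoly (C $$ (i, j)) (?b i)) =
        (\<Sum>i<?N. if i = j then T (?b j) else 0) - (\<Sum>i<?N. op_mat T $$ (i, j) *\<^sub>R ?b i)"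
      by (simp add: sum_subtractf)
    then show ?thesis using op_mat_column[OF j, of T] j by simp
  qed
  have chi: "op_char_poly T = Determinant.det C" by (simp add: op_char_poly_def char_poly_def C_def)
  have basis: "gpoly (op_char_poly T) (?b k) = 0" if k: "k < ?N" for k
  proof -
    have "0 = (\<Sum>j<?N. gpoly (adj_mat C $$ (j, k)) (\<Sum>i<?N. gpoly (C $$ (i, j)) (?b i)))"
      using col by simp
    also have "\<dots> = (\<Sum>j<?N. \<Sum>i<?N. gpoly (C $$ (i, j) * adj_mat C $$ (j, k)) (?b i))"
      unfolding gpoly_vsum gpoly_mult[symmetric] by (simp add: mult.commute)
    also have "\<dots> = (\<Sum>i<?N. gpoly (\<Sum>j<?N. C $$ (i, j) * adj_mat C $$ (j, k)) (?b i))"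
      by (subst sum.swap) (simp add: gpoly_sum)
    also have "\<dots> = (\<Sum>i<?N. gpoly ((C * adj_mat C) $$ (i, k)) (?b i))"
      using C adj(1) k
      by (intro sum.cong refl arg_cong2[where f = gpoly])
        (auto simp: scalar_prod_def atLeast0LessThan)
    also have "\<dots> = (\<Sum>i<?N. if i = k then gpoly (op_char_poly T) (?b k) else 0)"
      unfolding adj(2) chi using k by (intro sum.cong) auto
    finally show ?thesis using k by simp
  qed
  have "gpoly (op_char_poly T) v = (\<Sum>i<?N. inner v (?b i) *\<^sub>R gpoly (op_char_poly T) (?b i))"
    by (subst basis_list_representation[of v, symmetric]) (simp add: gpoly_vsum gpoly_vscale)
  then show ?thesis using basis by (simp add: poly_op_eq_gpoly[OF assms])
qed

lemma op_char_poly_monic: "monic (op_char_poly (T :: 'a::euclidean_space \<Rightarrow> 'a))"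
  and degree_op_char_poly: "degree (op_char_poly T) = DIM('a)"
  unfolding op_char_poly_def
  using degree_monic_char_poly[OF op_mat_carrier, of T] by auto

lemma poly_op_char_poly_0:
  "poly (op_char_poly T) 0 = (-1) ^ DIM('a) * op_det (T :: 'a::euclidean_space \<Rightarrow> 'a)"
proof -
  have "- char_matrix (op_mat T) 0 = (-1) \<cdot>\<^sub>m op_mat T"
    by (rule eq_matI) (auto simp: char_matrix_def)
  then show ?thesis
    unfolding op_char_poly_def op_det_def char_poly_matrix[OF op_mat_carrier] by simp
qed

text \<open>A complex eigenvector of the matrix is split into the real and imaginary parts of its
  coordinates, which become the two components \<open>x\<close> and \<open>y\<close> of an
  eigenvector of \<open>cop T\<close>.\<close>

lemma root_op_char_poly_imp_eigenvalue:
  fixes T :: "'a::euclidean_space \<Rightarrow> 'a"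
  assumes T: "linear T" and root: "poly (map_poly of_real (op_char_poly T)) c = 0"
  shows "is_eigenvalue T c"
proof -
  let ?N = "DIM('a)" and ?b = "\<lambda>i. basis_list ! i :: 'a"
  let ?A = "map_mat complex_of_real (op_mat T)"
  have A: "?A \<in> carrier_mat ?N ?N" by simp
  have "eigenvalue ?A c"
    using root unfolding eigenvalue_root_char_poly[OF A] op_char_poly_def
    by (simp add: of_real_hom.char_poly_hom[OF op_mat_carrier])
  then obtain v where v: "v \<in> carrier_vec ?N" "v \<noteq> 0\<^sub>v ?N" "?A *\<^sub>v v = c \<cdot>\<^sub>v v"
    unfolding eigenvalue_def eigenvector_def by auto
  have ev: "(\<Sum>j<?N. op_mat T $$ (i, j) * Re (vec_index v j)) = Re (c * vec_index v i)"
    "(\<Sum>j<?N. op_mat T $$ (i, j) * Im (vec_index v j)) = Im (c * vec_index v i)"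
    if i: "i < ?N" for i
  proof -
    have "vec_index (?A *\<^sub>v v) i = (\<Sum>j<?N. complex_of_real (op_mat T $$ (i, j)) * vec_index v j)"
      using i v(1) by (auto simp: scalar_prod_def atLeast0LessThan intro!: sum.cong)
    then have "(\<Sum>j<?N. complex_of_real (op_mat T $$ (i, j)) * vec_index v j) = c * vec_index v i"
      using i v by simp
    from arg_cong[OF this, of Re] arg_cong[OF this, of Im]
    show "(\<Sum>j<?N. op_mat T $$ (i, j) * Re (vec_index v j)) = Re (c * vec_index v i)"
      "(\<Sum>j<?N. op_mat T $$ (i, j) * Im (vec_index v j)) = Im (c * vec_index v i)"
      by simp_all
  qed
  have T_sum: "T (\<Sum>j<?N. f j *\<^sub>R ?b j) = (\<Sum>i<?N. (\<Sum>j<?N. op_mat T $$ (i, j) * f j) *\<^sub>R ?b i)" for f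
  proof -
    have "T (\<Sum>j<?N. f j *\<^sub>R ?b j) = (\<Sum>j<?N. f j *\<^sub>R (\<Sum>i<?N. op_mat T $$ (i, j) *\<^sub>R ?b i))"
      by (simp add: linear_sum[OF T] linear_scale[OF T] op_mat_column del: op_mat_index)
    also have "\<dots> = (\<Sum>j<?N. \<Sum>i<?N. (op_mat T $$ (i, j) * f j) *\<^sub>R ?b i)"
      by (simp add: scaleR_sum_right mult.commute)
    also have "\<dots> = (\<Sum>i<?N. (\<Sum>j<?N. op_mat T $$ (i, j) * f j) *\<^sub>R ?b i)"
      by (subst sum.swap) (simp only: scaleR_sum_left)
    finally show ?thesis .
  qed
  define x y where "x = (\<Sum>i<?N. Re (vec_index v i) *\<^sub>R ?b i)"
    and "y = (\<Sum>i<?N. Im (vec_index v i) *\<^sub>R ?b i)"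
  have "T x = (\<Sum>i<?N. Re (c * vec_index v i) *\<^sub>R ?b i)"
    unfolding x_def T_sum using ev(1) by (intro sum.cong) simp_all
  then have Tx: "T x = Re c *\<^sub>R x - Im c *\<^sub>R y"
    by (simp add: x_def y_def scaleR_left_diff_distrib scaleR_sum_right sum_subtractf)
  have "T y = (\<Sum>i<?N. Im (c * vec_index v i) *\<^sub>R ?b i)"
    unfolding y_def T_sum using ev(2) by (intro sum.cong) simp_all
  then have Ty: "T y = Re c *\<^sub>R y + Im c *\<^sub>R x"
    by (simp add: x_def y_def scaleR_left_distrib scaleR_sum_right sum.distrib)
  obtain i where i: "i < ?N" "vec_index v i \<noteq> 0" using v(1,2) by force
  have "inner x (?b i) = Re (vec_index v i)" "inner y (?b i) = Im (vec_index v i)"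
    unfolding x_def y_def using i(1) by (simp_all add: inner_sum_basis_list)
  then have "(x, y) \<noteq> 0" using i(2) by (auto simp: complex_eq_iff zero_prod_def)
  moreover have "(x, y) \<in> ceigenspace T c"
    by (simp add: ceigenspace_def cop_def cscale_def Tx Ty zero_prod_def)
  ultimately show ?thesis unfolding is_eigenvalue_def by blast
qed

section \<open>Double roots of the characteristic polynomial\<close>

lemma sum_const_poly: "(\<Sum>i\<in>I. [:f i:]) = [:\<Sum>i\<in>I. f i:]"
  by (induction I rule: infinite_finite_induct) auto

text \<open>Laplace expansion along column \<open>k\<close>, whose cofactors do not see that column.
  It shows the determinant to be linear in \<open>b\<close>, so that a common factor of
  \<open>b\<close> can be pulled out.\<close>

lemma det_replace_col:
  assumes A: "A \<in> carrier_mat n n" and k: "k < n"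
  shows "Determinant.det (replace_col A b k) = (\<Sum>i<n. vec_index b i * cofactor A i k)"
proof -
  have R: "replace_col A b k \<in> carrier_mat n n" using A by (auto simp: replace_col_def)
  have "cofactor (replace_col A b k) i k = cofactor A i k" if "i < n" for i
  proof -
    have "mat_delete (replace_col A b k) i k = mat_delete A i k"
      using that k A by (intro eq_matI) (auto simp: replace_col_def mat_delete_def)
    then show ?thesis by (simp add: cofactor_def)
  qed
  moreover have "replace_col A b k $$ (i, k) = vec_index b i" if "i < n" for i
    using that k A by (simp add: replace_col_def)
  ultimately show ?thesis using laplace_expansion_column[OF R k] by simp
qed

text \<open>By Cramer's rule the eigenvector \<open>u\<close> divides \<open>x - \<rho>\<close> out of \<open>\<chi>\<close>: for \<open>u\<^sub>k \<noteq> 0\<close>, the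
  quotient is up to a constant the determinant of \<open>x I - T\<close> with column \<open>k\<close> replaced by \<open>u\<close>.
  If it vanishes at \<open>\<rho>\<close>, a kernel vector of that matrix gives \<open>y\<close>.\<close>

lemma double_root_op_char_poly:
  fixes T :: "'a::euclidean_space \<Rightarrow> 'a"
  assumes T: "linear T" and u: "T u = \<rho> *\<^sub>R u" "u \<noteq> 0"
    and dvd: "[:- \<rho>, 1:] ^ 2 dvd op_char_poly T"
  shows "\<exists>y c. T y - \<rho> *\<^sub>R y = c *\<^sub>R u \<and> (\<forall>d. y \<noteq> d *\<^sub>R u)"
proof -
  let ?N = "DIM('a)" and ?b = "\<lambda>i. basis_list ! i :: 'a"
  define C where "C = char_poly_matrix (op_mat T)"
  have C: "C \<in> carrier_mat ?N ?N" unfolding C_def by simp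
  define U where "U = vec ?N (\<lambda>i. inner u (?b i))"
  define X where "X = vec ?N (\<lambda>i. [:inner u (?b i):])"
  have X: "X \<in> carrier_vec ?N" by (simp add: X_def)
  obtain k where k: "k < ?N" "inner u (?b k) \<noteq> 0"
  proof -
    have "\<exists>k<?N. inner u (?b k) \<noteq> 0"
    proof (rule ccontr)
      assume "\<not> ?thesis"
      then have "u = 0" using basis_list_representation[of u] by simp
      then show False using u(2) by simp
    qed
    then show ?thesis using that by blast
  qed
  have CX: "C *\<^sub>v X = [:- \<rho>, 1:] \<cdot>\<^sub>v X"
  proof (rule eq_vecI)
    fix i assume "i < dim_vec ([:- \<rho>, 1:] \<cdot>\<^sub>v X)"
    then have i: "i < ?N" by (simp add: X_def)
    have "vec_index (C *\<^sub>v X) i = (\<Sum>j<?N. C $$ (i, j) * [:inner u (?b j):])"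
      using i C by (auto simp: scalar_prod_def X_def atLeast0LessThan intro!: sum.cong)
    also have "\<dots> = (\<Sum>j<?N. (if j = i then [:0, 1:] * [:inner u (?b i):] else 0) +
        [:- (op_mat T $$ (i, j) * inner u (?b j)):])"
      using i unfolding C_def
      by (intro sum.cong refl)
        (auto simp: char_poly_matrix_op_mat_index algebra_simps)
    also have "\<dots> = [:0, 1:] * [:inner u (?b i):] + (\<Sum>j<?N. [:- (op_mat T $$ (i, j) * inner u (?b j)):])"
      using i by (simp add: sum.distrib)
    also have "(\<Sum>j<?N. [:- (op_mat T $$ (i, j) * inner u (?b j)):]) =
        [:- (\<Sum>j<?N. op_mat T $$ (i, j) * inner u (?b j)):]"
      by (simp only: sum_negf[symmetric] sum_const_poly)
    also have "(\<Sum>j<?N. op_mat T $$ (i, j) * inner u (?b j)) = inner (T u) (?b i)"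
      using i by (subst linear_eq_sum_basis_list[OF T, of u])
        (simp add: inner_sum_left mult.commute)
    finally show "vec_index (C *\<^sub>v X) i = vec_index ([:- \<rho>, 1:] \<cdot>\<^sub>v X) i"
      using i by (simp add: u(1) X_def)
  qed (use C in \<open>simp add: X_def\<close>)
  define \<Delta> where "\<Delta> = Determinant.det (replace_col C X k)"
  have "Determinant.det (replace_col C (C *\<^sub>v X) k) = vec_index X k * op_char_poly T"
    unfolding op_char_poly_def char_poly_def C_def[symmetric]
    by (rule cramer_lemma_mat[OF C X k(1)])
  moreover have "Determinant.det (replace_col C (C *\<^sub>v X) k) = [:- \<rho>, 1:] * \<Delta>"
    unfolding CX \<Delta>_def det_replace_col[OF C k(1)] sum_distrib_left
    using X by (intro sum.cong refl) (auto simp: mult.assoc simp del: mult_pCons_left)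
  moreover obtain g where "op_char_poly T = [:- \<rho>, 1:] * ([:- \<rho>, 1:] * g)"
    using dvd by (metis dvdE power2_eq_square mult.assoc)
  ultimately have "[:- \<rho>, 1:] * \<Delta> = [:- \<rho>, 1:] * (vec_index X k * ([:- \<rho>, 1:] * g))"
    by (simp only: ac_simps)
  then have "\<Delta> = vec_index X k * ([:- \<rho>, 1:] * g)"
    by (simp only: mult_cancel_left) auto
  then have "poly \<Delta> \<rho> = 0" by simp
  define M where "M = replace_col (mat ?N ?N (\<lambda>(i, j). poly (C $$ (i, j)) \<rho>)) U k"
  have M: "M \<in> carrier_mat ?N ?N" by (simp add: M_def replace_col_def)
  have "poly \<Delta> \<rho> = Determinant.det M"
    unfolding \<Delta>_def using C
    by (intro poly_det_cong[OF M]) (auto simp: M_def replace_col_def X_def U_def)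
  with \<open>poly \<Delta> \<rho> = 0\<close> obtain v where v: "v \<in> carrier_vec ?N" "v \<noteq> 0\<^sub>v ?N" "M *\<^sub>v v = 0\<^sub>v ?N"
    using det_0_iff_vec_prod_zero_field[OF M] by auto
  \<comment> \<open>Coordinate \<open>k\<close> of \<open>v\<close> multiplies the column that holds
    \<open>u\<close>, so it becomes the coefficient of \<open>u\<close>; the other coordinates form
    \<open>y\<close>. The value 0 at \<open>k\<close> keeps \<open>y\<close> off the line of
    \<open>u\<close>.\<close>
  define w where "w j = (if j = k then 0 else vec_index v j)" for j
  define y where "y = (\<Sum>j<?N. w j *\<^sub>R ?b j)"
  have coord: "\<rho> * inner y (?b i) - inner (T y) (?b i) + vec_index v k * inner u (?b i) = 0"
    if i: "i < ?N" for i
  proof -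
    have "0 = (\<Sum>j<?N. M $$ (i, j) * vec_index v j)"
      using arg_cong[OF v(3), of "\<lambda>x. vec_index x i"] i v(1) M
      by (simp add: scalar_prod_def atLeast0LessThan)
    also have "\<dots> = (\<Sum>j<?N. ((if j = i then \<rho> * w i else 0) - op_mat T $$ (i, j) * w j) +
        (if j = k then vec_index v k * inner u (?b i) else 0))"
      using i k C unfolding M_def w_def C_def
      by (intro sum.cong refl)
        (auto simp: char_poly_matrix_op_mat_index replace_col_def U_def algebra_simps)
    also have "\<dots> = \<rho> * w i - (\<Sum>j<?N. op_mat T $$ (i, j) * w j) + vec_index v k * inner u (?b i)"
      using i k by (simp add: sum.distrib sum_subtractf del: op_mat_index)
    also have "w i = inner y (?b i)" unfolding y_def using i by (simp add: inner_sum_basis_list)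
    also have "(\<Sum>j<?N. op_mat T $$ (i, j) * w j) = inner (T y) (?b i)"
      unfolding y_def linear_sum[OF T] linear_scale[OF T] inner_sum_left
      using i by (simp add: mult.commute)
    finally show ?thesis by simp
  qed
  have "T y - \<rho> *\<^sub>R y = vec_index v k *\<^sub>R u"
  proof (rule euclidean_eqI)
    fix b :: 'a assume "b \<in> Basis"
    then obtain i where "i < ?N" "b = ?b i"
      by (metis basis_list(2) in_set_conv_nth length_basis_list)
    then show "inner (T y - \<rho> *\<^sub>R y) b = inner (vec_index v k *\<^sub>R u) b"
      using coord[of i] by (simp add: inner_diff_left)
  qed
  moreover have "y \<noteq> d *\<^sub>R u" for d
  proof
    assume y: "y = d *\<^sub>R u"
    have "inner y (?b k) = w k" unfolding y_def using k(1) by (simp add: inner_sum_basis_list)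
    then have "d = 0" using k(2) y by (simp add: w_def)
    then have "y = 0" using y by simp
    then have "vec_index v k = 0"
      using calculation u(2) by (simp add: linear_0[OF T])
    moreover have "w j = 0" if "j < ?N" for j
      using inner_sum_basis_list[OF that, of w] \<open>y = 0\<close> by (simp add: y_def)
    ultimately have "vec_index v j = 0" if "j < ?N" for j
      using that by (metis w_def)
    then show False using v(1,2) by auto
  qed
  ultimately show ?thesis by blast
qed

text \<open>Signed volume, the source of orientations. The vectors are the columns, so an operator
  multiplies the matrix on the left and a change of frame on the right.\<close>

definition frame_det :: "(nat \<Rightarrow> 'a::euclidean_space) \<Rightarrow> real" where
  "frame_det f = Determinant.det (mat DIM('a) DIM('a) (\<lambda>(i, j). inner (f j) (basis_list ! i)))"

lemma frame_det_op:
  fixes T :: "'a::euclidean_space \<Rightarrow> 'a"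
  assumes T: "linear T"
  shows "frame_det (T \<circ> f) = op_det T * frame_det f"
proof -
  have "mat DIM('a) DIM('a) (\<lambda>(i, j). inner ((T \<circ> f) j) (basis_list ! i)) =
      op_mat T * mat DIM('a) DIM('a) (\<lambda>(i, j). inner (f j) (basis_list ! i))"
    by (rule eq_matI)
      (auto simp: scalar_prod_def atLeast0LessThan linear_eq_sum_basis_list[OF T, of "f _"]
        inner_sum_left mult.commute)
  then show ?thesis
    unfolding frame_det_def op_det_def
    by (simp add: Determinant.det_mult[OF op_mat_carrier])
qed

lemma frame_det_change:
  fixes f :: "nat \<Rightarrow> 'a::euclidean_space"
  assumes M: "M \<in> carrier_mat DIM('a) DIM('a)"
    and g: "\<And>j. j < DIM('a) \<Longrightarrow> g j = (\<Sum>i<DIM('a). M $$ (i, j) *\<^sub>R f i)"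
  shows "frame_det g = frame_det f * Determinant.det M"
proof -
  have "mat DIM('a) DIM('a) (\<lambda>(i, j). inner (g j) (basis_list ! i)) =
      mat DIM('a) DIM('a) (\<lambda>(i, j). inner (f j) (basis_list ! i)) * M"
    using M by (intro eq_matI)
      (auto simp: scalar_prod_def atLeast0LessThan g inner_sum_left mult.commute intro!: sum.cong)
  then show ?thesis
    unfolding frame_det_def using Determinant.det_mult[OF _ M] by simp
qed

lemma frame_det_zero_imp_dependent:
  fixes f :: "nat \<Rightarrow> 'a::euclidean_space"
  assumes "frame_det f = 0"
  shows "\<exists>c. (\<exists>i<DIM('a). c i \<noteq> 0) \<and> (\<Sum>i<DIM('a). c i *\<^sub>R f i) = 0"
proof -
  let ?F = "mat DIM('a) DIM('a) (\<lambda>(i, j). inner (f j) (basis_list ! i))"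
  obtain v where v: "v \<in> carrier_vec DIM('a)" "v \<noteq> 0\<^sub>v DIM('a)" "?F *\<^sub>v v = 0\<^sub>v DIM('a)"
    using assms det_0_iff_vec_prod_zero_field[of ?F "DIM('a)"] unfolding frame_det_def by auto
  have "\<exists>i<DIM('a). vec_index v i \<noteq> 0" using v(1,2) by force
  moreover have "(\<Sum>i<DIM('a). vec_index v i *\<^sub>R f i) = 0"
  proof (rule euclidean_eqI)
    fix b :: 'a assume "b \<in> Basis"
    then obtain i where i: "i < DIM('a)" "b = basis_list ! i"
      by (metis basis_list(2) in_set_conv_nth length_basis_list)
    have "vec_index (?F *\<^sub>v v) i = (\<Sum>j<DIM('a). inner (f j) b * vec_index v j)"
      using i v(1) by (simp add: scalar_prod_def atLeast0LessThan)
    then show "inner (\<Sum>i<DIM('a). vec_index v i *\<^sub>R f i) b = inner 0 b"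
      using i v(3) by (simp add: inner_sum_left mult.commute)
  qed
  ultimately show ?thesis by blast
qed

lemma continuous_on_frame_det:
  fixes f :: "'b::topological_space \<Rightarrow> nat \<Rightarrow> 'a::euclidean_space"
  assumes "\<And>j. j < DIM('a) \<Longrightarrow> continuous_on S (\<lambda>x. f x j)"
  shows "continuous_on S (\<lambda>x. frame_det (f x))"
proof -
  \<comment> \<open>The guard holds for every permutation; it makes the bound on \<open>p i\<close>,
    which the continuity assumption asks for, a part of the term.\<close>
  have "frame_det (f x) = (\<Sum>p\<in>{p. p permutes {0..<DIM('a)}}.
      signof p * (\<Prod>i\<in>{0..<DIM('a)}. if p i < DIM('a) then inner (f x (p i)) (basis_list ! i) else 0))" for x
    unfolding frame_det_def
    by (subst det_def'[of _ "DIM('a)"]) (auto intro!: sum.cong prod.cong dest: permutes_in_image)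
  then show ?thesis
    by (simp only:) (intro continuous_intros, auto intro!: continuous_intros assms)
qed

section \<open>Real polynomials with roots on the unit circle\<close>

text \<open>Induction on the degree: a complex root \<open>z\<close> yields the real factor
  \<open>x - 1\<close>, \<open>x + 1\<close> or, if it is not real, \<open>x^2 - 2 a x + 1\<close>
  with \<open>a = Re z\<close>, the constant term being \<open>|z|^2 = 1\<close>. Indexing the
  quadratic factors by the set of their \<open>a\<close> makes these distinct by
  construction.\<close>

lemma unit_circle_factorization_aux:
  fixes p :: "real poly"
  assumes "monic p" "\<And>z. poly (map_poly complex_of_real p) z = 0 \<Longrightarrow> cmod z = 1"
  shows "\<exists>l m A f. finite A \<and> (\<forall>a\<in>A. \<bar>a\<bar> < 1 \<and> f a \<ge> (1::nat)) \<and>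
    p = [:-1, 1:] ^ l * [:1, 1:] ^ m * (\<Prod>a\<in>A. [:1, - 2 * a, 1:] ^ f a)"
  using assms
proof (induction "degree p" arbitrary: p rule: less_induct)
  case less
  interpret h: map_poly_comm_ring_hom "of_real :: real \<Rightarrow> complex" ..
  have hom: "map_poly complex_of_real (q * g) = map_poly complex_of_real q * map_poly complex_of_real g" for q g
    by (rule h.hom_mult)
  have step: "\<exists>l m A f. finite A \<and> (\<forall>a\<in>A. \<bar>a\<bar> < 1 \<and> f a \<ge> (1::nat)) \<and>
      g = [:-1, 1:] ^ l * [:1, 1:] ^ m * (\<Prod>a\<in>A. [:1, - 2 * a, 1:] ^ f a)"
    if g: "p = q * g" and q: "monic q" "degree q > 0" for q g
  proof (rule less.hyps)
    have "g \<noteq> 0" "q \<noteq> 0" using less.prems(1) g by auto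
    then show "degree g < degree p" using q(2) by (simp add: g degree_mult_eq)
    show "monic g" using less.prems(1) q(1) by (simp add: g lead_coeff_mult)
    show "\<And>z. poly (map_poly complex_of_real g) z = 0 \<Longrightarrow> cmod z = 1"
      using less.prems(2) by (simp add: g hom)
  qed
  show ?case
  proof (cases "degree p = 0")
    case True
    then have "p = 1" using less.prems(1) by (metis monic_degree_0)
    then have "p = [:-1, 1:] ^ 0 * [:1, 1:] ^ 0 * (\<Prod>a\<in>{}. [:1, - 2 * a, 1:] ^ 0)" by simp
    moreover have "finite {}" "\<forall>a\<in>{}. \<bar>a\<bar> < 1 \<and> 0 \<ge> (1::nat)" by simp_all
    ultimately show ?thesis by (intro exI conjI)
  next
    case False
    then obtain z where z: "poly (map_poly complex_of_real p) z = 0"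
      using fundamental_theorem_of_algebra[of "map_poly complex_of_real p"]
      by (auto simp: constant_degree)
    have "cmod z = 1" using less.prems(2) z by blast
    show ?thesis
    proof (cases "Im z = 0")
      case True
      then have zr: "z = of_real (Re z)" by (simp add: complex_eq_iff)
      then have "poly p (Re z) = 0"
        using z by (metis of_real_eq_0_iff of_real_hom.poly_map_poly)
      moreover have "Re z = 1 \<or> Re z = - 1"
        using \<open>cmod z = 1\<close> zr by (metis abs_1 abs_eq_iff norm_of_real)
      ultimately consider "poly p 1 = 0" | "poly p (- 1) = 0" by auto
      then show ?thesis
      proof cases
        case 1
        then obtain g where g: "p = [:-1, 1:] * g" by (metis poly_eq_0_iff_dvd dvdE)
        obtain l m A f where *: "finite A" "\<forall>a\<in>A. \<bar>a\<bar> < 1 \<and> f a \<ge> (1::nat)"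
          "g = [:-1, 1:] ^ l * [:1, 1:] ^ m * (\<Prod>a\<in>A. [:1, - 2 * a, 1:] ^ f a)"
          using step[OF g] by auto
        have "p = [:-1, 1:] ^ Suc l * [:1, 1:] ^ m * (\<Prod>a\<in>A. [:1, - 2 * a, 1:] ^ f a)"
          unfolding g *(3) by (simp only: power_Suc mult.assoc)
        with *(1,2) show ?thesis by (intro exI conjI)
      next
        case 2
        then obtain g where g: "p = [:1, 1:] * g"
          by (metis poly_eq_0_iff_dvd dvdE minus_minus)
        obtain l m A f where *: "finite A" "\<forall>a\<in>A. \<bar>a\<bar> < 1 \<and> f a \<ge> (1::nat)"
          "g = [:-1, 1:] ^ l * [:1, 1:] ^ m * (\<Prod>a\<in>A. [:1, - 2 * a, 1:] ^ f a)"
          using step[OF g] by auto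
        have "p = [:-1, 1:] ^ l * [:1, 1:] ^ Suc m * (\<Prod>a\<in>A. [:1, - 2 * a, 1:] ^ f a)"
          unfolding g *(3) by (simp only: power_Suc mult.left_commute mult.assoc)
        with *(1,2) show ?thesis by (intro exI conjI)
      qed
    next
      case False
      define a where "a = Re z"
      define q where "q = [:1, - 2 * a, 1:]"
      have norm: "(Re z)\<^sup>2 + (Im z)\<^sup>2 = 1"
        using \<open>cmod z = 1\<close> by (simp add: cmod_power2[symmetric])
      have "a\<^sup>2 < 1" using norm False unfolding a_def by (smt (verit) zero_less_power2)
      then have a: "\<bar>a\<bar> < 1" by (simp add: abs_square_less_1)
      have qz: "poly (map_poly complex_of_real q) z = 0"
        using norm
        by (auto simp: q_def a_def map_poly_pCons complex_eq_iff power2_eq_square algebra_simps)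
      \<comment> \<open>A real polynomial of degree at most 1 that vanishes at the nonreal
        \<open>z\<close> is zero, so \<open>q\<close> divides \<open>p\<close>.\<close>
      have deg: "degree (p mod q) < 2"
        using degree_mod_less[of q p] by (auto simp: q_def)
      then obtain r0 r1 where r: "p mod q = [:r0, r1:]"
        by (metis degree_eq_zeroE degree1_coeffs less_2_cases One_nat_def pCons_0_0)
      have "map_poly complex_of_real p = map_poly complex_of_real q * map_poly complex_of_real (p div q) +
          map_poly complex_of_real (p mod q)"
        by (simp flip: hom h.hom_add)
      then have "poly (map_poly complex_of_real (p mod q)) z = 0"
        using z qz by simp
      then have "r1 * Im z = 0" "r0 + r1 * Re z = 0"
        unfolding r by (auto simp: of_real_hom.map_poly_pCons_hom complex_eq_iff algebra_simps)
      then have "p mod q = 0" using False r by simp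
      then obtain g where g: "p = q * g" by (metis dvdE mod_eq_0_iff_dvd)
      obtain l m A f where *: "finite A" "\<forall>a\<in>A. \<bar>a\<bar> < 1 \<and> f a \<ge> (1::nat)"
        "g = [:-1, 1:] ^ l * [:1, 1:] ^ m * (\<Prod>a\<in>A. [:1, - 2 * a, 1:] ^ f a)"
        using step[OF g] by (auto simp: q_def)
      \<comment> \<open>A value that is already present gains one in its exponent; a new one enters
        with exponent 1.\<close>
      define f' where "f' = (\<lambda>b. if b = a then (if a \<in> A then Suc (f a) else 1) else f b)"
      have "(\<Prod>b\<in>insert a A. [:1, - 2 * b, 1:] ^ f' b) =
          [:1, - 2 * a, 1:] ^ f' a * (\<Prod>b\<in>A - {a}. [:1, - 2 * b, 1:] ^ f' b)"
        using *(1) by (simp only: prod.insert_remove)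
      also have "(\<Prod>b\<in>A - {a}. [:1, - 2 * b, 1:] ^ f' b) = (\<Prod>b\<in>A - {a}. [:1, - 2 * b, 1:] ^ f b)"
        by (intro prod.cong) (auto simp: f'_def)
      also have "[:1, - 2 * a, 1:] ^ f' a * \<dots> = q * (\<Prod>b\<in>A. [:1, - 2 * b, 1:] ^ f b)"
      proof (cases "a \<in> A")
        case True
        then have "f' a = Suc (f a)" by (simp add: f'_def)
        then show ?thesis
          unfolding prod.remove[OF *(1) True] q_def by (simp only: power_Suc mult.assoc)
      next
        case False
        then have "f' a = 1" "A - {a} = A" by (auto simp: f'_def)
        then show ?thesis unfolding q_def by (simp only: power_one_right)
      qed
      finally have "p = [:-1, 1:] ^ l * [:1, 1:] ^ m * (\<Prod>b\<in>insert a A. [:1, - 2 * b, 1:] ^ f' b)"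
        by (simp only: g *(3) ac_simps)
      moreover have "\<forall>b\<in>insert a A. \<bar>b\<bar> < 1 \<and> f' b \<ge> 1" using * a by (auto simp: f'_def)
      moreover have "finite (insert a A)" using * by simp
      ultimately show ?thesis by blast
    qed
  qed
qed

lemma unit_circle_factorization:
  fixes p :: "real poly"
  assumes "monic p" "\<And>z. poly (map_poly complex_of_real p) z = 0 \<Longrightarrow> cmod z = 1"
  obtains l m s a r where "rotation_data s a r" "p = [:-1, 1:] ^ l * [:1, 1:] ^ m * rotation_poly s a r"
proof -
  obtain l m A f where *: "finite A" "\<forall>a\<in>A. \<bar>a\<bar> < 1 \<and> f a \<ge> (1::nat)"
    "p = [:-1, 1:] ^ l * [:1, 1:] ^ m * (\<Prod>a\<in>A. [:1, - 2 * a, 1:] ^ f a)"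
    using unit_circle_factorization_aux[OF assms] by blast
  obtain h where h: "bij_betw h {1..card A} A"
    using ex_bij_betw_nat_finite_1[OF *(1)] by blast
  have "rotation_poly (card A) h (f \<circ> h) = (\<Prod>a\<in>A. [:1, - 2 * a, 1:] ^ f a)"
    unfolding rotation_poly_def prod.reindex_bij_betw[OF h, symmetric] by simp
  moreover have "rotation_data (card A) h (f \<circ> h)"
    using h *(2) unfolding rotation_data_def bij_betw_def by auto
  ultimately show ?thesis by (intro that[of "card A" h "f \<circ> h" l m]) (simp_all only: *(3))
qed

text \<open>The factors take the values \<open>2 - 2 * a j\<close> at 1 and
  \<open>2 + 2 * a j\<close> at -1. Hence \<open>l\<close> and \<open>m\<close> are the exact
  multiplicities of the roots 1 and -1.\<close>

lemma poly_rotation_poly_nonzero: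
  assumes "rotation_data s a r" "t = 1 \<or> t = - 1"
  shows "poly (rotation_poly s a r) t \<noteq> 0"
proof -
  have "poly [:1, - 2 * a j, 1:] t \<noteq> 0" if "j \<in> {1..s}" for j
  proof -
    have "\<bar>a j\<bar> < 1" using assms(1) that by (auto simp: rotation_data_def)
    then show ?thesis using assms(2) by (auto simp: algebra_simps)
  qed
  then show ?thesis by (simp add: rotation_poly_def poly_prod)
qed

lemma poly_rotation_poly_0: "poly (rotation_poly s a r) 0 = 1"
  by (simp add: rotation_poly_def poly_prod)

lemma even_degree_rotation_poly: "even (degree (rotation_poly s a r))"
  unfolding rotation_poly_def
  by (subst degree_prod_eq_sum_degree) (auto simp: degree_power_eq intro!: dvd_sum)

lemma order_linear_power: "order c ([:- c, 1:] ^ k) = k"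
  by (rule order_power_n_n)

text \<open>The factor \<open>h\<close> covers all types at once: it is 1 in the elliptic and
  parabolic cases and \<open>(x - r) (x - 1 / r)\<close> in the hyperbolic one.\<close>

lemma order_minus_one_factorization:
  fixes h :: "real poly"
  assumes "rotation_data s a r" "poly h (- 1) \<noteq> 0"
  shows "order (- 1) ([:-1, 1:] ^ l * [:1, 1:] ^ m * (h * rotation_poly s a r)) = m"
proof -
  let ?g = "[:-1, 1:] ^ l * (h * rotation_poly s a r)"
  have "poly ?g (- 1) \<noteq> 0"
    using assms poly_rotation_poly_nonzero[OF assms(1), of "- 1"] by simp
  then have g: "order (- 1) ?g = 0" "?g \<noteq> 0" by (auto simp: order_0I)
  have nz: "[:- (- 1), 1:] ^ m * ?g \<noteq> 0" using g(2) by auto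
  have "[:-1, 1:] ^ l * [:1, 1:] ^ m * (h * rotation_poly s a r) = [:- (- 1), 1:] ^ m * ?g"
    unfolding minus_minus by (metis mult.assoc mult.commute)
  also have "order (- 1) \<dots> = m"
    unfolding order_mult[OF nz] order_linear_power g(1) by simp
  finally show ?thesis .
qed

text \<open>Yields the lower bounds for \<open>l\<close>, with \<open>k = 1\<close> in the elliptic
  and \<open>k = 3\<close> in the parabolic case.\<close>

lemma root_one_multiplicity_factorization:
  fixes k :: nat
  assumes "rotation_data s a r" "[:-1, 1:] ^ k dvd [:-1, 1:] ^ l * [:1, 1:] ^ m * rotation_poly s a r"
  shows "k \<le> l"
proof -
  let ?g = "[:1, 1:] ^ m * rotation_poly s a r"
  have g: "poly ?g 1 \<noteq> 0" using poly_rotation_poly_nonzero[OF assms(1), of 1] by simp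
  then have g': "order 1 ?g = 0" "?g \<noteq> 0" by (auto simp: order_0I)
  then have nz: "[:- 1, 1:] ^ l * ?g \<noteq> 0" by simp
  have "k \<le> order 1 ([:- 1, 1:] ^ l * ?g)"
    using assms(2) nz unfolding mult.assoc by (auto simp: order_divides)
  also have "\<dots> = l" unfolding order_mult[OF nz] order_linear_power g'(1) by simp
  finally show ?thesis .
qed

text \<open>Up to the sign \<open>(-1)^DIM('a)\<close> the determinant is the constant term of the
  characteristic polynomial, here \<open>(-1)^l\<close>; and the dimension has the parity of
  \<open>l + m\<close>, as the remaining factors have even degree.\<close>

lemma det_sign_factorization:
  fixes T :: "'a::euclidean_space \<Rightarrow> 'a"
  assumes "op_char_poly T = [:-1, 1:] ^ l * [:1, 1:] ^ m * (h * rotation_poly s a r)"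
    and "poly h 0 = 1" "even (degree h)"
  shows "op_det T = (- 1) ^ m"
proof -
  have nz: "h \<noteq> 0" "rotation_poly s a r \<noteq> 0" using assms(2) poly_rotation_poly_0[of s a r] by auto
  have "DIM('a) = degree ([:-1, 1:] ^ l * [:1, 1:] ^ m * (h * rotation_poly s a r))"
    using degree_op_char_poly[of T] by (simp only: assms(1))
  also have "\<dots> = l + m + (degree h + degree (rotation_poly s a r))"
    using nz by (simp add: degree_mult_eq degree_power_eq)
  finally have dim: "even DIM('a) \<longleftrightarrow> even (l + m)"
    using assms(3) even_degree_rotation_poly[of s a r] by presburger
  have "(- 1) ^ DIM('a) * op_det T = (- 1 :: real) ^ l"
    using poly_op_char_poly_0[of T] unfolding assms(1)
    by (simp add: assms(2) poly_rotation_poly_0)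
  then show ?thesis using dim by (auto simp: minus_one_power_iff split: if_splits)
qed

section \<open>Semisimple operators and the Jordan decomposition\<close>

text \<open>Choose an invariant complement of the kernel of \<open>F\<close>. Then
  \<open>F x\<close> depends only on the component of \<open>x\<close> in it, so \<open>F x\<close>
  lies both in the complement and in the kernel. The assumption \<open>inv\<close> is met by
  polynomials in \<open>S\<close>.\<close>

lemma semisimple_kernel_square:
  assumes S: "semisimple_op S" "linear S" and F: "linear F" "\<And>x. F (S x) = S (F x)"
    and inv: "\<And>W. subspace W \<Longrightarrow> S ` W \<subseteq> W \<Longrightarrow> F ` W \<subseteq> W"
    and x: "F (F x) = 0"
  shows "F x = 0"
proof -
  let ?W = "{x. F x = 0}"
  have "subspace ?W" by (rule linear_subspace_kernel[OF F(1)])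
  moreover have "S ` ?W \<subseteq> ?W" using F(2) by (auto simp: linear_0[OF S(2)])
  ultimately obtain C where C: "subspace C" "S ` C \<subseteq> C" "?W \<inter> C = {0}"
    "{w + u | w u. w \<in> ?W \<and> u \<in> C} = UNIV"
    using S(1) unfolding semisimple_op_def by meson
  obtain w c where wc: "x = w + c" "F w = 0" "c \<in> C" using C(4) by blast
  then have "F x = F c" by (simp add: linear_add[OF F(1)])
  moreover have "F c \<in> C" using inv[OF C(1,2)] wc(3) by blast
  ultimately have "F x \<in> ?W \<inter> C" using x by auto
  then show ?thesis using C(3) by blast
qed

text \<open>Semisimplicity speaks of real subspaces only. So \<open>c\<close> is replaced by its
  real minimal polynomial, evaluated at \<open>S\<close>: \<open>F = S - c\<close> for real
  \<open>c\<close>, and \<open>F = S^2 - 2 (Re c) S + |c|^2\<close> otherwise.\<close>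

lemma semisimple_eigenspace_step:
  assumes S: "semisimple_op S" "linear S"
    and z: "cop S (cop S z - cscale c z) = cscale c (cop S z - cscale c z)"
  shows "cop S z = cscale c z"
proof (cases "Im c = 0")
  case True
  define F where "F x = S x - Re c *\<^sub>R x" for x
  have lin: "linear F" unfolding F_def
    by (intro linear_compose_sub linear_scaleR S) 
  have zero: "F x = 0" if "F (F x) = 0" for x
  proof (rule semisimple_kernel_square[OF S lin _ _ that])
    show "F (S x) = S (F x)" for x
      by (simp add: F_def linear_diff[OF S(2)] linear_scale[OF S(2)])
    show "F ` W \<subseteq> W" if "subspace W" "S ` W \<subseteq> W" for W
      using that by (auto simp: F_def intro!: subspace_diff subspace_scale)
  qed
  from True have c: "cop S w - cscale c w = (F (fst w), F (snd w))" for w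
    by (simp add: cop_def cscale_def F_def)
  from z have "cop S (cop S z - cscale c z) - cscale c (cop S z - cscale c z) = 0" by simp
  then have "F (F (fst z)) = 0" "F (F (snd z)) = 0" by (simp_all add: c zero_prod_def)
  then have "cop S z - cscale c z = 0" unfolding c using zero by (simp add: zero_prod_def)
  then show ?thesis by simp
next
  case False
  let ?a = "Re c" and ?b = "Im c"
  define p where "p = ?a + ?a"
  have p: "p *\<^sub>R w = ?a *\<^sub>R w + ?a *\<^sub>R w"
    "(p * t) *\<^sub>R w = (?a * t) *\<^sub>R w + (?a * t) *\<^sub>R w" for t and w :: 'a
    by (simp_all only: p_def scaleR_left_distrib distrib_right)
  define F where "F x = S (S x) - p *\<^sub>R S x + (?a\<^sup>2 + ?b\<^sup>2) *\<^sub>R x" for x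
  have lin: "linear F"
    unfolding F_def
    by (rule linearI)
      (simp_all add: linear_add[OF S(2)] linear_scale[OF S(2)] algebra_simps)
  have zero: "F x = 0" if "F (F x) = 0" for x
  proof (rule semisimple_kernel_square[OF S lin _ _ that])
    show "F (S x) = S (F x)" for x
      by (simp add: F_def linear_add[OF S(2)] linear_diff[OF S(2)] linear_scale[OF S(2)])
    show "F ` W \<subseteq> W" if "subspace W" "S ` W \<subseteq> W" for W
      using that by (auto simp: F_def image_subset_iff
          intro!: subspace_diff subspace_add subspace_scale)
  qed
  obtain x y where xy: "z = (x, y)" by fastforce
  \<comment> \<open>\<open>(u, v)\<close> stands for \<open>(S - c) z\<close>, on which
    \<open>S\<close> acts as \<open>c\<close>. Since \<open>F = (S - conj c) (S - c)\<close>,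
    \<open>F\<close> kills \<open>u\<close> and \<open>v\<close>, and it maps \<open>z\<close> to
    \<open>(c - conj c)\<close> times \<open>(u, v)\<close>, a nonzero multiple.\<close>
  define u v where "u = S x - ?a *\<^sub>R x + ?b *\<^sub>R y" and "v = S y - ?a *\<^sub>R y - ?b *\<^sub>R x"
  have uv: "cop S z - cscale c z = (u, v)"
    by (simp add: xy cop_def cscale_def u_def v_def)
  have Su: "S u = ?a *\<^sub>R u - ?b *\<^sub>R v" and Sv: "S v = ?a *\<^sub>R v + ?b *\<^sub>R u"
    using z unfolding uv by (simp_all add: cop_def cscale_def)
  have Fx: "F x = S u - ?a *\<^sub>R u - ?b *\<^sub>R v" and Fy: "F y = S v - ?a *\<^sub>R v + ?b *\<^sub>R u"
    by (simp_all add: F_def u_def v_def linear_add[OF S(2)] linear_diff[OF S(2)]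
        linear_scale[OF S(2)] algebra_simps power2_eq_square p)
  have "F u = 0" "F v = 0"
    by (simp_all add: F_def Su Sv linear_add[OF S(2)] linear_diff[OF S(2)]
        linear_scale[OF S(2)] algebra_simps power2_eq_square p)
  moreover have FxFy: "F x = - (?b *\<^sub>R v + ?b *\<^sub>R v)" "F y = ?b *\<^sub>R u + ?b *\<^sub>R u"
    by (simp_all add: Fx Fy Su Sv algebra_simps)
  ultimately have "F (F x) = 0" "F (F y) = 0"
    by (simp_all add: linear_scale[OF lin] linear_add[OF lin] linear_diff[OF lin] linear_neg[OF lin])
  then have "F x = 0" "F y = 0" using zero by auto
  then have "u = 0" "v = 0" using FxFy False by (auto simp flip: scaleR_2)
  then show ?thesis using uv by (metis eq_iff_diff_eq_0 zero_prod_def)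
qed

lemma semisimple_eigenspace:
  assumes S: "semisimple_op S" "linear S"
    and z: "((\<lambda>w. cop S w - cscale c w) ^^ k) z = 0"
  shows "cop S z = cscale c z"
  using z
proof (induction k arbitrary: z)
  case 0
  then show ?case
    using linear_0[OF S(2)] by (simp add: cop_def cscale_def zero_prod_def)
next
  case (Suc k)
  from Suc.prems have "((\<lambda>w. cop S w - cscale c w) ^^ k) (cop S z - cscale c z) = 0"
    by (simp only: funpow_Suc_right comp_apply)
  from Suc.IH[OF this] show ?case by (rule semisimple_eigenspace_step[OF S])
qed

section \<open>Uniqueness of the Jordan decomposition\<close>

lemma linear_funpow:
  fixes F :: "'b::real_vector \<Rightarrow> 'b"
  shows "linear F \<Longrightarrow> linear (F ^^ i)"
proof (induction i)
  case 0
  show ?case by (simp add: linear_ident)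
next
  case (Suc i)
  then show ?case unfolding funpow.simps by (intro linear_compose) auto
qed

text \<open>Induction on \<open>k + m\<close> replaces the binomial formula: one application of
  \<open>A + B\<close> turns \<open>x\<close> into \<open>A x\<close>, for which \<open>k\<close>
  drops by one, plus \<open>B x\<close>, for which \<open>m\<close> drops by one.\<close>

lemma commuting_sum_funpow_zero:
  fixes A B :: "'b::real_vector \<Rightarrow> 'b"
  assumes lin: "linear A" "linear B" and comm: "\<And>x. A (B x) = B (A x)"
    and x: "(A ^^ k) x = 0" "(B ^^ m) x = 0"
  shows "((\<lambda>w. A w + B w) ^^ (k + m)) x = 0"
  using x
proof (induction "k + m" arbitrary: k m x)
  case 0
  then show ?case by simp
next
  case (Suc n)
  have lin': "linear ((\<lambda>w. A w + B w) ^^ i)" for i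
    by (intro linear_funpow linear_compose_add lin)
  have zero: "F x = 0" if "linear F" "x = 0" for F :: "'b \<Rightarrow> 'b" and x
    using that linear_0 by blast
  have A_pow: "(A ^^ i) (B y) = B ((A ^^ i) y)" for i y
    by (induction i) (simp_all add: comm)
  have B_pow: "(B ^^ i) (A y) = A ((B ^^ i) y)" for i y
    by (induction i) (simp_all add: comm[symmetric])
  show ?case
  proof (cases "k = 0 \<or> m = 0")
    case True
    then have "x = 0" using Suc.prems by auto
    then show ?thesis using zero[OF lin'] by blast
  next
    case False
    then obtain k' m' where km: "k = Suc k'" "m = Suc m'" by (meson not0_implies_Suc)
    have 1: "((\<lambda>w. A w + B w) ^^ n) (A x) = 0"
    proof -
      have "n = k' + m" using Suc.hyps(2) km by simp
      moreover have "(A ^^ k') (A x) = 0" using Suc.prems(1) km by (simp add: funpow_swap1)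
      moreover have "(B ^^ m) (A x) = 0" using Suc.prems(2) by (simp add: B_pow linear_0[OF lin(1)])
      ultimately show ?thesis using Suc.hyps(1)[of k' m "A x"] by simp
    qed
    have 2: "((\<lambda>w. A w + B w) ^^ n) (B x) = 0"
    proof -
      have "n = k + m'" using Suc.hyps(2) km by simp
      moreover have "(B ^^ m') (B x) = 0" using Suc.prems(2) km by (simp add: funpow_swap1)
      moreover have "(A ^^ k) (B x) = 0" using Suc.prems(1) by (simp add: A_pow linear_0[OF lin(2)])
      ultimately show ?thesis using Suc.hyps(1)[of k m' "B x"] by simp
    qed
    have "((\<lambda>w. A w + B w) ^^ Suc n) x = ((\<lambda>w. A w + B w) ^^ n) (A x + B x)"
      by (simp only: funpow_Suc_right comp_apply)
    also have "\<dots> = 0" by (simp only: linear_add[OF lin'] 1 2 add_0)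
    finally show ?thesis using Suc.hyps(2) by simp
  qed
qed

text \<open>By the Cayley-Hamilton theorem the characteristic polynomial kills every vector, so the
  primary decomposition reaches the whole complexification.\<close>

lemma complex_vector_induct:
  fixes T :: "'a::euclidean_space \<Rightarrow> 'a"
  assumes "linear T"
    and "\<And>x y. P x \<Longrightarrow> P y \<Longrightarrow> P (x + y)"
    and "\<And>c k w. ((\<lambda>w. cop T w - cscale c w) ^^ k) w = 0 \<Longrightarrow> P w"
  shows "P z"
proof (rule primary_decomposition_induct[OF linear_endo_complex[OF assms(1)], where P = P])
  have "op_char_poly T \<noteq> 0" using op_char_poly_monic[of T] by auto
  then show "map_poly complex_of_real (op_char_poly T) \<noteq> 0" by simp
  show "linear_endo.gpoly cscale (cop T) (map_poly complex_of_real (op_char_poly T)) z = 0"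
    using poly_op_complexify[OF assms(1), of _ "fst z" "snd z"] op_cayley_hamilton[OF assms(1)]
    by (simp add: zero_prod_def)
qed (use assms in blast)+

lemma linear_cop: "linear T \<Longrightarrow> linear (cop T)"
  by (rule linearI) (auto simp: cop_def linear_add linear_scale)

lemma linear_cscale: "linear (cscale c)"
  by (rule linearI) (auto simp: cscale_def algebra_simps)

lemma cop_cscale: "linear T \<Longrightarrow> cop T (cscale c z) = cscale c (cop T z)"
  by (simp add: cop_def cscale_def linear_add linear_diff linear_scale)

lemma eigenvalue_of_funpow_zero:
  fixes T :: "'a::euclidean_space \<Rightarrow> 'a"
  assumes "((\<lambda>w. cop T w - cscale c w) ^^ k) z = 0" "z \<noteq> 0"
  shows "is_eigenvalue T c"
  using assms
proof (induction k arbitrary: z)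
  case 0
  then show ?case by simp
next
  case (Suc k)
  show ?case
  proof (cases "cop T z - cscale c z = 0")
    case True
    then show ?thesis using Suc.prems(2) unfolding is_eigenvalue_def ceigenspace_def by blast
  next
    case False
    moreover have "((\<lambda>w. cop T w - cscale c w) ^^ k) (cop T z - cscale c z) = 0"
      using Suc.prems(1) by (simp only: funpow_Suc_right comp_apply)
    ultimately show ?thesis by (rule Suc.IH[rotated])
  qed
qed

lemma cscale_one [simp]: "cscale 1 z = z"
  by (simp add: cscale_def)

text \<open>A nonzero generalized eigenvector can only belong to \<open>c = 1\<close>, and for a sum
  of two vectors the exponents are added. The exponent may depend on \<open>z\<close>.\<close>

lemma unipotent_nilpotent:
  fixes U :: "'a::euclidean_space \<Rightarrow> 'a"
  assumes U: "linear U" "unipotent_op U"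
  shows "\<exists>k. ((\<lambda>w. cop U w - w) ^^ k) z = 0"
proof (rule complex_vector_induct[OF U(1), where P = "\<lambda>z. \<exists>k. ((\<lambda>w. cop U w - w) ^^ k) z = 0"])
  let ?N = "\<lambda>w. cop U w - w"
  have lin: "linear (?N ^^ i)" for i
    by (intro linear_funpow linear_compose_sub linear_cop U linear_ident)
  show "\<exists>k. (?N ^^ k) (x + y) = 0" if x: "\<exists>k. (?N ^^ k) x = 0" and y: "\<exists>k. (?N ^^ k) y = 0" for x y
  proof -
    from x y obtain k m where "(?N ^^ k) x = 0" "(?N ^^ m) y = 0" by blast
    then have "(?N ^^ (m + k)) x = 0" "(?N ^^ (k + m)) y = 0"
      by (simp_all add: funpow_add linear_0[OF lin])
    then have "(?N ^^ (k + m)) (x + y) = 0" by (simp add: linear_add[OF lin] add.commute)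
    then show ?thesis by blast
  qed
  show "\<exists>k. (?N ^^ k) w = 0" if w: "((\<lambda>w. cop U w - cscale c w) ^^ k) w = 0" for c k w
  proof (cases "w = 0")
    case True
    then show ?thesis by (intro exI[of _ 0]) simp
  next
    case False
    then have "c = 1" using eigenvalue_of_funpow_zero[OF w] U(2) by (simp add: unipotent_op_def)
    then show ?thesis using w by auto
  qed
qed

text \<open>\<open>S - c\<close> is the sum of the commuting operators \<open>T - c\<close> and
  \<open>S - T = S (1 - U)\<close>. Powers of both kill \<open>z\<close>, the second because
  \<open>U\<close> is unipotent. So \<open>z\<close> is a generalized eigenvector of
  \<open>S\<close>, hence an eigenvector. Thus \<open>T\<close> determines \<open>S\<close> on its
  generalized eigenvectors.\<close>

lemma jordan_semisimple_part_eigenvector: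
  fixes T :: "'a::euclidean_space \<Rightarrow> 'a"
  assumes jd: "jordan_decomposition T S U" and z: "((\<lambda>w. cop T w - cscale c w) ^^ k) z = 0"
  shows "cop S z = cscale c z"
proof -
  have S: "linear S" "semisimple_op S" and U: "linear U" "unipotent_op U"
    and T: "T = S \<circ> U" and comm: "S \<circ> U = U \<circ> S"
    using jd by (auto simp: jordan_decomposition_def)
  have comm': "cop U (cop S w) = cop S (cop U w)" for w
    using comm by (metis cop_compose)
  have Tw: "cop T w = cop S (cop U w)" for w by (simp add: T cop_compose)
  obtain m where m: "((\<lambda>w. cop U w - w) ^^ m) z = 0" using unipotent_nilpotent[OF U] by blast
  note lin = linear_cop[OF S(1)] linear_cop[OF U(1)] linear_cscale
  define A where "A w = cop T w - cscale c w" for w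
  define B where "B w = cop S w - cop T w" for w
  have linA: "linear A" and linB: "linear B"
    unfolding A_def B_def Tw
    by (intro linear_compose_sub lin linear_compose[OF lin(2) lin(1), unfolded comp_def])+
  have AB: "A (B w) = B (A w)" for w
    by (simp add: A_def B_def Tw linear_diff[OF lin(1)] linear_diff[OF lin(2)] linear_diff[OF lin(3)]
        cop_cscale[OF S(1)] cop_cscale[OF U(1)] comm' algebra_simps)
  have Bpow: "(B ^^ i) w = (cop S ^^ i) (((\<lambda>w. w - cop U w) ^^ i) w)" for i w
  proof (induction i arbitrary: w)
    case (Suc i)
    have S_shift: "((\<lambda>w. w - cop U w) ^^ i) (cop S y) = cop S (((\<lambda>w. w - cop U w) ^^ i) y)" for y
      by (induction i) (simp_all add: comm' linear_diff[OF lin(1)])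
    have "(B ^^ Suc i) w = (B ^^ i) (cop S (w - cop U w))"
      by (simp only: funpow_Suc_right comp_apply B_def Tw linear_diff[OF lin(1)])
    also have "\<dots> = (cop S ^^ i) (cop S (((\<lambda>w. w - cop U w) ^^ i) (w - cop U w)))"
      unfolding Suc.IH S_shift ..
    also have "\<dots> = (cop S ^^ Suc i) (((\<lambda>w. w - cop U w) ^^ Suc i) w)"
      by (simp only: funpow_Suc_right comp_apply)
    finally show ?case .
  qed simp
  have sign: "((\<lambda>w. w - cop U w) ^^ i) w = (- 1) ^ i *\<^sub>R ((\<lambda>w. cop U w - w) ^^ i) w" for i w
  proof (induction i)
    case (Suc i)
    then show ?case by (simp add: linear_scale[OF lin(2)] linear_neg[OF lin(2)] algebra_simps)
  qed simp
  have "(cop S ^^ i) 0 = 0" for i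
    by (induction i) (simp_all add: linear_0[OF lin(1)])
  then have "(B ^^ m) z = 0" unfolding Bpow sign m by simp
  moreover have "(A ^^ k) z = 0" using z unfolding A_def .
  ultimately have "((\<lambda>w. A w + B w) ^^ (k + m)) z = 0"
    using commuting_sum_funpow_zero[OF linA linB AB] by blast
  then have "((\<lambda>w. cop S w - cscale c w) ^^ (k + m)) z = 0" by (simp add: A_def B_def)
  then show ?thesis by (rule semisimple_eigenspace[OF S(2,1)])
qed

text \<open>Both semisimple parts act as the same scalar on each generalized eigenvector of
  \<open>T\<close>, so they agree; \<open>U\<close> follows by cancelling the injective
  \<open>S\<close>.\<close>

lemma jordan_decomposition_unique:
  fixes T :: "'a::euclidean_space \<Rightarrow> 'a"
  assumes T: "linear T" "inj T" and jd: "jordan_decomposition T S U" "jordan_decomposition T S' U'"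
  shows "S' = S \<and> U' = U"
proof -
  have "cop S' z = cop S z" for z
  proof (rule complex_vector_induct[OF T(1), where P = "\<lambda>z. cop S' z = cop S z"])
    have lin: "linear (cop S)" "linear (cop S')"
      using jd by (auto simp: jordan_decomposition_def intro: linear_cop)
    show "cop S' (x + y) = cop S (x + y)" if "cop S' x = cop S x" "cop S' y = cop S y" for x y
      using that by (simp add: linear_add[OF lin(1)] linear_add[OF lin(2)])
    show "cop S' w = cop S w" if "((\<lambda>w. cop T w - cscale c w) ^^ k) w = 0" for c k w
      using jordan_semisimple_part_eigenvector[OF jd(1) that]
        jordan_semisimple_part_eigenvector[OF jd(2) that] by simp
  qed
  then have "fst (cop S' (x, x)) = fst (cop S (x, x))" for x by simp
  then have S: "S' = S" by (auto simp: cop_def)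
  have "inj S" using T(2) jd(1) unfolding jordan_decomposition_def by (metis inj_on_imageI2)
  moreover have "S (U x) = S (U' x)" for x
    using jd S unfolding jordan_decomposition_def by (metis comp_apply)
  ultimately have "U' = U" by (metis injD ext)
  with S show ?thesis by simp
qed

text \<open>Write \<open>q = (x - 1)^j g\<close> with \<open>g\<close> nonzero at 1. If
  \<open>j <= k\<close>, then \<open>(x - 1)^(k - j) q\<close> sends \<open>v\<close> to
  \<open>g\<close> applied to the fixed vector \<open>(A - 1)^k v\<close>, that is, to a nonzero
  multiple of it. This gives both the minimal polynomial of the unipotent part and the bound 3 for
  \<open>l\<close>.\<close>

lemma mult_eigenvalue_one_dvd:
  fixes A :: "'a::euclidean_space \<Rightarrow> 'a"
  assumes A: "linear A" and v: "((\<lambda>w. A w - w) ^^ k) v \<noteq> 0" "((\<lambda>w. A w - w) ^^ Suc k) v = 0"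
    and q: "poly_op q A v = 0"
  shows "[:-1, 1:] ^ Suc k dvd q"
proof (cases "q = 0")
  case False
  interpret linear_endo scaleR A by (rule linear_endo_real[OF A])
  obtain g where g: "q = [:- 1, 1:] ^ order 1 q * g" "\<not> [:- 1, 1:] dvd g"
    using order_decomp[OF False, of 1] by blast
  have pow: "gpoly ([:- 1, 1:] ^ i) w = ((\<lambda>w. A w - w) ^^ i) w" for i w
    using gpoly_linear_power[of 1 i w] by simp
  show ?thesis
  proof (rule ccontr)
    assume "\<not> ?thesis"
    then have "order 1 q \<le> k"
      using False unfolding order_divides by simp
    then have "[:- 1, 1:] ^ (k - order 1 q) * q = g * [:- 1, 1:] ^ k"
      by (subst g(1)) (simp add: power_add[symmetric] mult.assoc[symmetric] mult.commute)
    moreover have "gpoly q v = 0" using q by (simp add: poly_op_eq_gpoly[OF A])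
    ultimately have "gpoly g (gpoly ([:- 1, 1:] ^ k) v) = 0"
      by (metis gpoly_mult gpoly_vzero)
    moreover have "A (gpoly ([:- 1, 1:] ^ k) v) = 1 *\<^sub>R gpoly ([:- 1, 1:] ^ k) v"
      using v(2) by (simp add: pow)
    ultimately have "poly g 1 *\<^sub>R gpoly ([:- 1, 1:] ^ k) v = 0"
      by (metis gpoly_eigenvector)
    moreover have "poly g 1 \<noteq> 0" using g(2) by (simp add: poly_eq_0_iff_dvd)
    ultimately show False using v(1) by (simp add: pow)
  qed
qed simp

text \<open>Along the line \<open>y + t a\<close> the form is affine in \<open>t\<close> with slope
  \<open>2 * G a y\<close>, so a nonzero slope would make it negative somewhere.\<close>

lemma semidefinite_null_vector:
  fixes G :: "'a::real_vector \<Rightarrow> 'a \<Rightarrow> real"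
  assumes G: "bilinear G" "\<And>x y. G x y = G y x" and U: "subspace U" "\<And>x. x \<in> U \<Longrightarrow> G x x \<ge> 0"
    and ay: "a \<in> U" "y \<in> U" "G a a = 0"
  shows "G a y = 0"
proof (rule ccontr)
  assume nz: "G a y \<noteq> 0"
  \<comment> \<open>With this \<open>t\<close> the form takes the value -1.\<close>
  define t where "t = - (G y y + 1) / (2 * G a y)"
  have "G (y + t *\<^sub>R a) (y + t *\<^sub>R a) \<ge> 0" using U ay by (auto intro: subspace_add subspace_scale)
  moreover have "G (y + t *\<^sub>R a) (y + t *\<^sub>R a) = G y y + 2 * t * G a y"
    using ay(3) G(2)[of y a]
    by (simp add: bilinear_ladd[OF G(1)] bilinear_radd[OF G(1)] bilinear_lmul[OF G(1)] bilinear_rmul[OF G(1)])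
  moreover have "2 * t * G a y = - (G y y + 1)" using nz by (simp add: t_def)
  ultimately show False by simp
qed

text \<open>Gram-Schmidt on a basis of \<open>W\<close>. A basis vector that becomes null after
  correction is skipped, being orthogonal to all of \<open>U\<close>. The definite case yields
  invariant complements; the semidefinite one is for the vectors orthogonal to a light-like
  \<open>u\<close>.\<close>

lemma semidefinite_projection:
  fixes G :: "'a::euclidean_space \<Rightarrow> 'a \<Rightarrow> real"
  assumes G: "bilinear G" "\<And>x y. G x y = G y x" and U: "subspace U" "\<And>x. x \<in> U \<Longrightarrow> G x x \<ge> 0"
    and W: "subspace W" "W \<subseteq> U" and x: "x \<in> U"
  shows "\<exists>w\<in>W. \<forall>y\<in>W. G (x - w) y = 0"
proof -
  note bil = bilinear_ladd[OF G(1)] bilinear_radd[OF G(1)] bilinear_lmul[OF G(1)] bilinear_rmul[OF G(1)]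
    bilinear_lsub[OF G(1)] bilinear_rsub[OF G(1)] bilinear_rzero[OF G(1)]
  have ext: "G x y = 0" if "\<forall>y\<in>B. G x y = 0" "y \<in> span B" for B x y
    using that(2) by (induction rule: span_induct_alt) (use that(1) in \<open>auto simp: bil\<close>)
  have proj: "\<forall>x\<in>U. \<exists>w\<in>span B. \<forall>y\<in>B. G (x - w) y = 0" if "finite B" "B \<subseteq> U" for B
    using that
  proof (induction rule: finite_induct)
    case empty
    then show ?case using span_0 by auto
  next
    case (insert a B)
    have spanU: "span B \<subseteq> U" using insert.prems U(1) by (simp add: span_minimal)
    have mono: "w \<in> span (insert a B)" if "w \<in> span B" for w
      using that span_mono[of B "insert a B"] by blast
    obtain a0 where a0: "a0 \<in> span B" "\<forall>y\<in>B. G (a - a0) y = 0"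
      using insert by blast
    define a' where "a' = a - a0"
    have a'U: "a' \<in> U" using insert.prems a0 spanU by (auto simp: a'_def intro!: subspace_diff U(1))
    have a'B: "G a' y = 0" if "y \<in> span B" for y using ext a0(2) that by (auto simp: a'_def)
    have a's: "a' \<in> span (insert a B)"
      unfolding a'_def by (rule span_diff[OF span_base mono[OF a0(1)]]) simp
    show ?case
    proof
      fix x assume x: "x \<in> U"
      then obtain w where w: "w \<in> span B" "\<forall>y\<in>B. G (x - w) y = 0" using insert by blast
      have wB: "G (x - w) y = 0" if "y \<in> span B" for y using ext w(2) that by auto
      \<comment> \<open>For null \<open>a'\<close> the coefficient is arbitrary, because
        \<open>x - w\<close> is already orthogonal to \<open>a'\<close>.\<close>
      define t where "t = (if G a' a' = 0 then 0 else G (x - w) a' / G a' a')"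
      have "G (x - (w + t *\<^sub>R a')) y = 0" if "y \<in> insert a B" for y
      proof -
        have "y \<in> B \<or> y = a' + a0" using that by (auto simp: a'_def)
        moreover have "G (x - (w + t *\<^sub>R a')) y = 0" if "y \<in> span B" for y
          using wB[OF that] a'B[OF that] by (simp add: bil)
        moreover have "G (x - (w + t *\<^sub>R a')) a' = 0"
        proof (cases "G a' a' = 0")
          case True
          have "x - w \<in> U" using x w spanU by (auto intro!: subspace_diff U(1))
          then have "G a' (x - w) = 0"
            using semidefinite_null_vector[OF G U a'U _ True] by blast
          then show ?thesis using True G(2)[of a' "x - w"] by (simp add: bil)
        next
          case False
          then have "t * G a' a' = G (x - w) a'" by (simp add: t_def)
          then show ?thesis by (simp add: bil)
        qed
        ultimately show ?thesis using a0(1) by (auto simp: bilinear_radd[OF G(1)] intro: span_base)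
      qed
      moreover have "w + t *\<^sub>R a' \<in> span (insert a B)"
        using mono[OF w(1)] a's by (auto intro: span_add span_scale)
      ultimately show "\<exists>w\<in>span (insert a B). \<forall>y\<in>insert a B. G (x - w) y = 0" by blast
    qed
  qed
  obtain B where B: "B \<subseteq> W" "independent B" "W \<subseteq> span B" by (metis basis_exists)
  then have "span B = W" using W(1) by (simp add: span_minimal subset_antisym)
  moreover have "finite B" using B(2) by (simp add: independent_imp_finite)
  ultimately show ?thesis using proj[of B] x B(1) W(2) ext by (metis subset_trans)
qed

text \<open>If the adjoint \<open>S\<close> preserves \<open>W\<close>, then \<open>T\<close>
  preserves the \<open>G\<close>-orthogonal complement of \<open>W\<close>. Allowing an
  \<open>S\<close> other than the inverse of \<open>T\<close> makes room for the hyperbolic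
  case.\<close>

lemma semisimple_of_adjoint:
  fixes T :: "'a::euclidean_space \<Rightarrow> 'a" and G :: "'a \<Rightarrow> 'a \<Rightarrow> real"
  assumes T: "linear T" and G: "bilinear G" "\<And>x y. G x y = G y x" "\<And>x. x \<noteq> 0 \<Longrightarrow> G x x > 0"
    and adj: "\<And>x y. G (T x) y = G x (S y)"
    and inv: "\<And>W. subspace W \<Longrightarrow> T ` W \<subseteq> W \<Longrightarrow> S ` W \<subseteq> W"
  shows "semisimple_op T"
  unfolding semisimple_op_def
proof (intro allI impI, elim conjE)
  fix W assume W: "subspace W" "T ` W \<subseteq> W"
  define C where "C = {x. \<forall>y\<in>W. G x y = 0}"
  note bil = bilinear_ladd[OF G(1)] bilinear_lmul[OF G(1)] bilinear_lzero[OF G(1)]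
  have "subspace C" unfolding C_def subspace_def by (auto simp: bil)
  moreover have "T ` C \<subseteq> C" unfolding C_def using inv[OF W] by (auto simp: adj)
  moreover have "W \<inter> C = {0}"
    using W(1) G(3) by (auto simp: C_def subspace_0 bil) (metis less_irrefl)
  moreover have "x \<in> {w + u | w u. w \<in> W \<and> u \<in> C}" for x
  proof -
    have nonneg: "G x x \<ge> 0" for x using G(3)[of x] bil(3)[of x] by (cases "x = 0") auto
    obtain w where "w \<in> W" "\<forall>y\<in>W. G (x - w) y = 0"
      using semidefinite_projection[OF G(1,2) subspace_UNIV _ W(1), of x] nonneg by auto
    then have "x = w + (x - w)" "x - w \<in> C" by (auto simp: C_def)
    then show ?thesis using \<open>w \<in> W\<close> by blast
  qed
  ultimately show "\<exists>U. subspace U \<and> T ` U \<subseteq> U \<and> W \<inter> U = {0} \<and> {w + u |w u. w \<in> W \<and> u \<in> U} = UNIV"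
    by blast
qed

section \<open>Lorentz forms\<close>

text \<open>The signature is encoded by a unit time-like vector \<open>p\<close> with negative
  definite orthogonal complement; every other unit time-like vector can take its place, in
  particular a point of \<open>H\<close>.\<close>

locale lorentz =
  fixes B :: "'a::euclidean_space \<Rightarrow> 'a \<Rightarrow> real" and p :: 'a
  assumes bilinear: "bilinear B"
    and sym: "B x y = B y x"
    and base: "B p p = 1"
    and neg: "B p x = 0 \<Longrightarrow> x \<noteq> 0 \<Longrightarrow> B x x < 0"
begin

lemmas bil = bilinear_ladd[OF bilinear] bilinear_radd[OF bilinear]
  bilinear_lmul[OF bilinear] bilinear_rmul[OF bilinear]
  bilinear_lneg[OF bilinear] bilinear_rneg[OF bilinear]
  bilinear_lsub[OF bilinear] bilinear_rsub[OF bilinear]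
  bilinear_lzero[OF bilinear] bilinear_rzero[OF bilinear]

lemma form_scaleR: "B (c *\<^sub>R x) (c *\<^sub>R x) = c\<^sup>2 * B x x"
  by (simp add: bil power2_eq_square)

lemma nondegenerate:
  assumes "\<And>y. B x y = 0"
  shows "x = 0"
  using neg[of x] assms sym by fastforce

lemma base_nonzero: "B v v \<ge> 0 \<Longrightarrow> v \<noteq> 0 \<Longrightarrow> B p v \<noteq> 0"
  using neg[of v] by fastforce

text \<open>On the affine hyperplane \<open>B p = 1\<close> the difference of two points is space-like, which makes
  \<open>B\<close> positive on pairs of points of the cone.\<close>

lemma normalized_inner:
  assumes "B p v = B p w" "v \<noteq> w"
  shows "2 * B v w > B v v + B w w"
proof -
  have "B (v - w) (v - w) < 0" using assms by (intro neg) (auto simp: bil)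
  then show ?thesis using sym[of v w] by (simp add: bil)
qed

text \<open>After rescaling both vectors to \<open>B p = 1\<close> this is
  \<open>normalized_inner\<close>; the product \<open>B p v * B p w\<close> records whether they lie
  in the same half of the cone.\<close>

lemma inner_time_like_sign:
  assumes v: "B v v > 0" and w: "B w w \<ge> 0" "w \<noteq> 0"
  shows "B v w * (B p v * B p w) > 0"
proof -
  have "v \<noteq> 0" using v by (auto simp: bil)
  then have nz: "B p v \<noteq> 0" "B p w \<noteq> 0" using base_nonzero v w by auto
  define v' w' where "v' = inverse (B p v) *\<^sub>R v" and "w' = inverse (B p w) *\<^sub>R w"
  have "B v' v' > 0" "B w' w' \<ge> 0" using v w nz by (simp_all add: v'_def w'_def form_scaleR)
  moreover have "B p v' = B p w'" using nz by (simp add: v'_def w'_def bil)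
  ultimately have "B v' w' > 0" using normalized_inner[of v' w'] by (cases "v' = w'") auto
  moreover have "B v w * (B p v * B p w) = (B p v * B p w)\<^sup>2 * B v' w'"
    using nz by (simp add: v'_def w'_def bil power2_eq_square field_simps)
  ultimately show ?thesis using nz by simp
qed

lemma time_like_orthogonal:
  assumes "B v v > 0" "B v x = 0" "x \<noteq> 0"
  shows "B x x < 0"
  using inner_time_like_sign[of v x] assms by fastforce

text \<open>Rescaled to \<open>B p = 1\<close>, two distinct points of the closed cone have positive
  product, so orthogonality forces them to coincide.\<close>

lemma light_like_orthogonal:
  assumes u: "B u u = 0" "u \<noteq> 0" and x: "B x x \<ge> 0" "B u x = 0"
  shows "\<exists>c. x = c *\<^sub>R u"
proof (cases "x = 0")
  case False
  have nz: "B p u \<noteq> 0" "B p x \<noteq> 0" using base_nonzero u x False by auto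
  define u' x' where "u' = inverse (B p u) *\<^sub>R u" and "x' = inverse (B p x) *\<^sub>R x"
  have "B u' u' = 0" "B x' x' \<ge> 0" using u x by (simp_all add: u'_def x'_def form_scaleR)
  moreover have "B u' x' = 0" using x by (simp add: u'_def x'_def bil)
  moreover have "B p u' = B p x'" using nz by (simp add: u'_def x'_def bil)
  ultimately have "u' = x'" using normalized_inner[of u' x'] by fastforce
  then have "x = B p x *\<^sub>R inverse (B p u) *\<^sub>R u" using nz by (simp add: u'_def x'_def)
  then show ?thesis by (metis scaleR_scaleR)
qed (auto intro: exI[of _ 0])

lemma light_like_orthogonal_nonpos:
  assumes "B u u = 0" "u \<noteq> 0" "B u x = 0"
  shows "B x x \<le> 0"
proof (rule ccontr)
  assume "\<not> ?thesis"
  then have "B x x > 0" "B x u = 0" using assms sym by auto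
  then show False using time_like_orthogonal[of x u] assms by simp
qed

text \<open>\<open>B h h\<close> times the form that is \<open>B\<close> on the line of
  \<open>h\<close> and \<open>- B\<close> on the orthogonal complement; the factor
  \<open>B h h\<close> avoids a division.\<close>

definition pos_form :: "'a \<Rightarrow> 'a \<Rightarrow> 'a \<Rightarrow> real" where
  "pos_form h x y = 2 * B x h * B y h - B h h * B x y"

lemma bilinear_pos_form: "bilinear (pos_form h)"
  unfolding bilinear_def pos_form_def
  by (auto intro!: linearI simp: bil algebra_simps)

lemma pos_form_sym: "pos_form h x y = pos_form h y x"
  using sym by (simp add: pos_form_def)

lemma pos_form_pos:
  assumes h: "B h h > 0" and x: "x \<noteq> 0"
  shows "pos_form h x x > 0"
proof -
  define a y where "a = B x h / B h h" and "y = x - a *\<^sub>R h"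
  have xh: "B x h = a * B h h" using h by (simp add: a_def)
  have yh: "B h y = 0" using sym[of h x] by (simp add: y_def bil xh)
  have x_eq: "x = a *\<^sub>R h + y" by (simp add: y_def)
  have "pos_form h x x = B h h * (a\<^sup>2 * B h h - B y y)"
    using yh sym[of h y] xh by (simp add: pos_form_def x_eq bil power2_eq_square algebra_simps)
  moreover have "a\<^sup>2 * B h h - B y y > 0"
  proof (cases "y = 0")
    case True
    then have "a \<noteq> 0" using x x_eq by auto
    then show ?thesis using True h by (simp add: bil)
  next
    case False
    then have "B y y < 0" using time_like_orthogonal[OF h yh] by simp
    then show ?thesis using h by (smt (verit) mult_nonneg_nonneg zero_le_power2)
  qed
  ultimately show ?thesis using h by simp
qed

lemma continuous_on_form:
  fixes f g :: "'b::topological_space \<Rightarrow> 'a"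
  assumes "continuous_on S f" "continuous_on S g"
  shows "continuous_on S (\<lambda>x. B (f x) (g x))"
proof -
  have "bounded_bilinear B" using bilinear bilinear_conv_bounded_bilinear by blast
  then show ?thesis using assms by (rule bounded_bilinear.continuous_on)
qed

text \<open>On the section \<open>pos_form p v v = 2 - B v v <= 2\<close>, and by compactness of the
  unit sphere this form dominates a positive multiple of the squared norm, whence boundedness.
  Convexity holds because \<open>B\<close> is nonnegative on pairs of points.\<close>

lemma compact_convex_cone_section:
  shows "compact {v. B p v = 1 \<and> B v v \<ge> 0}" (is "compact ?S")
    and "convex {v. B p v = 1 \<and> B v v \<ge> 0}"
    and "{v. B p v = 1 \<and> B v v \<ge> 0} \<noteq> {}"
proof -
  have "?S = {v. B p v = 1} \<inter> {v. 0 \<le> B v v}" by auto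
  then have "closed ?S"
    by (auto intro!: closed_Int closed_Collect_eq closed_Collect_le continuous_on_form
        continuous_on_const continuous_on_id)
  moreover have "bounded ?S"
  proof -
    have "compact (sphere (0::'a) 1)" "sphere (0::'a) 1 \<noteq> {}" by auto
    moreover have "continuous_on (sphere 0 1) (\<lambda>x. pos_form p x x)"
      unfolding pos_form_def
      by (intro continuous_intros continuous_on_form)
    ultimately have "\<exists>x0\<in>sphere 0 1. \<forall>x\<in>sphere 0 1. pos_form p x0 x0 \<le> pos_form p x x"
      by (rule continuous_attains_inf)
    then obtain x0 where x0: "x0 \<in> sphere 0 1" "\<forall>x\<in>sphere 0 1. pos_form p x0 x0 \<le> pos_form p x x"
      by blast
    define m where "m = pos_form p x0 x0"
    have m: "m > 0" unfolding m_def using x0(1) by (intro pos_form_pos) (auto simp: base)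
    have "norm v \<le> sqrt (2 / m)" if v: "v \<in> ?S" for v
    proof -
      have "v \<noteq> 0" using v by (auto simp: bil)
      then have "m \<le> pos_form p (inverse (norm v) *\<^sub>R v) (inverse (norm v) *\<^sub>R v)"
        unfolding m_def using x0(2) by auto
      also have "\<dots> = pos_form p v v / (norm v)\<^sup>2"
        by (simp add: bilinear_lmul[OF bilinear_pos_form] bilinear_rmul[OF bilinear_pos_form]
            power2_eq_square divide_simps)
      also have "\<dots> \<le> 2 / (norm v)\<^sup>2"
        using v sym[of v p] by (intro divide_right_mono) (auto simp: pos_form_def base)
      finally have "(norm v)\<^sup>2 \<le> 2 / m" using m \<open>v \<noteq> 0\<close> by (simp add: field_simps)
      then show ?thesis by (rule real_le_rsqrt)
    qed
    then show ?thesis unfolding bounded_iff by blast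
  qed
  ultimately show "compact ?S" by (simp add: compact_eq_bounded_closed)
  show "convex ?S"
    unfolding convex_def
  proof (intro ballI allI impI)
    fix v w :: 'a and s t :: real
    assume v: "v \<in> ?S" and w: "w \<in> ?S" and st: "0 \<le> s" "0 \<le> t" "s + t = 1"
    have "B v w \<ge> 0" using normalized_inner[of v w] v w by (cases "v = w") auto
    moreover have "B (s *\<^sub>R v + t *\<^sub>R w) (s *\<^sub>R v + t *\<^sub>R w) = s\<^sup>2 * B v v + 2 * (s * t) * B v w + t\<^sup>2 * B w w"
      using sym[of w v] by (simp add: bil power2_eq_square algebra_simps)
    ultimately show "s *\<^sub>R v + t *\<^sub>R w \<in> ?S" using v w st by (simp add: bil)
  qed
  show "?S \<noteq> {}" using base by (auto intro!: exI[of _ p])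
qed

end

locale lorentz_isometry = lorentz +
  fixes T :: "'a \<Rightarrow> 'a"
  assumes linear_T: "linear T"
    and iso: "B (T x) (T y) = B x y"
    and time: "B p (T p) > 0"
begin

lemmas lin = linear_add[OF linear_T] linear_diff[OF linear_T] linear_scale[OF linear_T]
  linear_neg[OF linear_T] linear_0[OF linear_T]

lemma inj_T: "inj T"
proof -
  have "x = 0" if "T x = 0" for x
    using nondegenerate[of x] iso[of x] that by (simp add: bil)
  then show ?thesis using linear_injective_0[OF linear_T] by blast
qed

lemma bij_T: "bij T"
  using inj_T linear_injective_imp_surjective[OF linear_T] by (simp add: bij_def)

lemma T_inv [simp]: "T (inv_into UNIV T x) = x"
  using bij_T by (simp add: bij_is_surj surj_f_inv_f)

lemma iso_inv: "B (T x) y = B x (inv_into UNIV T y)"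
  using iso[of x "inv_into UNIV T y"] by simp

text \<open>By dimension, the injective \<open>T\<close> maps \<open>W\<close> onto
  \<open>W\<close>.\<close>

lemma inv_invariant:
  assumes "subspace W" "T ` W \<subseteq> W"
  shows "inv_into UNIV T ` W \<subseteq> W"
proof -
  have "dim (T ` W) = dim W"
    using dim_image_eq[OF linear_T] inj_T by (metis inj_on_subset subset_UNIV)
  then have "T ` W = W"
    using subspace_dim_equal[of "T ` W" W] assms linear_subspace_image[OF linear_T] by simp
  then show ?thesis using inj_T by (metis image_inv_f_f subset_refl)
qed

text \<open>As \<open>p\<close> and \<open>T p\<close> lie in the same half of the cone,
  \<open>B p v\<close> and \<open>B (T p) v\<close> have the same sign, and invariance makes
  \<open>c\<close> their quotient.\<close>

lemma eigenvalue_cone_pos: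
  assumes v: "B v v \<ge> 0" "v \<noteq> 0" "T v = c *\<^sub>R v"
  shows "c > 0"
proof -
  have "B (T p) v * (B p (T p) * B p v) > 0"
    using v base iso by (intro inner_time_like_sign) auto
  then have "B (T p) v * B p v > 0" using time by (simp add: mult.left_commute zero_less_mult_iff)
  moreover have "B p v = c * B (T p) v" using iso[of p v] v(3) by (simp add: bil)
  ultimately have "c * (B (T p) v)\<^sup>2 > 0" by (simp add: power2_eq_square algebra_simps)
  then show ?thesis by (simp add: zero_less_mult_iff)
qed

lemma time_like_eigenvector_fixed:
  assumes "B v v > 0" "T v = c *\<^sub>R v"
  shows "T v = v"
proof -
  have "c > 0" using assms by (intro eigenvalue_cone_pos[of v]) (auto simp: bil)
  moreover have "c * c = 1" using iso[of v v] assms by (simp add: bil)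
  ultimately have "c = 1" by (auto simp: square_eq_1_iff)
  then show ?thesis using assms(2) by simp
qed

lemma cone_eigenvector_exists: "\<exists>v c. v \<noteq> 0 \<and> B v v \<ge> 0 \<and> T v = c *\<^sub>R v"
proof -
  let ?S = "{v. B p v = 1 \<and> B v v \<ge> 0}"
  \<comment> \<open>\<open>T v\<close> rescaled back to the slice, so a fixed point of
    \<open>f\<close> is an eigenvector of \<open>T\<close>.\<close>
  define f where "f v = inverse (B p (T v)) *\<^sub>R T v" for v
  have nz: "B p (T v) \<noteq> 0" if "v \<in> ?S" for v
  proof (rule base_nonzero)
    show "B (T v) (T v) \<ge> 0" using that by (simp add: iso)
    have "v \<noteq> 0" using that by (auto simp: bil)
    then show "T v \<noteq> 0" using inj_T lin(5) by (metis injD)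
  qed
  have "continuous_on ?S T" using linear_T linear_continuous_on linear_conv_bounded_linear by blast
  then have "continuous_on ?S f"
    unfolding f_def using nz
    by (intro continuous_on_scaleR continuous_on_inverse continuous_on_form continuous_on_const) auto
  moreover have "B (f v) (f v) = (inverse (B p (T v)))\<^sup>2 * B v v" for v
    by (simp only: f_def form_scaleR iso)
  then have "f \<in> ?S \<rightarrow> ?S"
    using nz by (auto simp: f_def bilinear_rmul[OF bilinear])
  ultimately obtain v where v: "v \<in> ?S" "f v = v"
    using brouwer[OF compact_convex_cone_section] by blast
  have "T v = B p (T v) *\<^sub>R f v" using nz[OF v(1)] by (simp add: f_def)
  then have "T v = B p (T v) *\<^sub>R v" using v(2) by simp
  moreover have "v \<noteq> 0" using v(1) by (auto simp: bil)
  ultimately show ?thesis using v(1) by blast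
qed

end

text \<open>\<open>p\<close> and \<open>S p\<close> have the same product with the fixed
  \<open>h\<close>, so they lie in the same half of the cone. This is applied to the semisimple part
  of a parabolic isometry.\<close>

lemma (in lorentz) isometry_fixing_time_like:
  assumes S: "linear S" "\<And>x y. B (S x) (S y) = B x y" and h: "B h h > 0" "S h = h"
  shows "lorentz_isometry B p S"
proof unfold_locales
  have 1: "B h p * (B p h * B p p) > 0" "B h (S p) * (B p h * B p (S p)) > 0"
    using h base S(2)[of p p] by (intro inner_time_like_sign; force simp: bil)+
  have "B h (S p) = B h p" using S(2)[of h p] h(2) by simp
  with 1 show "B p (S p) > 0" unfolding base by (auto simp: zero_less_mult_iff mult_less_0_iff)
qed (use S in \<open>auto simp: linear_add linear_scale\<close>)

section \<open>Complex eigenvalues, invariant forms and functionals\<close>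

lemma is_eigenvalue_of_real:
  "is_eigenvalue T (of_real c) \<longleftrightarrow> (\<exists>v. v \<noteq> 0 \<and> T v = c *\<^sub>R v)"
proof
  assume "is_eigenvalue T (of_real c)"
  then obtain x y where "(x, y) \<noteq> 0" "T x = c *\<^sub>R x" "T y = c *\<^sub>R y"
    by (auto simp: is_eigenvalue_def ceigenspace_def cop_def cscale_def zero_prod_def)
  then show "\<exists>v. v \<noteq> 0 \<and> T v = c *\<^sub>R v" by (auto simp: zero_prod_def)
next
  assume "\<exists>v. v \<noteq> 0 \<and> T v = c *\<^sub>R v"
  then obtain v where "v \<noteq> 0" "T v = c *\<^sub>R v" by blast
  then have "(v, v) \<in> ceigenspace T (of_real c)" "(v, v) \<noteq> 0"
    by (auto simp: ceigenspace_def cop_def cscale_def zero_prod_def)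
  then show "is_eigenvalue T (of_real c)" unfolding is_eigenvalue_def by blast
qed

lemma is_eigenvalueE:
  assumes "is_eigenvalue T c"
  obtains x y where "x \<noteq> 0 \<or> y \<noteq> 0" "T x = Re c *\<^sub>R x - Im c *\<^sub>R y" "T y = Re c *\<^sub>R y + Im c *\<^sub>R x"
  using assms
  by (auto simp: is_eigenvalue_def ceigenspace_def cop_def cscale_def zero_prod_def)

text \<open>\<open>G x x + G y y\<close> is the Hermitian extension of \<open>G\<close> at
  \<open>x + i y\<close>. Passing to the image under \<open>T\<close> leaves it unchanged and
  multiplies it by \<open>|c|^2\<close>.\<close>

lemma invariant_form_eigenvalue:
  fixes G :: "'a::real_vector \<Rightarrow> 'a \<Rightarrow> real"
  assumes G: "bilinear G" "\<And>x y. G x y = G y x" "\<And>x y. G (T x) (T y) = G x y"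
    and T: "T x = Re c *\<^sub>R x - Im c *\<^sub>R y" "T y = Re c *\<^sub>R y + Im c *\<^sub>R x"
    and nz: "G x x + G y y \<noteq> 0"
  shows "cmod c = 1"
proof -
  have "G x x + G y y = G (T x) (T x) + G (T y) (T y)" by (simp add: G(3))
  also have "\<dots> = ((Re c)\<^sup>2 + (Im c)\<^sup>2) * (G x x + G y y)"
    using G(2)[of x y]
    by (simp add: T bilinear_ladd[OF G(1)] bilinear_radd[OF G(1)] bilinear_lmul[OF G(1)]
        bilinear_rmul[OF G(1)] bilinear_lsub[OF G(1)] bilinear_rsub[OF G(1)]
        power2_eq_square algebra_simps)
  finally have "(cmod c)\<^sup>2 = 1" using nz by (simp add: cmod_power2)
  then show ?thesis by (simp add: power2_eq_1_iff) (smt (verit) norm_ge_zero)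
qed

text \<open>Passing to the image under \<open>T\<close> multiplies the complex number with parts
  \<open>\<phi> x\<close> and \<open>\<phi> y\<close> by \<open>t\<close> and also by
  \<open>c\<close>.\<close>

lemma invariant_functional_eigenvalue:
  fixes \<phi> :: "'a::euclidean_space \<Rightarrow> real"
  assumes \<phi>: "linear \<phi>" "\<And>x. \<phi> (T x) = t * \<phi> x"
    and T: "T x = Re c *\<^sub>R x - Im c *\<^sub>R y" "T y = Re c *\<^sub>R y + Im c *\<^sub>R x"
    and c: "c \<noteq> of_real t"
  shows "\<phi> x = 0 \<and> \<phi> y = 0"
proof -
  have "t * \<phi> x = Re c * \<phi> x - Im c * \<phi> y" "t * \<phi> y = Re c * \<phi> y + Im c * \<phi> x"
    using \<phi>(2)[of x] \<phi>(2)[of y]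
    by (simp_all add: T linear_add[OF \<phi>(1)] linear_diff[OF \<phi>(1)] linear_scale[OF \<phi>(1)])
  then have "(c - of_real t) * Complex (\<phi> x) (\<phi> y) = 0"
    by (simp add: complex_eq_iff algebra_simps)
  then have "Complex (\<phi> x) (\<phi> y) = 0" using c by (simp only: mult_eq_0_iff) simp
  then show ?thesis by (simp add: complex_eq_iff)
qed

lemma op_char_poly_root:
  fixes T :: "'a::euclidean_space \<Rightarrow> 'a"
  assumes "linear T" "T v = c *\<^sub>R v" "v \<noteq> 0"
  shows "poly (op_char_poly T) c = 0"
proof -
  interpret linear_endo scaleR T by (rule linear_endo_real[OF assms(1)])
  have "poly (op_char_poly T) c *\<^sub>R v = 0"
    using op_cayley_hamilton[OF assms(1), of v] gpoly_eigenvector[OF assms(2)]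
    by (simp add: poly_op_eq_gpoly[OF assms(1)])
  then show ?thesis using assms(3) by simp
qed

section \<open>Isometries with a time-like fixed vector\<close>

locale elliptic_isometry = lorentz_isometry +
  fixes h
  assumes h_time_like: "B h h > 0" and h_fixed: "T h = h"
begin

lemma pos_form_invariant: "pos_form h (T x) (T y) = pos_form h x y"
  using iso[of _ h] h_fixed by (simp add: pos_form_def iso)

lemma elliptic_semisimple: "semisimple_op T"
proof (rule semisimple_of_adjoint[OF linear_T bilinear_pos_form pos_form_sym pos_form_pos[OF h_time_like]])
  show "pos_form h (T x) y = pos_form h x (inv_into UNIV T y)" for x y
    using pos_form_invariant[of x "inv_into UNIV T y"] by simp
  show "inv_into UNIV T ` W \<subseteq> W" if "subspace W" "T ` W \<subseteq> W" for W
    using inv_invariant that .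
qed

lemma elliptic_eigenvalue:
  assumes "is_eigenvalue T c"
  shows "cmod c = 1"
proof -
  obtain x y where xy: "x \<noteq> 0 \<or> y \<noteq> 0" "T x = Re c *\<^sub>R x - Im c *\<^sub>R y" "T y = Re c *\<^sub>R y + Im c *\<^sub>R x"
    using assms by (rule is_eigenvalueE)
  have nonneg: "pos_form h z z \<ge> 0" for z
    using pos_form_pos[OF h_time_like, of z] bilinear_lzero[OF bilinear_pos_form] by (cases "z = 0") auto
  have "pos_form h x x + pos_form h y y \<noteq> 0"
    using xy(1) pos_form_pos[OF h_time_like, of x] pos_form_pos[OF h_time_like, of y]
      nonneg[of x] nonneg[of y] by linarith
  then show ?thesis
    using invariant_form_eigenvalue[where G = "pos_form h" and T = T, OF bilinear_pos_form pos_form_sym pos_form_invariant xy(2,3)] by simp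
qed

lemma elliptic_char_poly:
  obtains l m s a r where "elliptic_form T l m s a r"
proof -
  have "cmod z = 1" if "poly (map_poly complex_of_real (op_char_poly T)) z = 0" for z
    using elliptic_eigenvalue[OF root_op_char_poly_imp_eigenvalue[OF linear_T that]] .
  then obtain l m s a r where 1: "rotation_data s a r"
    "op_char_poly T = [:-1, 1:] ^ l * [:1, 1:] ^ m * rotation_poly s a r"
    by (rule unit_circle_factorization[OF op_char_poly_monic])
  have "h \<noteq> 0" using h_time_like by (auto simp: bil)
  then have "poly (op_char_poly T) 1 = 0"
    using op_char_poly_root[OF linear_T, of h 1] h_fixed by simp
  then have "[:-1, 1:] ^ 1 dvd op_char_poly T" by (simp add: poly_eq_0_iff_dvd)
  then have "1 \<le> l" using root_one_multiplicity_factorization[OF 1(1)] 1(2) by metis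
  then show ?thesis using that 1 by (simp add: elliptic_form_def)
qed

end

section \<open>Isometries with a real eigenvalue other than 1 and -1\<close>

context lorentz_isometry
begin

lemma functional_eigenvalue:
  assumes "T u = t *\<^sub>R u" "t \<noteq> 0"
  shows "B (T x) u = inverse t * B x u"
proof -
  have "t * B (T x) u = B x u" using iso[of x u] assms(1) by (simp add: bil)
  then show ?thesis using assms(2) by (simp add: field_simps)
qed

lemma linear_form_left: "linear (\<lambda>x. B x u)"
  using bilinear by (simp add: bilinear_def)

lemma eigenvalue_nonzero:
  assumes "T u = t *\<^sub>R u" "u \<noteq> 0"
  shows "t \<noteq> 0"
proof
  assume "t = 0"
  then have "T u = T 0" using assms(1) by (simp add: lin)
  then show False using injD[OF inj_T] assms(2) by blast
qed

lemma real_eigenvalue_light_like: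
  assumes "T u = t *\<^sub>R u" "t \<noteq> 1" "t \<noteq> - 1"
  shows "B u u = 0"
proof -
  have "t * t * B u u = B u u" using iso[of u u] assms(1) by (simp add: bil)
  then have "(t * t - 1) * B u u = 0" by (simp add: algebra_simps)
  moreover have "t * t - 1 \<noteq> 0" using assms(2,3) by (simp add: square_eq_1_iff)
  ultimately show ?thesis by simp
qed

text \<open>Otherwise \<open>T - inverse t\<close> would be surjective. But its image is orthogonal
  to \<open>u\<close>, against nondegeneracy.\<close>

lemma inverse_eigenvector:
  assumes "T u = t *\<^sub>R u" "u \<noteq> 0"
  shows "\<exists>w. w \<noteq> 0 \<and> T w = inverse t *\<^sub>R w"
proof (rule ccontr)
  assume none: "\<not> ?thesis"
  define F where "F x = T x - inverse t *\<^sub>R x" for x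
  have F: "linear F"
    unfolding F_def by (intro linear_compose_sub linear_T linear_scaleR)
  moreover have "x = 0" if "F x = 0" for x using none that by (auto simp: F_def)
  ultimately have "surj F"
    using linear_injective_imp_surjective linear_injective_0 by blast
  have t: "t \<noteq> 0" by (rule eigenvalue_nonzero[OF assms])
  have "B u (F x) = 0" for x
    using functional_eigenvalue[OF assms(1) t, of x] sym by (simp add: F_def bil)
  then have "B u y = 0" for y using \<open>surj F\<close> by (metis surjD)
  then show False using nondegenerate assms(2) by blast
qed

text \<open>Eigenvectors whose eigenvalues do not multiply to 1 are orthogonal, and orthogonal
  light-like vectors of a Lorentz form are parallel. With \<open>t' = t\<close> this makes the
  eigenspace a line.\<close>

lemma eigenvector_parallel:
  assumes u: "T u = t *\<^sub>R u" "u \<noteq> 0" "t \<noteq> 1" "t \<noteq> - 1"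
    and x: "T x = t' *\<^sub>R x" "t' \<noteq> 1" "t' \<noteq> - 1" "t' \<noteq> inverse t"
  shows "\<exists>c. x = c *\<^sub>R u"
proof -
  have "t' * B x u = inverse t * B x u"
    using functional_eigenvalue[OF u(1) eigenvalue_nonzero[OF u(1,2)], of x] x(1) by (simp add: bil)
  then have "B u x = 0" using x(4) sym by simp
  then show ?thesis
    using light_like_orthogonal[OF real_eigenvalue_light_like[OF u(1,3,4)] u(2)]
      real_eigenvalue_light_like[OF x(1-3)] by simp
qed

lemma not_self_inverse:
  assumes "t \<noteq> 0" "t \<noteq> 1" "t \<noteq> - 1"
  shows "t \<noteq> inverse (t :: real)"
proof
  assume "t = inverse t"
  then have "t * t = 1" using assms(1) by (metis right_inverse)
  then show False using assms by (simp add: square_eq_1_iff)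
qed

end

locale hyperbolic_isometry = lorentz_isometry +
  fixes t u w
  assumes eigen: "T u = t *\<^sub>R u" "T w = inverse t *\<^sub>R w"
    and pairing: "B u w = 1"
    and t: "t \<noteq> 1" "t \<noteq> - 1"
begin

lemma nonzero: "u \<noteq> 0" "w \<noteq> 0"
  using pairing by (auto simp: bil)

lemma t_nonzero: "t \<noteq> 0"
  by (rule eigenvalue_nonzero[OF eigen(1) nonzero(1)])

lemma inverse_t: "inverse t \<noteq> 1" "inverse t \<noteq> - 1"
  using t by (auto simp: inverse_eq_iff_eq[of t 1, simplified] inverse_eq_iff_eq[of t "- 1", simplified])

lemma light_like: "B u u = 0" "B w w = 0"
  by (rule real_eigenvalue_light_like[OF eigen(1) t], rule real_eigenvalue_light_like[OF eigen(2) inverse_t])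

lemma pairing': "B w u = 1"
  using pairing sym by simp

lemma eigenspace: "T x = t *\<^sub>R x \<Longrightarrow> \<exists>c. x = c *\<^sub>R u"
  by (rule eigenvector_parallel[OF eigen(1) nonzero(1) t _ t not_self_inverse[OF t_nonzero t]])

lemma real_eigenspace_eq: "real_eigenspace T t = span {u}"
proof -
  have "x \<in> span {u}" if "T x = t *\<^sub>R x" for x using eigenspace[OF that] by (auto simp: span_singleton)
  moreover have "T (c *\<^sub>R u) = t *\<^sub>R c *\<^sub>R u" for c using eigen by (simp add: lin)
  ultimately show ?thesis by (auto simp: real_eigenspace_def span_singleton)
qed

lemma functional: "B (T x) u = inverse t * B x u" "B (T x) w = t * B x w"
  using functional_eigenvalue[OF eigen(1) t_nonzero]
    functional_eigenvalue[OF eigen(2) nonzero_imp_inverse_nonzero[OF t_nonzero]] by simp_all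

text \<open>The functional \<open>\<lambda>x. B x w\<close> vanishes on the image of
  \<open>T - t\<close> but not at \<open>u\<close>. So the \<open>y\<close> supplied by a double
  root would be an eigenvector off the line of \<open>u\<close>.\<close>

lemma simple_root: "\<not> [:- t, 1:] ^ 2 dvd op_char_poly T"
proof
  assume "[:- t, 1:] ^ 2 dvd op_char_poly T"
  then obtain y c where y: "T y - t *\<^sub>R y = c *\<^sub>R u" "\<And>d. y \<noteq> d *\<^sub>R u"
    using double_root_op_char_poly[OF linear_T eigen(1) nonzero(1)] by blast
  have "B (T y - t *\<^sub>R y) w = 0" by (simp add: bil functional)
  then have "c = 0" using y(1) pairing by (simp add: bil)
  then show False using y eigenspace[of y] by auto
qed

text \<open>The projection onto the line of \<open>u\<close> along \<open>w\<^sup>\<bottom>\<close> is a polynomial in \<open>T\<close>, since \<open>t\<close> is a simple root.\<close>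

lemma projection_invariant:
  assumes W: "subspace W" "T ` W \<subseteq> W" "x \<in> W"
  shows "B x w *\<^sub>R u \<in> W"
proof -
  interpret linear_endo scaleR T by (rule linear_endo_real[OF linear_T])
  have "[:- t, 1:] dvd op_char_poly T"
    using op_char_poly_root[OF linear_T eigen(1) nonzero(1)] by (simp add: poly_eq_0_iff_dvd)
  then obtain f where f: "op_char_poly T = [:- t, 1:] * f" by (rule dvdE)
  have "poly f t \<noteq> 0"
  proof
    assume "poly f t = 0"
    then obtain g where "f = [:- t, 1:] * g" by (metis poly_eq_0_iff_dvd dvdE)
    then have "op_char_poly T = [:- t, 1:] ^ 2 * g"
      using f by (simp only: power2_eq_square mult.assoc)
    then show False using simple_root by (metis dvd_triv_left)
  qed
  have "gpoly [:- t, 1:] (gpoly f x) = 0"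
    using op_cayley_hamilton[OF linear_T, of x]
    unfolding poly_op_eq_gpoly[OF linear_T] f gpoly_mult .
  then have "T (gpoly f x) = t *\<^sub>R gpoly f x" by (simp add: gpoly_linear)
  then obtain c where c: "gpoly f x = c *\<^sub>R u" using eigenspace by blast
  \<comment> \<open>\<open>\<lambda>x. B x w\<close> is an eigenfunctional for \<open>t\<close>, so
    polynomials in \<open>T\<close> act on it by evaluation at \<open>t\<close>; this determines the
    coefficient \<open>c\<close>.\<close>
  have "B (gpoly q x) w = poly q t * B x w" for q
    by (induction q) (simp_all add: gpoly_pCons bil functional algebra_simps)
  from this[of f] have "c = poly f t * B x w" using c pairing by (simp add: bil)
  then have "B x w *\<^sub>R u = inverse (poly f t) *\<^sub>R gpoly f x"
    using c \<open>poly f t \<noteq> 0\<close> by simp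
  moreover have "gpoly f x \<in> W"
    using W by (intro gpoly_mem) (auto simp: subspace_0 subspace_add subspace_scale)
  ultimately show ?thesis using W(1) by (simp add: subspace_scale)
qed

lemma swap: "hyperbolic_isometry B p T (inverse t) w u"
  using eigen pairing' inverse_t by unfold_locales auto

lemma hyperbolic_semisimple: "semisimple_op T"
proof -
  interpret s: hyperbolic_isometry B p T "inverse t" w u by (rule swap)
  define h where "h = u + w"
  have h: "B h h = 2" by (simp add: h_def bil light_like pairing pairing')
  \<comment> \<open>\<open>B x w\<close> and \<open>B x u\<close> are the coefficients of
    \<open>x\<close> along \<open>u\<close> and \<open>w\<close>. The corrections exchange the
    eigenvalues of the inverse there, so that \<open>S\<close> is \<open>T\<close> on that plane,
    where \<open>T\<close> is self-adjoint for \<open>pos_form h\<close>, and the inverse of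
    \<open>T\<close> on the orthogonal complement.\<close>
  define S where "S x = inv_into UNIV T x + (B x w * (t - inverse t)) *\<^sub>R u + (B x u * (inverse t - t)) *\<^sub>R w" for x
  have inv: "B (inv_into UNIV T x) u = t * B x u" "B (inv_into UNIV T x) w = inverse t * B x w" for x
    using functional[of "inv_into UNIV T x"] t_nonzero by simp_all
  have Su: "B (S x) u = inverse t * B x u" "B (S x) w = t * B x w" for x
    unfolding S_def by (simp_all add: bil inv light_like pairing pairing' algebra_simps)
  show ?thesis
  proof (rule semisimple_of_adjoint[OF linear_T bilinear_pos_form pos_form_sym])
    show "pos_form h x x > 0" if "x \<noteq> 0" for x using pos_form_pos[OF _ that] h by simp
    show "pos_form h (T x) y = pos_form h x (S y)" for x y
    proof -
      have "B x (S y) = B (T x) y + (B y w * (t - inverse t)) * B x u + (B y u * (inverse t - t)) * B x w"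
        by (simp add: S_def bil iso_inv)
      then show ?thesis
        unfolding pos_form_def h_def bil functional Su
        by (simp add: bil light_like pairing pairing' algebra_simps)
    qed
    show "S ` W \<subseteq> W" if W: "subspace W" "T ` W \<subseteq> W" for W
    proof
      fix y assume "y \<in> S ` W"
      then obtain x where x: "x \<in> W" "y = S x" by blast
      have "inv_into UNIV T x \<in> W" using inv_invariant[OF W] x(1) by blast
      moreover have "(t - inverse t) *\<^sub>R B x w *\<^sub>R u \<in> W" "(inverse t - t) *\<^sub>R B x u *\<^sub>R w \<in> W"
        by (rule subspace_scale[OF W(1) projection_invariant[OF W x(1)]],
            rule subspace_scale[OF W(1) s.projection_invariant[OF W x(1)]])
      ultimately show "y \<in> W"
        unfolding x(2) S_def using W(1) by (simp add: subspace_add mult.commute)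
    qed
  qed
qed

text \<open>For any other eigenvalue, both components of an eigenvector are orthogonal to
  \<open>u\<close> and \<open>w\<close>, hence to the time-like \<open>u + w\<close>; there
  \<open>B\<close> is negative definite and forces modulus 1.\<close>

lemma hyperbolic_eigenvalue:
  assumes "is_eigenvalue T c"
  shows "c = of_real t \<or> c = of_real (inverse t) \<or> cmod c = 1"
proof (rule ccontr)
  assume c: "\<not> ?thesis"
  obtain x y where xy: "x \<noteq> 0 \<or> y \<noteq> 0" "T x = Re c *\<^sub>R x - Im c *\<^sub>R y" "T y = Re c *\<^sub>R y + Im c *\<^sub>R x"
    using assms by (rule is_eigenvalueE)
  have "B x u = 0 \<and> B y u = 0" "B x w = 0 \<and> B y w = 0"
    using invariant_functional_eigenvalue[OF linear_form_left functional(1) xy(2,3)]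
      invariant_functional_eigenvalue[OF linear_form_left functional(2) xy(2,3)] c by auto
  then have "B (u + w) x = 0" "B (u + w) y = 0" using sym[of u x] sym[of w x] sym[of u y] sym[of w y] by (auto simp: bil)
  moreover have "B (u + w) (u + w) > 0" by (simp add: bil light_like pairing pairing')
  ultimately have "z = x \<or> z = y \<Longrightarrow> z \<noteq> 0 \<Longrightarrow> B z z < 0" for z
    using time_like_orthogonal by blast
  then have "B x x + B y y \<noteq> 0"
    using xy(1) by (smt (verit) bilinear_lzero[OF bilinear])
  then have "cmod c = 1" using invariant_form_eigenvalue[where G = B and T = T, OF bilinear sym iso xy(2,3)] by simp
  with c show False by simp
qed

text \<open>Since \<open>t\<close> and \<open>inverse t\<close> are simple roots, all roots of the
  quotient by their linear factors lie on the unit circle.\<close>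

lemma hyperbolic_char_poly:
  obtains l m s a r where "hyperbolic_form T t l m s a r"
proof -
  interpret s: hyperbolic_isometry B p T "inverse t" w u by (rule swap)
  have "[:- t, 1:] dvd op_char_poly T"
    using op_char_poly_root[OF linear_T eigen(1) nonzero(1)] by (simp add: poly_eq_0_iff_dvd)
  then obtain f where f: "op_char_poly T = [:- t, 1:] * f" by (rule dvdE)
  have "poly ([:- t, 1:] * f) (inverse t) = 0"
    using op_char_poly_root[OF linear_T eigen(2) nonzero(2)] f by simp
  then have "poly f (inverse t) = 0" using not_self_inverse[OF t_nonzero t] by auto
  then obtain g where "f = [:- inverse t, 1:] * g" by (metis poly_eq_0_iff_dvd dvdE)
  then have g: "op_char_poly T = [:- t, 1:] * [:- inverse t, 1:] * g" using f by (simp only: mult.assoc)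
  interpret h: map_poly_comm_ring_hom "of_real :: real \<Rightarrow> complex" ..
  have "poly g t \<noteq> 0"
  proof
    assume "poly g t = 0"
    then obtain q where "g = [:- t, 1:] * q" by (metis poly_eq_0_iff_dvd dvdE)
    then have "op_char_poly T = [:- t, 1:] ^ 2 * ([:- inverse t, 1:] * q)"
      using g by (simp only: power2_eq_square ac_simps)
    then show False using simple_root by (metis dvd_triv_left)
  qed
  moreover have "poly g (inverse t) \<noteq> 0"
  proof
    assume "poly g (inverse t) = 0"
    then obtain q where "g = [:- inverse t, 1:] * q" by (metis poly_eq_0_iff_dvd dvdE)
    then have "op_char_poly T = [:- inverse t, 1:] ^ 2 * ([:- t, 1:] * q)"
      using g by (simp only: power2_eq_square ac_simps)
    then show False using s.simple_root by (metis dvd_triv_left)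
  qed
  ultimately have real_roots: "poly (map_poly complex_of_real g) (of_real t) \<noteq> 0"
    "poly (map_poly complex_of_real g) (of_real (inverse t)) \<noteq> 0"
    unfolding of_real_hom.poly_map_poly by simp_all
  have "cmod z = 1" if z: "poly (map_poly complex_of_real g) z = 0" for z
  proof -
    have "poly (map_poly complex_of_real (op_char_poly T)) z = 0"
      unfolding g h.hom_mult using z by simp
    then have "is_eigenvalue T z" by (rule root_op_char_poly_imp_eigenvalue[OF linear_T])
    then show ?thesis using hyperbolic_eigenvalue z real_roots by blast
  qed
  moreover have "monic g"
  proof -
    have "lead_coeff (op_char_poly T) = lead_coeff g" unfolding g lead_coeff_mult by simp
    then show ?thesis using op_char_poly_monic[of T] by simp
  qed
  ultimately obtain l m s a r where 1: "rotation_data s a r"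
    "g = [:-1, 1:] ^ l * [:1, 1:] ^ m * rotation_poly s a r"
    using unit_circle_factorization by metis
  have "op_char_poly T = [:-1, 1:] ^ l * [:1, 1:] ^ m * ([:- t, 1:] * [:- inverse t, 1:] * rotation_poly s a r)"
    unfolding g 1(2) by (simp only: ac_simps)
  then show ?thesis using that 1(1) by (simp add: hyperbolic_form_def)
qed

end

context lorentz_isometry
begin

lemma hyperbolic_isometry_exists:
  assumes u: "T u = t *\<^sub>R u" "u \<noteq> 0" "t \<noteq> 1" "t \<noteq> - 1"
  obtains w where "hyperbolic_isometry B p T t u w"
proof -
  obtain w where w: "w \<noteq> 0" "T w = inverse t *\<^sub>R w" using inverse_eigenvector[OF u(1,2)] by blast
  have t': "inverse t \<noteq> 1" "inverse t \<noteq> - 1"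
    using u(3,4) by (auto simp: inverse_eq_iff_eq[of t 1, simplified] inverse_eq_iff_eq[of t "- 1", simplified])
  have "B u w \<noteq> 0"
  proof
    assume "B u w = 0"
    moreover have "B w w \<ge> 0" using real_eigenvalue_light_like[OF w(2) t'] by simp
    ultimately obtain c where c: "w = c *\<^sub>R u"
      using light_like_orthogonal[OF real_eigenvalue_light_like[OF u(1,3,4)] u(2)] by blast
    then have "t *\<^sub>R w = inverse t *\<^sub>R w" using w(2) u(1) by (simp add: lin)
    then show False using w(1) not_self_inverse[OF eigenvalue_nonzero[OF u(1,2)] u(3,4)] by simp
  qed
  then have "hyperbolic_isometry B p T t u (inverse (B u w) *\<^sub>R w)"
    using u w by unfold_locales (auto simp: lin bil)
  then show ?thesis by (rule that)
qed

end

section \<open>Parabolic isometries\<close>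

text \<open>The normal form of a parabolic isometry on the span of \<open>u\<close>, \<open>e\<close>, \<open>v\<close>: it acts there as the
  transvection \<open>x \<mapsto> x + B x u e - B x e u - B e e / 2 \<cdot> B x u u\<close>, which extends to the unipotent part.\<close>

locale parabolic_isometry = lorentz_isometry +
  fixes u v e :: 'a and g :: real
  assumes Tu: "T u = u" and Tv: "T v = v + e + (g / 2) *\<^sub>R u" and Te: "T e = e + g *\<^sub>R u"
    and uu: "B u u = 0" and vv: "B v v = 0" and uv: "B u v = 1"
    and ue: "B u e = 0" and ve: "B v e = 0" and ee: "B e e = - g" and g: "g > 0"

context lorentz_isometry
begin

text \<open>\<open>T - 1\<close> maps everything into \<open>U\<close>, the vectors orthogonal to
  \<open>u\<close>. Correct \<open>v0\<close> by some \<open>y\<close> in \<open>U\<close> so that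
  its displacement \<open>k\<close> becomes orthogonal to \<open>(T - 1) U\<close>. Then
  \<open>T k - k\<close> is orthogonal to \<open>U\<close>, hence a multiple of \<open>u\<close>,
  which closes the normal form.\<close>

lemma parabolic_isometry_exists:
  assumes u: "T u = u" "u \<noteq> 0" "B u u = 0" and no_fixed: "\<And>h. T h = h \<Longrightarrow> B h h \<le> 0"
  obtains v e g where "parabolic_isometry B p T u v e g"
proof -
  define U where "U = {x. B u x = 0}"
  have U: "subspace U" unfolding U_def subspace_def by (auto simp: bil)
  have U_nonpos: "B x x \<le> 0" if "x \<in> U" for x
    using light_like_orthogonal_nonpos[OF u(3,2)] that by (simp add: U_def)
  have TU: "T x - x \<in> U" for x
  proof -
    have "B u (T x) = B u x" using iso[of u x] u(1) by simp
    then show ?thesis by (simp add: U_def bil)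
  qed
  obtain v0 where v0: "B u v0 = 1"
  proof -
    obtain y where "B u y \<noteq> 0" using nondegenerate u(2) by blast
    then have "B u (inverse (B u y) *\<^sub>R y) = 1" by (simp add: bil)
    then show ?thesis by (rule that)
  qed
  \<comment> \<open>The orthogonal space of \<open>U\<close> is the line of \<open>u\<close>:
    subtracting the right multiple of \<open>u\<close> makes \<open>x\<close> orthogonal to
    \<open>v0\<close> as well, and \<open>U\<close> and \<open>v0\<close> span everything.\<close>
  have perp: "\<exists>d. x = d *\<^sub>R u" if x: "\<And>y. y \<in> U \<Longrightarrow> B x y = 0" for x
  proof -
    have "B (x - B x v0 *\<^sub>R u) y = 0" for y
    proof -
      have "y - B u y *\<^sub>R v0 \<in> U" using v0 by (simp add: U_def bil)
      from x[OF this] show ?thesis by (simp add: bil mult.commute)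
    qed
    then have "x - B x v0 *\<^sub>R u = 0" by (rule nondegenerate)
    then show ?thesis by (metis eq_iff_diff_eq_0)
  qed
  define W where "W = (\<lambda>x. T x - x) ` U"
  have W: "subspace W" unfolding W_def
    by (intro linear_subspace_image linear_compose_sub linear_T linear_ident U)
  have neg_bil: "bilinear (\<lambda>x y. - B x y)"
    unfolding bilinear_def by (auto intro!: linearI simp: bil)
  have "\<exists>z\<in>W. \<forall>y\<in>W. - B (T v0 - v0 - z) y = 0"
    using sym U_nonpos TU W
    by (intro semidefinite_projection[OF neg_bil _ U]) (auto simp: W_def)
  then obtain y where y: "y \<in> U" "\<And>y'. y' \<in> U \<Longrightarrow> B (T v0 - v0 - (T y - y)) (T y' - y') = 0"
    unfolding W_def by auto
  define k where "k = T v0 - v0 - (T y - y)"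
  have kU: "k \<in> U" unfolding k_def by (intro subspace_diff U TU)
  have "\<exists>d. inv_into UNIV T k - k = d *\<^sub>R u"
  proof (rule perp)
    fix y' assume y': "y' \<in> U"
    have "B (T y') k = B y' (inv_into UNIV T k)" by (rule iso_inv)
    then show "B (inv_into UNIV T k - k) y' = 0"
      using y(2)[OF y'] sym[of k "T y'"] sym[of y' "inv_into UNIV T k"] sym[of k y'] unfolding k_def[symmetric] by (simp add: bil)
  qed
  then obtain d where "inv_into UNIV T k - k = d *\<^sub>R u" by blast
  then have "T (inv_into UNIV T k - k) = d *\<^sub>R u" using u(1) by (simp add: lin)
  then have Tk0: "k - T k = d *\<^sub>R u" by (simp add: lin)
  define g where "g = - d"
  have Tk: "T k = k + g *\<^sub>R u" using Tk0 by (simp add: g_def algebra_simps)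
  define v1 where "v1 = v0 - y"
  have v1: "B u v1 = 1" "B v1 u = 1"
    using v0 y(1) sym[of v1 u] by (simp_all add: v1_def U_def bil)
  have Tv1: "T v1 = v1 + k" by (simp add: v1_def k_def lin)
  \<comment> \<open>Multiples of the fixed light-like \<open>u\<close> are free to add: here they
    make \<open>v\<close> light-like, and below they make \<open>e\<close> orthogonal to
    \<open>v\<close>.\<close>
  define v where "v = v1 - (B v1 v1 / 2) *\<^sub>R u"
  have v: "B u v = 1" "B v u = 1" "B v v = 0" using v1 u(3) by (simp_all add: v_def bil)
  have Tv: "T v = v + k" using Tv1 u(1) by (simp add: v_def lin)
  have uk: "B u k = 0" "B k u = 0" using kU sym[of k u] by (simp_all add: U_def)
  have beta: "2 * B v k + B k k = 0"
    using iso[of v v] sym[of k v] by (simp add: Tv bil v)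
  have gk: "g = - B k k"
    using iso[of v k] by (simp add: Tv Tk bil v uk)
  define e where "e = k - B v k *\<^sub>R u"
  have e: "B u e = 0" "B v e = 0" "B e e = - g"
    using sym[of k u] by (simp_all add: e_def bil uk u(3) v gk)
  have Te: "T e = e + g *\<^sub>R u" by (simp add: e_def lin Tk u(1))
  have Tv': "T v = v + e + (g / 2) *\<^sub>R u"
  proof -
    have "B v k = g / 2" using beta gk by simp
    then show ?thesis by (simp add: Tv e_def)
  qed
  \<comment> \<open>The absence of time-like fixed vectors enters here: \<open>g = 0\<close> would
    give \<open>e = 0\<close>, and then \<open>T\<close> would fix the time-like
    \<open>u + v\<close>.\<close>
  have "g \<noteq> 0"
  proof
    assume g0: "g = 0"
    then have "B e e = 0" using e by simp
    then obtain c where "e = c *\<^sub>R u" using light_like_orthogonal[OF u(3,2), of e] e by auto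
    then have "e = 0" using e(2) v by (simp add: bil)
    then have "T (u + v) = u + v" using Tv' g0 u(1) by (simp add: lin)
    moreover have "B (u + v) (u + v) = 2" by (simp add: bil v u(3))
    ultimately show False using no_fixed[of "u + v"] by simp
  qed
  moreover have "g \<ge> 0" using U_nonpos[OF kU] gk by simp
  ultimately have "parabolic_isometry B p T u v e g"
    using u Te Tv' v e by unfold_locales auto
  then show ?thesis by (rule that)
qed

end

context parabolic_isometry
begin

lemma products: "B v u = 1" "B e u = 0" "B e v = 0"
  using uv ue ve sym[of v u] sym[of e u] sym[of e v] by simp_all

lemma u_nonzero: "u \<noteq> 0"
  using uv by (auto simp: bil)

definition unip :: "'a \<Rightarrow> 'a" where
  "unip x = x + B x u *\<^sub>R e - B x e *\<^sub>R u + (g / 2 * B x u) *\<^sub>R u"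

text \<open>The transvection of \<open>unip\<close> with \<open>- e\<close> in place of
  \<open>e\<close>.\<close>

definition unip_inv :: "'a \<Rightarrow> 'a" where
  "unip_inv x = x - B x u *\<^sub>R e + B x e *\<^sub>R u + (g / 2 * B x u) *\<^sub>R u"

definition ss :: "'a \<Rightarrow> 'a" where "ss = T \<circ> unip_inv"

lemma linear_unip: "linear unip"
  by (rule linearI) (simp_all add: unip_def bil algebra_simps add_divide_distrib)

lemma linear_unip_inv: "linear unip_inv"
  by (rule linearI) (simp_all add: unip_inv_def bil algebra_simps add_divide_distrib)

lemma unip_inv_unip: "unip_inv (unip x) = x"
proof -
  have "B (unip x) u = B x u" "B (unip x) e = B x e - g * B x u"
    by (simp_all add: unip_def bil uu ee products ue)
  then show ?thesis unfolding unip_inv_def[of "unip x"]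
    by (simp add: unip_def algebra_simps) (simp flip: scaleR_add_left)
qed

lemma iso_unip_inv: "B (unip_inv x) (unip_inv y) = B x y"
  using sym[of e y] sym[of u y]
  by (simp add: unip_inv_def bil uu ee products ue algebra_simps)

lemma linear_ss: "linear ss"
  unfolding ss_def by (intro linear_compose linear_unip_inv linear_T)

lemma iso_ss: "B (ss x) (ss y) = B x y"
  by (simp add: ss_def iso iso_unip_inv)

lemma T_eq: "T = ss \<circ> unip"
  by (simp add: fun_eq_iff ss_def unip_inv_unip)

text \<open>\<open>T\<close> and \<open>unip\<close> agree on \<open>u\<close>, \<open>e\<close> and
  \<open>v\<close>. As \<open>ss\<close> fixes \<open>u\<close> and \<open>e\<close>, from which
  \<open>unip\<close> is built, it commutes with \<open>unip\<close>; and \<open>u + v\<close> is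
  its time-like fixed vector.\<close>

lemma ss_fixed: "ss u = u" "ss e = e" "ss v = v"
proof -
  show "ss u = u" by (simp add: ss_def unip_inv_def uu ue Tu)
  have "unip_inv e = e - g *\<^sub>R u" by (simp add: unip_inv_def products ee)
  then show "ss e = e" by (simp add: ss_def lin Te Tu)
  have "unip_inv v = v - e + (g / 2) *\<^sub>R u" by (simp add: unip_inv_def products ve)
  then have "ss v = v + e + (g / 2) *\<^sub>R u - (e + g *\<^sub>R u) + (g / 2) *\<^sub>R u"
    by (simp add: ss_def lin Te Tu Tv)
  also have "g *\<^sub>R u = (g / 2) *\<^sub>R u + (g / 2) *\<^sub>R u" by (simp flip: scaleR_add_left)
  also have "v + e + (g / 2) *\<^sub>R u - (e + ((g / 2) *\<^sub>R u + (g / 2) *\<^sub>R u)) + (g / 2) *\<^sub>R u = v"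
    by (simp add: algebra_simps)
  finally show "ss v = v" .
qed

lemma ss_functional: "B (ss x) u = B x u" "B (ss x) e = B x e"
  using iso_ss[of x u] iso_ss[of x e] ss_fixed by simp_all

lemma ss_unip_commute: "ss \<circ> unip = unip \<circ> ss"
  by (rule ext)
    (simp add: unip_def ss_functional ss_fixed linear_add[OF linear_ss] linear_diff[OF linear_ss]
      linear_scale[OF linear_ss])

lemma ss_elliptic: "elliptic_isometry B p ss (u + v)"
proof -
  have h: "B (u + v) (u + v) > 0" by (simp add: bil uu vv uv products)
  have f: "ss (u + v) = u + v" by (simp add: linear_add[OF linear_ss] ss_fixed)
  interpret s: lorentz_isometry B p ss
    by (rule isometry_fixing_time_like[OF linear_ss iso_ss h f])
  show ?thesis using h f by unfold_locales
qed

lemma unip_diff: "unip x - x = B x u *\<^sub>R e - B x e *\<^sub>R u + (g / 2 * B x u) *\<^sub>R u"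
  by (simp add: unip_def)

lemma unip_nilpotent:
  "((\<lambda>w. unip w - w) ^^ 2) x = (g * B x u) *\<^sub>R u" "((\<lambda>w. unip w - w) ^^ 3) x = 0"
proof -
  have 2: "unip (unip x - x) - (unip x - x) = (g * B x u) *\<^sub>R u" for x
  proof -
    have "B (unip x - x) u = 0" "B (unip x - x) e = - g * B x u"
      unfolding unip_diff by (simp_all add: bil uu ee products ue)
    then show ?thesis unfolding unip_diff[of "unip x - x"] by simp
  qed
  have 3: "unip (c *\<^sub>R u) - c *\<^sub>R u = 0" for c
    unfolding unip_diff by (simp add: bil uu ue)
  show "((\<lambda>w. unip w - w) ^^ 2) x = (g * B x u) *\<^sub>R u"
    by (simp add: numeral_2_eq_2 2)
  show "((\<lambda>w. unip w - w) ^^ 3) x = 0"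
    by (simp add: numeral_3_eq_3 2 3)
qed

lemma unip_v: "((\<lambda>w. unip w - w) ^^ 2) v \<noteq> 0"
  using g u_nonzero by (simp add: unip_nilpotent products)

lemma unip_not_id: "unip \<noteq> id"
proof
  assume "unip = id"
  then have "((\<lambda>w. unip w - w) ^^ 2) v = 0" by (simp add: numeral_2_eq_2)
  with unip_v show False by simp
qed

text \<open>An eigenvector for \<open>c \<noteq> 1\<close> is orthogonal to \<open>u\<close>, so
  \<open>unip - 1\<close> sends it to a multiple of \<open>u\<close>. Pairing with \<open>e\<close>,
  which is orthogonal to \<open>u\<close>, shows that multiple to be zero, and nondegeneracy leaves
  only the zero vector.\<close>

lemma unip_unipotent: "unipotent_op unip"
  unfolding unipotent_op_def
proof (intro allI impI)
  fix c assume "is_eigenvalue unip c"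
  then obtain x y where xy: "x \<noteq> 0 \<or> y \<noteq> 0" "unip x = Re c *\<^sub>R x - Im c *\<^sub>R y"
    "unip y = Re c *\<^sub>R y + Im c *\<^sub>R x"
    by (rule is_eigenvalueE)
  show "c = 1"
  proof (rule ccontr)
    assume c: "c \<noteq> 1"
    have f: "B (unip x) u = 1 * B x u" for x by (simp add: unip_def bil uu products)
    have xu: "B x u = 0 \<and> B y u = 0"
      by (rule invariant_functional_eigenvalue[OF linear_form_left f xy(2,3)]) (use c in simp)
    define \<phi> where "\<phi> z = Complex (B x z) (B y z)" for z
    have "unip x = x - B x e *\<^sub>R u" "unip y = y - B y e *\<^sub>R u" using xu by (simp_all add: unip_def)
    then have eq: "x - B x e *\<^sub>R u = Re c *\<^sub>R x - Im c *\<^sub>R y" "y - B y e *\<^sub>R u = Re c *\<^sub>R y + Im c *\<^sub>R x"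
      using xy(2,3) by simp_all
    have "B (x - B x e *\<^sub>R u) z = B (Re c *\<^sub>R x - Im c *\<^sub>R y) z"
      "B (y - B y e *\<^sub>R u) z = B (Re c *\<^sub>R y + Im c *\<^sub>R x) z" for z
      using eq by simp_all
    then have key: "(c - 1) * \<phi> z = - (\<phi> e * of_real (B u z))" for z
      by (simp add: \<phi>_def complex_eq_iff bil algebra_simps)
    have "\<phi> e = 0" using key[of e] c by (simp add: ue)
    then have "\<phi> z = 0" for z using key[of z] c by simp
    then have "B x z = 0" "B y z = 0" for z by (simp_all add: \<phi>_def complex_eq_iff)
    then show False using nondegenerate xy(1) by blast
  qed
qed

lemma jordan: "jordan_decomposition T ss unip"
  unfolding jordan_decomposition_def
  by (intro conjI linear_ss linear_unip elliptic_isometry.elliptic_semisimple[OF ss_elliptic]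
      unip_unipotent T_eq ss_unip_commute)

lemma unip_minimal_poly: "is_minimal_poly unip ([:-1, 1:] ^ 3)"
  unfolding is_minimal_poly_def
proof (intro conjI allI impI)
  interpret linear_endo scaleR unip by (rule linear_endo_real[OF linear_unip])
  show "lead_coeff ([:-1, 1:] ^ 3 :: real poly) = 1" by (simp add: lead_coeff_power)
  show "poly_op ([:-1, 1:] ^ 3) unip x = 0" for x
    using gpoly_linear_power[of 1 3 x] unip_nilpotent(2)[of x]
    by (simp add: poly_op_eq_gpoly[OF linear_unip] del: power_Suc)
  show "[:-1, 1:] ^ 3 dvd q" if "\<forall>v. poly_op q unip v = 0" for q
    using mult_eigenvalue_one_dvd[OF linear_unip unip_v, of q] that unip_nilpotent(2)[of v]
    by (simp only: numeral_3_eq_3 numeral_2_eq_2 simp_thms)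
qed

lemma T_nilpotent: "((\<lambda>w. T w - w) ^^ 2) v = g *\<^sub>R u" "((\<lambda>w. T w - w) ^^ 3) v = 0"
proof -
  have 1: "T v - v = e + (g / 2) *\<^sub>R u" by (simp add: Tv)
  have 2: "T (T v - v) - (T v - v) = g *\<^sub>R u" unfolding 1 by (simp add: lin Te Tu)
  show "((\<lambda>w. T w - w) ^^ 2) v = g *\<^sub>R u" by (simp add: numeral_2_eq_2 2)
  show "((\<lambda>w. T w - w) ^^ 3) v = 0"
    by (simp only: numeral_3_eq_3 funpow.simps comp_apply id_apply 2) (simp add: lin Tu)
qed

lemma not_semisimple: "\<not> semisimple_op T"
proof
  assume "semisimple_op T"
  have "((\<lambda>w. cop T w - cscale 1 w) ^^ k) (x, 0) = (((\<lambda>w. T w - w) ^^ k) x, 0)" for k x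
    by (induction k) (simp_all add: cop_def lin)
  from this[of 3 v] have "((\<lambda>w. cop T w - cscale 1 w) ^^ 3) (v, 0) = 0"
    by (simp only: T_nilpotent zero_prod_def)
  then have "cop T (v, 0) = cscale 1 (v, 0)"
    by (rule semisimple_eigenspace[OF \<open>semisimple_op T\<close> linear_T])
  then have "T v = v" by (simp add: cop_def)
  then have "T v - v = 0" by simp
  then have "((\<lambda>w. T w - w) ^^ 2) v = 0" by (simp add: numeral_2_eq_2 lin)
  then show False using g u_nonzero by (simp add: T_nilpotent)
qed

text \<open>\<open>ss\<close> acts on \<open>z\<close> as \<open>c \<noteq> 1\<close> and fixes
  \<open>u\<close> and \<open>e\<close>, so the components of \<open>z\<close> are orthogonal to
  both. There \<open>unip\<close> is the identity and \<open>T\<close> equals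
  \<open>ss\<close>.\<close>

lemma parabolic_pure:
  assumes z: "((\<lambda>w. cop T w - cscale c w) ^^ k) z = 0" and c: "c \<noteq> 1"
  shows "cop T z = cscale c z"
proof -
  have S: "cop ss z = cscale c z"
    by (rule jordan_semisimple_part_eigenvector[OF jordan z])
  obtain x y where xy: "z = (x, y)" by fastforce
  have eq: "ss x = Re c *\<^sub>R x - Im c *\<^sub>R y" "ss y = Re c *\<^sub>R y + Im c *\<^sub>R x"
    using S by (simp_all add: xy cop_def cscale_def)
  have f: "B (ss x) u = 1 * B x u" "B (ss x) e = 1 * B x e" for x by (simp_all add: ss_functional)
  have "B x u = 0 \<and> B y u = 0"
    by (rule invariant_functional_eigenvalue[OF linear_form_left f(1) eq]) (use c in simp)
  moreover have "B x e = 0 \<and> B y e = 0"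
    by (rule invariant_functional_eigenvalue[OF linear_form_left f(2) eq]) (use c in simp)
  ultimately have "unip x = x" "unip y = y" by (simp_all add: unip_def)
  then have "T x = ss x" "T y = ss y" using fun_cong[OF T_eq, of x] fun_cong[OF T_eq, of y] by simp_all
  then have "cop T z = cop ss z" by (simp add: xy cop_def)
  with S show ?thesis by simp
qed

lemma parabolic_eigenvalue:
  assumes "is_eigenvalue T c"
  shows "cmod c = 1"
proof (cases "c = 1")
  case False
  obtain z where z: "z \<noteq> 0" "cop T z = cscale c z"
    using assms by (auto simp: is_eigenvalue_def ceigenspace_def)
  then have "((\<lambda>w. cop T w - cscale c w) ^^ 1) z = 0" by simp
  then have "cop ss z = cscale c z" by (rule jordan_semisimple_part_eigenvector[OF jordan])
  then have "z \<in> ceigenspace ss c" by (simp add: ceigenspace_def)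
  then have "is_eigenvalue ss c" using z(1) unfolding is_eigenvalue_def by blast
  then show ?thesis by (rule elliptic_isometry.elliptic_eigenvalue[OF ss_elliptic])
qed simp

lemma parabolic_char_poly:
  obtains l m s a r where "parabolic_form T l m s a r"
proof -
  have "cmod z = 1" if "poly (map_poly complex_of_real (op_char_poly T)) z = 0" for z
    using parabolic_eigenvalue[OF root_op_char_poly_imp_eigenvalue[OF linear_T that]] .
  then obtain l m s a r where 1: "rotation_data s a r"
    "op_char_poly T = [:-1, 1:] ^ l * [:1, 1:] ^ m * rotation_poly s a r"
    by (rule unit_circle_factorization[OF op_char_poly_monic])
  \<comment> \<open>\<open>v\<close> starts a Jordan chain of length three for the eigenvalue 1, so
    the cube of \<open>x - 1\<close> divides the characteristic polynomial.\<close>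
  have "((\<lambda>w. T w - w) ^^ 2) v \<noteq> 0" using g u_nonzero by (simp add: T_nilpotent)
  moreover have "((\<lambda>w. T w - w) ^^ Suc 2) v = 0" using T_nilpotent(2) by (simp only: numeral_3_eq_3 numeral_2_eq_2)
  ultimately have "[:-1, 1:] ^ Suc 2 dvd op_char_poly T"
    using mult_eigenvalue_one_dvd[OF linear_T] op_cayley_hamilton[OF linear_T] by blast
  then have "Suc 2 \<le> l" using root_one_multiplicity_factorization[OF 1(1)] 1(2) by metis
  then show ?thesis using that 1 by (simp add: parabolic_form_def)
qed

end

section \<open>Orientation\<close>

lemma independent_image_iff:
  fixes f :: "nat \<Rightarrow> 'a::real_vector"
  shows "inj_on f {..<N} \<and> independent (f ` {..<N}) \<longleftrightarrow>
    (\<forall>c. (\<Sum>i<N. c i *\<^sub>R f i) = 0 \<longrightarrow> (\<forall>i<N. c i = 0))" (is "?L \<longleftrightarrow> ?R")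
proof
  assume L: ?L
  show ?R
  proof (intro allI impI)
    fix c i assume c: "(\<Sum>i<N. c i *\<^sub>R f i) = 0" and i: "i < N"
    define d where "d y = c (the_inv_into {..<N} f y)" for y
    have "(\<Sum>y\<in>f ` {..<N}. d y *\<^sub>R y) = (\<Sum>i<N. c i *\<^sub>R f i)"
      using L by (simp add: sum.reindex d_def the_inv_into_f_f)
    then have "d (f i) = 0" using L c i by (auto simp: dependent_finite)
    then show "c i = 0" using L i by (simp add: d_def the_inv_into_f_f)
  qed
next
  assume R: ?R
  have inj: "inj_on f {..<N}"
  proof (rule inj_onI, rule ccontr)
    fix i j assume ij: "i \<in> {..<N}" "j \<in> {..<N}" "f i = f j" "i \<noteq> j"
    define c where "c k = (if k = i then 1 else if k = j then - 1 else 0 :: real)" for k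
    have "(\<Sum>k<N. c k *\<^sub>R f k) = (\<Sum>k\<in>{i, j}. c k *\<^sub>R f k)"
      using ij by (intro sum.mono_neutral_right) (auto simp: c_def)
    also have "\<dots> = 0" using ij by (simp add: c_def)
    finally have "c i = 0" using R ij by auto
    then show False by (simp add: c_def)
  qed
  moreover have "independent (f ` {..<N})"
  proof -
    have "d y = 0" if d: "(\<Sum>y\<in>f ` {..<N}. d y *\<^sub>R y) = 0" and y: "y \<in> f ` {..<N}" for d y
    proof -
      have "(\<Sum>i<N. d (f i) *\<^sub>R f i) = 0" using inj d by (simp add: sum.reindex)
      then show ?thesis using R[rule_format, of "\<lambda>i. d (f i)"] y by auto
    qed
    then show ?thesis by (auto simp: dependent_finite)
  qed
  ultimately show ?L by blast
qed

lemma span_image_lessThan: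
  fixes f :: "nat \<Rightarrow> 'a::real_vector"
  assumes "y \<in> span (f ` {..<N})"
  shows "\<exists>c. y = (\<Sum>i<N. c i *\<^sub>R f i)"
  using assms
proof (induction rule: span_induct_alt)
  case base
  show ?case by (rule exI[of _ "\<lambda>_. 0"]) simp
next
  case (step t x y)
  then obtain k c where k: "k < N" "x = f k" and c: "y = (\<Sum>i<N. c i *\<^sub>R f i)" by auto
  have "(\<Sum>i<N. (c i + (if i = k then t else 0)) *\<^sub>R f i) = y + (\<Sum>i<N. if i = k then t *\<^sub>R f k else 0)"
    unfolding c sum.distrib[symmetric] by (intro sum.cong) (auto simp: scaleR_left_distrib)
  also have "\<dots> = t *\<^sub>R x + y" using k by simp
  finally show ?case by metis
qed

locale hyperboloid = lorentz +
  fixes Q :: "'a \<Rightarrow> real" and H :: "'a set"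
  assumes Q: "Q v = B v v"
    and H: "H = {q. B q q = 1 \<and> B p q > 0}"
    and connected_H: "connected H"
begin

lemma Suc_N: "Suc (DIM('a) - 1) = DIM('a)"
  using DIM_positive[where 'a = 'a] by simp

lemma polar_form_eq: "polar_form Q x y = B x y"
  using sym[of y x] by (simp add: polar_form_def Q bil)

lemma tangent_space_eq: "tangent_space Q q = {v. B q v = 0}"
  by (simp add: tangent_space_def polar_form_eq)

lemma p_in_H: "p \<in> H"
  by (simp add: H base)

lemma dim_tangent_space:
  assumes "q \<in> H"
  shows "dim {v. B q v = 0} = (DIM('a) - 1)"
proof -
  let ?S = "{v. B q v = 0}"
  have q: "B q q = 1" using assms by (simp add: H)
  have S: "subspace ?S" unfolding subspace_def by (auto simp: bil)
  then have "q \<notin> span ?S" using q by (auto simp: span_eq_iff[THEN iffD2])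
  then have "dim (insert q ?S) = Suc (dim ?S)" by (simp add: dim_insert)
  moreover have "span (insert q ?S) = UNIV"
  proof -
    have "x \<in> span (insert q ?S)" for x
    proof -
      have "x - B q x *\<^sub>R q \<in> ?S" by (simp add: bil q)
      then have "(x - B q x *\<^sub>R q) + B q x *\<^sub>R q \<in> span (insert q ?S)"
        by (intro span_add span_scale span_base) auto
      then show ?thesis by simp
    qed
    then show ?thesis by auto
  qed
  then have "dim (insert q ?S) = DIM('a)" by (metis dim_UNIV dim_span)
  ultimately show ?thesis by simp
qed

text \<open>By dimension, independent tangent vectors of the right number already span, so the
  condition on the span reduces to tangency.\<close>

lemma tangent_frames_iff:
  "(q, b) \<in> tangent_frames Q H \<longleftrightarrow> q \<in> H \<and> (\<forall>j<(DIM('a) - 1). B q (b j) = 0) \<and> (\<forall>j\<ge>(DIM('a) - 1). b j = 0) \<and>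
    (\<forall>c. (\<Sum>i<(DIM('a) - 1). c i *\<^sub>R b i) = 0 \<longrightarrow> (\<forall>i<(DIM('a) - 1). c i = 0))"
proof -
  have S: "subspace {v. B q v = 0}" unfolding subspace_def by (auto simp: bil)
  have "span (b ` {..<(DIM('a) - 1)}) = {v. B q v = 0} \<longleftrightarrow> (\<forall>j<(DIM('a) - 1). B q (b j) = 0)"
    if q: "q \<in> H" and ind: "inj_on b {..<(DIM('a) - 1)}" "independent (b ` {..<(DIM('a) - 1)})"
  proof
    assume "span (b ` {..<(DIM('a) - 1)}) = {v. B q v = 0}"
    then show "\<forall>j<(DIM('a) - 1). B q (b j) = 0" using span_superset[of "b ` {..<(DIM('a) - 1)}"] by blast
  next
    assume "\<forall>j<(DIM('a) - 1). B q (b j) = 0"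
    then have "span (b ` {..<(DIM('a) - 1)}) \<subseteq> {v. B q v = 0}" by (intro span_minimal S) auto
    moreover have "dim (span (b ` {..<(DIM('a) - 1)})) = (DIM('a) - 1)"
      using ind by (simp add: dim_eq_card_independent card_image)
    ultimately show "span (b ` {..<(DIM('a) - 1)}) = {v. B q v = 0}"
      using dim_tangent_space[OF q] S by (intro subspace_dim_equal) auto
  qed
  then show ?thesis
    unfolding tangent_frames_def tangent_space_eq independent_image_iff[symmetric] by auto
qed

text \<open>A hypersurface oriented by its normal: \<open>q\<close> itself is orthogonal to the
  tangent space at \<open>q\<close> and is put in front of the tangent frame.\<close>

definition frame_sign :: "'a \<times> (nat \<Rightarrow> 'a) \<Rightarrow> real" where
  "frame_sign x = sgn (frame_det (case_nat (fst x) (snd x)))"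

lemma sum_case_nat: "(\<Sum>i<DIM('a). c i *\<^sub>R case_nat q b i) = c 0 *\<^sub>R q + (\<Sum>i<(DIM('a) - 1). c (Suc i) *\<^sub>R b i)"
  using sum.lessThan_Suc_shift[of "\<lambda>i. c i *\<^sub>R case_nat q b i" "DIM('a) - 1"] by simp

lemma frame_det_nonzero:
  assumes "(q, b) \<in> tangent_frames Q H"
  shows "frame_det (case_nat q b) \<noteq> 0"
proof
  assume "frame_det (case_nat q b) = 0"
  then obtain c where c: "\<exists>i<DIM('a). c i \<noteq> 0" "(\<Sum>i<DIM('a). c i *\<^sub>R case_nat q b i) = 0"
    using frame_det_zero_imp_dependent by blast
  have q: "B q q = 1" and b: "\<forall>j<(DIM('a) - 1). B q (b j) = 0"
    and ind: "\<And>c i. (\<Sum>i<(DIM('a) - 1). c i *\<^sub>R b i) = 0 \<Longrightarrow> i < (DIM('a) - 1) \<Longrightarrow> c i = 0"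
    using assms unfolding tangent_frames_iff by (auto simp: H)
  have lin: "linear (B q)" using bilinear by (simp add: bilinear_def)
  have "B q (\<Sum>i<(DIM('a) - 1). c (Suc i) *\<^sub>R b i) = 0"
    using b by (simp add: linear_sum[OF lin] linear_scale[OF lin])
  then have "c 0 = 0" using arg_cong[OF c(2), of "B q"] q by (simp add: sum_case_nat bil)
  then have "(\<Sum>i<(DIM('a) - 1). c (Suc i) *\<^sub>R b i) = 0" using c(2) by (simp add: sum_case_nat)
  then have "c (Suc i) = 0" if "i < (DIM('a) - 1)" for i using ind[of "\<lambda>i. c (Suc i)"] that by blast
  with \<open>c 0 = 0\<close> have "c i = 0" if "i < Suc (DIM('a) - 1)" for i using that by (cases i) auto
  then show False using c(1) unfolding Suc_N by blast
qed

text \<open>The full frames differ by the block matrix with blocks 1 and \<open>M\<close>.\<close>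

lemma frame_det_case_nat_change:
  fixes q :: 'a
  assumes M: "M \<in> carrier_mat (DIM('a) - 1) (DIM('a) - 1)" and c: "\<forall>j<(DIM('a) - 1). c j = (\<Sum>i<(DIM('a) - 1). M $$ (i, j) *\<^sub>R b i)"
  shows "frame_det (case_nat q c) = frame_det (case_nat q b) * Determinant.det M"
proof -
  define M' where "M' = four_block_mat (1\<^sub>m 1) (0\<^sub>m 1 (DIM('a) - 1)) (0\<^sub>m (DIM('a) - 1) 1) M"
  have M': "M' \<in> carrier_mat (Suc (DIM('a) - 1)) (Suc (DIM('a) - 1))"
    using four_block_carrier_mat[OF one_carrier_mat[of 1] M] by (simp add: M'_def)
  have "Determinant.det M' = Determinant.det (1\<^sub>m 1) * Determinant.det M"
    unfolding M'_def by (rule det_four_block_mat_lower_left_zero) (use M in auto)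
  then have det: "Determinant.det M' = Determinant.det M" by simp
  have "frame_det (case_nat q c) = frame_det (case_nat q b) * Determinant.det M'"
  proof (rule frame_det_change)
    show "M' \<in> carrier_mat DIM('a) DIM('a)" using M' Suc_N by simp
    fix j assume j: "j < DIM('a)"
    have idx: "M' $$ (0, 0) = 1" "i < (DIM('a) - 1) \<Longrightarrow> M' $$ (Suc i, 0) = 0" "k < (DIM('a) - 1) \<Longrightarrow> M' $$ (0, Suc k) = 0"
      "i < (DIM('a) - 1) \<Longrightarrow> k < (DIM('a) - 1) \<Longrightarrow> M' $$ (Suc i, Suc k) = M $$ (i, k)" for i k
      using M by (auto simp: M'_def)
    have "case_nat q c j = M' $$ (0, j) *\<^sub>R q + (\<Sum>i<(DIM('a) - 1). M' $$ (Suc i, j) *\<^sub>R b i)"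
    proof (cases j)
      case 0
      then show ?thesis by (simp add: idx)
    next
      case (Suc k)
      then have "k < (DIM('a) - 1)" using j by simp
      with Suc show ?thesis using c by (simp add: idx)
    qed
    then show "case_nat q c j = (\<Sum>i<DIM('a). M' $$ (i, j) *\<^sub>R case_nat q b i)"
      by (simp only: sum_case_nat)
  qed
  then show ?thesis by (simp add: det)
qed

lemma continuous_on_case_nat:
  assumes "continuous_on S f" "\<And>j. continuous_on S (\<lambda>x. g x j)"
  shows "continuous_on S (\<lambda>x. case_nat (f x) (g x) j)"
  using assms by (cases j) auto

lemma is_orientation_frame_sign: "is_orientation Q H frame_sign"
  unfolding is_orientation_def
proof (intro conjI allI ballI impI)
  show "frame_sign ` tangent_frames Q H \<subseteq> {- 1, 1}"
    using frame_det_nonzero by (auto simp: frame_sign_def sgn_if)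
  show "continuous_on (tangent_frames Q H) frame_sign"
    unfolding frame_sign_def
  proof (rule continuous_on_sgn)
    show "continuous_on (tangent_frames Q H) (\<lambda>x. frame_det (case_nat (fst x) (snd x)))"
      by (intro continuous_on_frame_det continuous_on_case_nat continuous_on_fst continuous_on_id
          continuous_on_product_then_coordinatewise[OF continuous_on_snd[OF continuous_on_id]])
    show "\<forall>x\<in>tangent_frames Q H. frame_det (case_nat (fst x) (snd x)) \<noteq> 0"
      using frame_det_nonzero by auto
  qed
  fix q b c M
  assume M: "M \<in> carrier_mat (DIM('a) - 1) (DIM('a) - 1)" and "(q, b) \<in> tangent_frames Q H \<and> (q, c) \<in> tangent_frames Q H \<and>
    (\<forall>j<(DIM('a) - 1). c j = (\<Sum>i<(DIM('a) - 1). M $$ (i, j) *\<^sub>R b i))"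
  then have "frame_det (case_nat q c) = frame_det (case_nat q b) * Determinant.det M"
    by (intro frame_det_case_nat_change) auto
  then show "frame_sign (q, c) = sgn (Determinant.det M) * frame_sign (q, b)"
    by (simp add: frame_sign_def sgn_mult)
qed

text \<open>Projecting a frame at \<open>p\<close> along \<open>q\<close> gives a frame at every \<open>q \<in> H\<close>.\<close>

definition moving_frame :: "(nat \<Rightarrow> 'a) \<Rightarrow> 'a \<Rightarrow> nat \<Rightarrow> 'a" where
  "moving_frame b q j = b j - B q (b j) *\<^sub>R q"

text \<open>A vanishing combination of the projected vectors puts the same combination of
  \<open>b\<close> on the line of \<open>q\<close>. That combination is orthogonal to
  \<open>p\<close> while \<open>B p q > 0\<close>, so it is zero.\<close>

lemma moving_frame:
  assumes b: "(p, b) \<in> tangent_frames Q H" and q: "q \<in> H"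
  shows "(q, moving_frame b q) \<in> tangent_frames Q H"
proof -
  have bp: "\<forall>j<(DIM('a) - 1). B p (b j) = 0" "\<forall>j\<ge>(DIM('a) - 1). b j = 0"
    and ind: "\<And>c i. (\<Sum>i<(DIM('a) - 1). c i *\<^sub>R b i) = 0 \<Longrightarrow> i < (DIM('a) - 1) \<Longrightarrow> c i = 0"
    using b by (auto simp: tangent_frames_iff)
  have qq: "B q q = 1" "B p q > 0" using q by (auto simp: H)
  have lin: "linear (B p)" using bilinear by (simp add: bilinear_def)
  have "c i = 0" if c: "(\<Sum>i<(DIM('a) - 1). c i *\<^sub>R moving_frame b q i) = 0" and i: "i < (DIM('a) - 1)" for c i
  proof -
    define y where "y = (\<Sum>i<(DIM('a) - 1). c i *\<^sub>R b i)"
    have "(\<Sum>i<(DIM('a) - 1). c i *\<^sub>R moving_frame b q i) = y - (\<Sum>i<(DIM('a) - 1). c i * B q (b i)) *\<^sub>R q"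
      by (simp add: moving_frame_def y_def scaleR_right_diff_distrib sum_subtractf scaleR_sum_left)
    with c have y: "y = (\<Sum>i<(DIM('a) - 1). c i * B q (b i)) *\<^sub>R q" by simp
    have "B p y = 0" using bp by (simp add: y_def linear_sum[OF lin] linear_scale[OF lin])
    then have "y = 0" using y qq(2) by (auto simp: bil)
    then show "c i = 0" using ind i by (simp add: y_def)
  qed
  then show ?thesis
    using q bp(2) by (auto simp: tangent_frames_iff moving_frame_def bil qq)
qed

lemma frame_at_base_exists: "\<exists>b. (p, b) \<in> tangent_frames Q H"
proof -
  let ?S = "{v. B p v = 0}"
  have S: "subspace ?S" unfolding subspace_def by (auto simp: bil)
  obtain C where C: "C \<subseteq> ?S" "independent C" "?S \<subseteq> span C" "card C = dim ?S"
    by (metis basis_exists)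
  have "finite C" using C(2) by (simp add: independent_imp_finite)
  then obtain f where f: "bij_betw f {0..<card C} C" using ex_bij_betw_nat_finite by blast
  have card: "card C = (DIM('a) - 1)" using C(4) dim_tangent_space[OF p_in_H] by simp
  define b where "b j = (if j < (DIM('a) - 1) then f j else 0)" for j
  have img: "b ` {..<(DIM('a) - 1)} = C" "inj_on b {..<(DIM('a) - 1)}"
    using f by (auto simp: b_def card bij_betw_def inj_on_def atLeast0LessThan)
  have "span C = ?S" using C S by (simp add: span_minimal subset_antisym)
  then have "(p, b) \<in> tangent_frames Q H"
    unfolding tangent_frames_def tangent_space_eq using img C(2) p_in_H by (auto simp: b_def)
  then show ?thesis by blast
qed

end

lemma (in hyperboloid) connected_sign_constant:
  fixes f :: "'a \<Rightarrow> real"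
  assumes "continuous_on H f" "f ` H \<subseteq> {- 1, 1}" "x \<in> H" "y \<in> H"
  shows "f x = f y"
proof -
  have "finite (f ` H)" using assms(2) finite_subset by blast
  then have "f constant_on H" by (rule continuous_finite_range_constant[OF connected_H assms(1)])
  then show ?thesis using assms(3,4) unfolding constant_on_def by metis
qed

locale hyperboloid_isometry = hyperboloid + lorentz_isometry
begin

lemma T_in_H: "q \<in> H \<Longrightarrow> T q \<in> H"
proof -
  assume "q \<in> H"
  then have q: "B q q = 1" "B p q > 0" by (simp_all add: H)
  then have "q \<noteq> 0" by (auto simp: bil)
  then have Tq: "T q \<noteq> 0" using injD[OF inj_T, of q 0] by (auto simp: lin)
  have "B (T p) (T q) * (B p (T p) * B p (T q)) > 0"
    using q base Tq by (intro inner_time_like_sign) (auto simp: iso)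
  then have "B p (T q) > 0" using q time by (simp add: iso zero_less_mult_iff)
  then show "T q \<in> H" using q by (simp add: H iso)
qed

lemma T_frame:
  assumes b: "(q, b) \<in> tangent_frames Q H"
  shows "(T q, T \<circ> b) \<in> tangent_frames Q H"
proof -
  have ind: "\<And>c i. (\<Sum>i<(DIM('a) - 1). c i *\<^sub>R b i) = 0 \<Longrightarrow> i < (DIM('a) - 1) \<Longrightarrow> c i = 0"
    using b by (auto simp: tangent_frames_iff)
  have "c i = 0" if c: "(\<Sum>i<(DIM('a) - 1). c i *\<^sub>R (T \<circ> b) i) = 0" and i: "i < (DIM('a) - 1)" for c i
  proof -
    have "T (\<Sum>i<(DIM('a) - 1). c i *\<^sub>R b i) = 0" using c by (simp add: linear_sum[OF linear_T] lin)
    then have "(\<Sum>i<(DIM('a) - 1). c i *\<^sub>R b i) = 0" using inj_T lin(5) by (metis injD)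
    then show ?thesis by (rule ind[OF _ i])
  qed
  then show ?thesis using b T_in_H by (auto simp: tangent_frames_iff iso lin)
qed

lemma frame_det_T: "frame_det (case_nat (T q) (T \<circ> b)) = op_det T * frame_det (case_nat q b)"
proof -
  have "case_nat (T q) (T \<circ> b) = T \<circ> case_nat q b" by (auto simp: fun_eq_iff split: nat.split)
  then show ?thesis by (simp add: frame_det_op[OF linear_T])
qed

lemma orientation_preserving_if:
  assumes "op_det T > 0"
  shows "orientation_preserving Q H T"
  unfolding orientation_preserving_def
proof (intro exI conjI ballI, rule is_orientation_frame_sign, clarify)
  fix q b
  show "frame_sign (T q, T \<circ> b) = frame_sign (q, b)"
    using assms by (simp add: frame_sign_def frame_det_T sgn_mult)
qed

text \<open>A given orientation \<open>\<sigma>\<close> and \<open>frame_sign\<close> are both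
  constant along the moving frame, since \<open>H\<close> is connected, so each has equal values at
  \<open>p\<close> and \<open>T p\<close>. Comparing the moving frame at \<open>T p\<close> with the
  image frame by \<open>M\<close>, invariance of \<open>\<sigma>\<close> forces
  \<open>sgn (det M) = 1\<close>; then \<open>frame_sign\<close> is preserved too, and
  \<open>T\<close> changes it by the sign of its determinant.\<close>

lemma orientation_preserving_only_if:
  assumes "orientation_preserving Q H T"
  shows "op_det T > 0"
proof -
  obtain \<sigma> where \<sigma>: "is_orientation Q H \<sigma>"
    and inv: "\<And>q b. (q, b) \<in> tangent_frames Q H \<Longrightarrow> \<sigma> (T q, T \<circ> b) = \<sigma> (q, b)"
    using assms by (auto simp: orientation_preserving_def)
  have \<sigma>_range: "\<sigma> ` tangent_frames Q H \<subseteq> {- 1, 1}" and \<sigma>_cont: "continuous_on (tangent_frames Q H) \<sigma>"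
    and \<sigma>_change: "\<And>q b c M. M \<in> carrier_mat (DIM('a) - 1) (DIM('a) - 1) \<Longrightarrow> (q, b) \<in> tangent_frames Q H \<Longrightarrow>
      (q, c) \<in> tangent_frames Q H \<Longrightarrow> (\<forall>j<(DIM('a) - 1). c j = (\<Sum>i<(DIM('a) - 1). M $$ (i, j) *\<^sub>R b i)) \<Longrightarrow>
      \<sigma> (q, c) = sgn (Determinant.det M) * \<sigma> (q, b)"
    using \<sigma> unfolding is_orientation_def by blast+
  obtain b where b: "(p, b) \<in> tangent_frames Q H" using frame_at_base_exists by blast
  define F where "F q = (q, moving_frame b q)" for q
  have F: "F q \<in> tangent_frames Q H" if "q \<in> H" for q using moving_frame[OF b that] by (simp add: F_def)
  have Fp: "F p = (p, b)"
    using b by (auto simp: F_def moving_frame_def fun_eq_iff tangent_frames_iff bil)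
      (metis not_le bil(10) scaleR_zero_left)
  have F_cont: "continuous_on H F"
    unfolding F_def moving_frame_def
    by (intro continuous_on_Pair continuous_on_coordinatewise_then_product continuous_on_diff
        continuous_on_scaleR continuous_on_form continuous_on_id continuous_on_const)
  have const: "\<tau> (F (T p)) = \<tau> (F p)"
    if \<tau>: "continuous_on (tangent_frames Q H) \<tau>" "\<tau> ` tangent_frames Q H \<subseteq> {- 1, 1}"
    for \<tau> :: "'a \<times> (nat \<Rightarrow> 'a) \<Rightarrow> real"
  proof (rule connected_sign_constant)
    show "continuous_on H (\<lambda>q. \<tau> (F q))"
      using continuous_on_compose2[OF \<tau>(1) F_cont] F by blast
    show "(\<lambda>q. \<tau> (F q)) ` H \<subseteq> {- 1, 1}" using \<tau>(2) F by blast
  qed (use p_in_H T_in_H in auto)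
  have sign_or: "continuous_on (tangent_frames Q H) frame_sign" "frame_sign ` tangent_frames Q H \<subseteq> {- 1, 1}"
    using is_orientation_frame_sign unfolding is_orientation_def by blast+
  define f where "f = moving_frame b (T p)"
  have Tp: "(T p, f) \<in> tangent_frames Q H" "(T p, T \<circ> b) \<in> tangent_frames Q H"
    using F[OF T_in_H[OF p_in_H]] T_frame[OF b] by (simp_all add: F_def f_def)
  have "\<exists>c. (T \<circ> b) j = (\<Sum>i<(DIM('a) - 1). c i *\<^sub>R f i)" if "j < (DIM('a) - 1)" for j
  proof (rule span_image_lessThan)
    have "(T \<circ> b) j \<in> span ((T \<circ> b) ` {..<(DIM('a) - 1)})" using that by (intro span_base) auto
    then show "(T \<circ> b) j \<in> span (f ` {..<(DIM('a) - 1)})"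
      using Tp unfolding tangent_frames_def by auto
  qed
  then obtain c where c: "\<And>j. j < (DIM('a) - 1) \<Longrightarrow> (T \<circ> b) j = (\<Sum>i<(DIM('a) - 1). c j i *\<^sub>R f i)" by metis
  define M where "M = mat (DIM('a) - 1) (DIM('a) - 1) (\<lambda>(i, j). c j i)"
  have M: "M \<in> carrier_mat (DIM('a) - 1) (DIM('a) - 1)" "\<forall>j<(DIM('a) - 1). (T \<circ> b) j = (\<Sum>i<(DIM('a) - 1). M $$ (i, j) *\<^sub>R f i)"
    using c by (simp_all add: M_def)
  have "\<sigma> (T p, T \<circ> b) = sgn (Determinant.det M) * \<sigma> (T p, f)"
    by (rule \<sigma>_change[OF M(1) Tp M(2)])
  moreover have "\<sigma> (T p, T \<circ> b) = \<sigma> (p, b)" by (rule inv[OF b])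
  moreover have "\<sigma> (T p, f) = \<sigma> (p, b)" using const[OF \<sigma>_cont \<sigma>_range] Fp by (simp add: F_def f_def)
  moreover have "\<sigma> (p, b) \<noteq> 0" using \<sigma>_range b by force
  ultimately have "sgn (Determinant.det M) = 1" by simp
  moreover have "frame_det (case_nat (T p) (T \<circ> b)) = frame_det (case_nat (T p) f) * Determinant.det M"
    by (rule frame_det_case_nat_change[OF M])
  ultimately have "frame_sign (T p, T \<circ> b) = frame_sign (T p, f)"
    by (simp add: frame_sign_def sgn_mult)
  also have "\<dots> = frame_sign (p, b)" using const[OF sign_or] Fp by (simp add: F_def f_def)
  finally have "sgn (op_det T) * frame_sign (p, b) = frame_sign (p, b)"
    by (simp add: frame_sign_def frame_det_T sgn_mult)
  moreover have "frame_sign (p, b) \<noteq> 0" using sign_or(2) b by force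
  ultimately show ?thesis by (simp add: sgn_1_pos)
qed

end

section \<open>The model of hyperbolic space\<close>

text \<open>The sheet is the radial projection of one open half of the cone, which is convex because
  \<open>B\<close> is positive on pairs in the same half.\<close>

lemma (in lorentz) connected_sheet: "connected {q. B q q = 1 \<and> B p q > 0}"
proof -
  let ?C = "{v. B v v > 0 \<and> B p v > 0}"
  have "convex ?C"
    unfolding convex_def
  proof (intro ballI allI impI)
    fix v w :: 'a and s t :: real
    assume v: "v \<in> ?C" and w: "w \<in> ?C" and st: "0 \<le> s" "0 \<le> t" "s + t = 1"
    have "w \<noteq> 0" using w by (auto simp: bil)
    then have vw: "B v w > 0" using inner_time_like_sign[of v w] v w by (auto simp: zero_less_mult_iff mult_less_0_iff)
    have eq: "B (s *\<^sub>R v + t *\<^sub>R w) (s *\<^sub>R v + t *\<^sub>R w) = s\<^sup>2 * B v v + 2 * (s * t) * B v w + t\<^sup>2 * B w w"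
      using sym[of w v] by (simp add: bil power2_eq_square algebra_simps)
    have nonneg: "0 \<le> s\<^sup>2 * B v v" "0 \<le> 2 * (s * t) * B v w" "0 \<le> t\<^sup>2 * B w w"
      "0 \<le> s * B p v" "0 \<le> t * B p w"
      using st v w vw by simp_all
    from st consider "s > 0" | "t > 0" by linarith
    then show "s *\<^sub>R v + t *\<^sub>R w \<in> ?C"
    proof cases
      case 1
      then have "0 < s\<^sup>2 * B v v" "0 < s * B p v" using v by simp_all
      then show ?thesis using nonneg eq by (simp add: bil)
    next
      case 2
      then have "0 < t\<^sup>2 * B w w" "0 < t * B p w" using w by simp_all
      then show ?thesis using nonneg eq by (simp add: bil)
    qed
  qed
  then have "connected ?C" by (rule convex_connected)
  moreover have "continuous_on ?C (\<lambda>v. inverse (sqrt (B v v)) *\<^sub>R v)"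
    by (intro continuous_on_scaleR continuous_on_inverse continuous_on_real_sqrt continuous_on_form
        continuous_on_id) auto
  ultimately have "connected ((\<lambda>v. inverse (sqrt (B v v)) *\<^sub>R v) ` ?C)"
    by (rule connected_continuous_image[rotated])
  moreover have "(\<lambda>v. inverse (sqrt (B v v)) *\<^sub>R v) ` ?C = {q. B q q = 1 \<and> B p q > 0}"
  proof (intro equalityI subsetI)
    fix q assume "q \<in> (\<lambda>v. inverse (sqrt (B v v)) *\<^sub>R v) ` ?C"
    then obtain v where v: "q = inverse (sqrt (B v v)) *\<^sub>R v" "B v v > 0" "B p v > 0" by blast
    then have "B q q = 1" by (simp only: form_scaleR) (simp add: power_inverse)
    then show "q \<in> {q. B q q = 1 \<and> B p q > 0}" using v by (simp add: bilinear_rmul[OF bilinear])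
  next
    fix q assume "q \<in> {q. B q q = 1 \<and> B p q > 0}"
    then show "q \<in> (\<lambda>v. inverse (sqrt (B v v)) *\<^sub>R v) ` ?C" by (intro image_eqI[of _ _ q]) auto
  qed
  ultimately show ?thesis by simp
qed

lemma (in lorentz) change_base:
  assumes "B q q = 1"
  shows "lorentz B q"
  using bilinear sym assms time_like_orthogonal[of q] by unfold_locales auto

lemma polar_form_sym: "polar_form Q u v = polar_form Q v u"
  by (simp add: polar_form_def add.commute)

lemma polar_form_self:
  assumes "quadratic_form Q"
  shows "polar_form Q v v = Q v"
proof -
  have "Q (v + v) = 4 * Q v"
    using assms unfolding quadratic_form_def scaleR_2[symmetric] by (simp add: power2_eq_square)
  then show ?thesis by (simp add: polar_form_def)
qed

text \<open>\<open>p\<close> is the positive basis vector, normalized. A vector orthogonal to it has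
  only negative directions in its orthogonal expansion.\<close>

lemma lorentz_of_signature:
  fixes Q :: "'a::euclidean_space \<Rightarrow> real"
  assumes Q: "quadratic_form Q" and sig: "has_signature Q 1 n"
  shows "\<exists>p. lorentz (polar_form Q) p"
proof -
  let ?B = "polar_form Q"
  have bil: "bilinear ?B" using Q by (simp add: quadratic_form_def)
  obtain P N where PN: "P \<inter> N = {}" "independent (P \<union> N)" "span (P \<union> N) = UNIV" "card P = 1"
    "pairwise (\<lambda>u v. ?B u v = 0) (P \<union> N)" "\<forall>v\<in>P. Q v > 0" "\<forall>v\<in>N. Q v < 0"
    using sig unfolding has_signature_def by blast
  obtain e where e: "P = {e}" using PN(4) by (rule card_1_singletonE)
  have fin: "finite (P \<union> N)" using PN(2) by (rule independent_imp_finite)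
  have Qe: "Q e > 0" using PN(6) e by simp
  have orth: "?B u v = (if u = v then Q u else 0)" if "u \<in> P \<union> N" "v \<in> P \<union> N" for u v
    using PN(5) that polar_form_self[OF Q] by (auto simp: pairwise_def)
  define p where "p = inverse (sqrt (Q e)) *\<^sub>R e"
  have "lorentz ?B p"
  proof
    show "bilinear ?B" by (rule bil)
    show "?B x y = ?B y x" for x y by (rule polar_form_sym)
    have "?B p p = (inverse (sqrt (Q e)))\<^sup>2 * ?B e e"
      by (simp add: p_def bilinear_lmul[OF bil] bilinear_rmul[OF bil] power2_eq_square)
    then show "?B p p = 1" using Qe by (simp add: power_inverse polar_form_self[OF Q])
    fix x assume x: "?B p x = 0" "x \<noteq> 0"
    have "x \<in> span (P \<union> N)" using PN(3) by simp
    then obtain c where c: "x = (\<Sum>v\<in>P \<union> N. c v *\<^sub>R v)"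
      unfolding span_finite[OF fin] by auto
    have lin: "linear (?B u)" "linear (\<lambda>u. ?B u v)" for u v using bil by (simp_all add: bilinear_def)
    have Bux: "?B u x = c u * Q u" if "u \<in> P \<union> N" for u
    proof -
      have "?B u x = (\<Sum>v\<in>P \<union> N. c v * ?B u v)"
        unfolding c by (simp add: linear_sum[OF lin(1)] linear_scale[OF lin(1)])
      also have "\<dots> = (\<Sum>v\<in>P \<union> N. if v = u then c u * Q u else 0)"
        using orth that by (intro sum.cong) auto
      also have "\<dots> = c u * Q u" using that fin by simp
      finally show ?thesis .
    qed
    have "?B e x = 0" using x(1) Qe by (simp add: p_def bilinear_lmul[OF bil])
    then have ce: "c e = 0" using Bux[of e] e Qe by simp
    have "?B x x = (\<Sum>v\<in>P \<union> N. c v * ?B v x)"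
      by (subst (1) c) (simp add: linear_sum[OF lin(2)] linear_scale[OF lin(2)])
    also have "\<dots> = (\<Sum>v\<in>P \<union> N. (c v)\<^sup>2 * Q v)"
      using Bux by (intro sum.cong) (auto simp: power2_eq_square)
    also have "\<dots> < 0"
    proof (rule ccontr)
      assume "\<not> ?thesis"
      moreover have nonpos: "(c v)\<^sup>2 * Q v \<le> 0" if "v \<in> P \<union> N" for v
        using that ce e PN(7) by (auto simp: mult_nonneg_nonpos less_imp_le)
      then have "(\<Sum>v\<in>P \<union> N. (c v)\<^sup>2 * Q v) \<le> 0" by (rule sum_nonpos)
      ultimately have "(\<Sum>v\<in>P \<union> N. - ((c v)\<^sup>2 * Q v)) = 0" by (simp add: sum_negf)
      then have "\<forall>v\<in>P \<union> N. - ((c v)\<^sup>2 * Q v) = 0"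
        using nonpos fin by (subst (asm) sum_nonneg_eq_0_iff) auto
      then have "c v = 0" if "v \<in> P \<union> N" for v using that PN(6,7) by fastforce
      then have "x = 0" unfolding c by simp
      then show False using x(2) by simp
    qed
    finally show "?B x x < 0" .
  qed
  then show ?thesis by blast
qed

text \<open>Any point of the component serves as \<open>p\<close>. The functional \<open>B p\<close>
  has no zero on the component, where vectors orthogonal to \<open>p\<close> cannot occur, so
  connectedness keeps it positive; conversely the sheet is connected and contains \<open>p\<close>,
  so it lies in the component.\<close>

lemma hyperboloid_isometry_of_component:
  fixes Q :: "'a::euclidean_space \<Rightarrow> real"
  assumes Q: "quadratic_form Q" and sig: "has_signature Q 1 n"
    and H: "H \<in> components {v. Q v = 1}" and T: "T \<in> hyp_isometries Q H"
  obtains p where "hyperboloid_isometry (polar_form Q) p Q H T"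
proof -
  let ?B = "polar_form Q"
  obtain p0 where p0: "lorentz ?B p0" using lorentz_of_signature[OF Q sig] by blast
  obtain p where p: "p \<in> H" using in_components_nonempty[OF H] by blast
  have sub: "H \<subseteq> {v. Q v = 1}" by (rule in_components_subset[OF H])
  have self: "?B v v = Q v" for v by (rule polar_form_self[OF Q])
  have "?B p p = 1" using p sub self by auto
  then interpret lorentz ?B p by (rule lorentz.change_base[OF p0])
  have "?B p q > 0" if q: "q \<in> H" for q
  proof (rule ccontr)
    assume "\<not> ?thesis"
    moreover have "?B p p > 0" by (simp add: base)
    moreover have "connected (?B p ` H)"
      by (intro connected_continuous_image in_components_connected[OF H] continuous_on_form
          continuous_on_const continuous_on_id)
    ultimately have "0 \<in> ?B p ` H"
      using p q connectedD_interval[of "?B p ` H" "?B p q" "?B p p" 0] by auto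
    then obtain r where r: "r \<in> H" "?B p r = 0" by auto
    then have "?B r r = 1" using sub self by auto
    then show False using neg[OF r(2)] by (cases "r = 0") (auto simp: bil)
  qed
  then have sub1: "H \<subseteq> {q. ?B q q = 1 \<and> ?B p q > 0}" using sub self by auto
  have "{q. ?B q q = 1 \<and> ?B p q > 0} \<subseteq> H"
    by (rule components_maximal[OF H connected_sheet]) (use p sub1 self in auto)
  with sub1 have H_eq: "H = {q. ?B q q = 1 \<and> ?B p q > 0}" by blast
  have lin: "linear T" and QT: "Q (T v) = Q v" and TH: "T ` H = H" for v
    using T by (auto simp: hyp_isometries_def isometry_group_def)
  have "?B (T x) (T y) = ?B x y" for x y
    unfolding polar_form_def linear_add[OF lin, symmetric] QT ..
  moreover have "?B p (T p) > 0" using p TH H_eq by blast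
  ultimately have "hyperboloid_isometry ?B p Q H T"
    using self H_eq connected_sheet lin by unfold_locales (auto simp: linear_add linear_scale)
  then show ?thesis by (rule that)
qed

section \<open>Mixed eigenvalues, the three types and the determinant\<close>

lemma ceigenspace_subset:
  fixes T :: "'a::euclidean_space \<Rightarrow> 'a"
  assumes "linear T"
  shows "ceigenspace T c \<subseteq> gen_ceigenspace T c"
proof
  let ?F = "\<lambda>w. cop T w - cscale c w"
  fix z assume "z \<in> ceigenspace T c"
  then have z: "?F z = 0" by (simp add: ceigenspace_def)
  have "linear (?F ^^ k)" for k
    by (intro linear_funpow linear_compose_sub linear_cop linear_cscale assms)
  then have "(?F ^^ k) 0 = 0" for k by (rule linear_0)
  then have "(?F ^^ Suc k) z = 0" for k unfolding funpow_Suc_right comp_apply z .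
  from this[of "DIM('a) - 1"] show "z \<in> gen_ceigenspace T c" by (simp add: gen_ceigenspace_def)
qed

lemma mixed_eigenvalueE:
  fixes T :: "'a::euclidean_space \<Rightarrow> 'a"
  assumes "linear T" "mixed_eigenvalue T c"
  obtains z where "((\<lambda>w. cop T w - cscale c w) ^^ DIM('a)) z = 0" "cop T z \<noteq> cscale c z"
  using assms ceigenspace_subset[OF assms(1), of c]
  by (auto simp: mixed_eigenvalue_def pure_eigenvalue_def gen_ceigenspace_def ceigenspace_def)

lemma (in hyperboloid) hyp_isometry:
  assumes "lorentz_isometry B p S"
  shows "S \<in> hyp_isometries Q H"
proof -
  interpret s: lorentz_isometry B p S by fact
  interpret s: hyperboloid_isometry B p Q H S by unfold_locales
  have "S ` H = H"
  proof (intro equalityI subsetI)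
    fix q assume q: "q \<in> H"
    then have "q \<noteq> 0" "S p \<in> H" using s.T_in_H[OF p_in_H] by (auto simp: H bil)
    then have "B (S p) q * (B p (S p) * B p q) > 0"
      using q by (intro inner_time_like_sign) (auto simp: H)
    then have "B p (inv_into UNIV S q) > 0"
      using q \<open>S p \<in> H\<close> by (auto simp: H s.iso_inv zero_less_mult_iff mult_less_0_iff)
    moreover have "B (inv_into UNIV S q) (inv_into UNIV S q) = B q q"
      using s.iso[of "inv_into UNIV S q" "inv_into UNIV S q"] by simp
    ultimately have "inv_into UNIV S q \<in> H" using q by (simp add: H)
    then show "q \<in> S ` H" by (intro image_eqI[of _ _ "inv_into UNIV S q"]) simp_all
  qed (use s.T_in_H in auto)
  then show ?thesis
    using s.linear_T s.bij_T by (simp add: hyp_isometries_def isometry_group_def Q s.iso)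
qed

context hyperboloid_isometry
begin

lemma T_hyp: "T \<in> hyp_isometries Q H"
  by (rule hyp_isometry) unfold_locales

lemma time_like_eigenvector_iff: "has_time_like_eigenvector Q T \<longleftrightarrow> (\<exists>h. elliptic_isometry B p T h)"
proof
  assume "has_time_like_eigenvector Q T"
  then obtain c v where "T v = c *\<^sub>R v" "B v v > 0"
    by (auto simp: has_time_like_eigenvector_def real_eigenspace_def time_like_def Q)
  then have "elliptic_isometry B p T v"
    using time_like_eigenvector_fixed by unfold_locales auto
  then show "\<exists>h. elliptic_isometry B p T h" ..
next
  assume "\<exists>h. elliptic_isometry B p T h"
  then obtain h where "elliptic_isometry B p T h" ..
  then interpret elliptic_isometry B p T h .
  have "h \<in> real_eigenspace T 1" "h \<noteq> 0" "time_like Q h"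
    using h_fixed h_time_like by (auto simp: real_eigenspace_def time_like_def Q bil)
  then show "has_time_like_eigenvector Q T" unfolding has_time_like_eigenvector_def by blast
qed

lemma real_eigenvalue_hyperbolic:
  assumes "r \<noteq> 1" "r \<noteq> - 1" "is_eigenvalue T (of_real r)"
  obtains u w where "hyperbolic_isometry B p T r u w"
proof -
  obtain u where "u \<noteq> 0" "T u = r *\<^sub>R u" using assms(3) unfolding is_eigenvalue_of_real by blast
  then obtain w where "hyperbolic_isometry B p T r u w" using hyperbolic_isometry_exists assms(1,2) by blast
  then show ?thesis by (rule that)
qed

lemma hyperbolic_pair:
  assumes "hyperbolic_isometry B p T r u w"
  shows "has_real_eigenvalue_pair T r"
proof -
  interpret hyperbolic_isometry B p T r u w by fact
  show ?thesis
    unfolding has_real_eigenvalue_pair_def is_eigenvalue_of_real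
    using t eigen nonzero by blast
qed

lemma trichotomy:
  "(\<exists>h. elliptic_isometry B p T h) \<or> (\<exists>r u w. hyperbolic_isometry B p T r u w) \<or>
    (\<exists>u v e g. parabolic_isometry B p T u v e g)"
proof -
  obtain v c where v: "v \<noteq> 0" "B v v \<ge> 0" "T v = c *\<^sub>R v" using cone_eigenvector_exists by blast
  have "c > 0" by (rule eigenvalue_cone_pos[OF v(2,1,3)])
  consider "\<exists>h. T h = h \<and> B h h > 0" | "c \<noteq> 1" | "c = 1" "\<And>h. T h = h \<Longrightarrow> B h h \<le> 0"
    by (meson not_le)
  then show ?thesis
  proof cases
    case 1
    then obtain h where "T h = h" "B h h > 0" by blast
    then have "elliptic_isometry B p T h" by unfold_locales
    then show ?thesis by blast
  next
    case 2
    then obtain w where "hyperbolic_isometry B p T c v w"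
      using hyperbolic_isometry_exists[OF v(3,1)] \<open>c > 0\<close> by auto
    then show ?thesis by blast
  next
    case 3
    then have "T v = v" "B v v = 0" using v by (simp_all add: antisym)
    then obtain w e g where "parabolic_isometry B p T v w e g"
      using parabolic_isometry_exists[OF _ v(1) _ 3(2)] by blast
    then show ?thesis by blast
  qed
qed

lemma elliptic_not_hyperbolic:
  assumes "elliptic_isometry B p T h" "is_eigenvalue T (of_real r)"
  shows "r = 1 \<or> r = - 1"
  using elliptic_isometry.elliptic_eigenvalue[OF assms] by (simp add: abs_eq_iff')

lemma mixed_eigenvalue_one:
  assumes "mixed_eigenvalue T c"
  shows "c = 1"
proof (rule ccontr)
  assume c: "c \<noteq> 1"
  obtain z where z: "((\<lambda>w. cop T w - cscale c w) ^^ DIM('a)) z = 0" "cop T z \<noteq> cscale c z"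
    by (rule mixed_eigenvalueE[OF linear_T assms])
  then have "\<not> semisimple_op T" using semisimple_eigenspace[OF _ linear_T z(1)] by blast
  moreover have "\<not> parabolic_isometry B p T u v e g" for u v e g
    using parabolic_isometry.parabolic_pure[OF _ z(1) c] z(2) by blast
  ultimately show False
    using trichotomy elliptic_isometry.elliptic_semisimple hyperbolic_isometry.hyperbolic_semisimple by blast
qed

lemma op_det_eq: "op_det T = (- 1) ^ order (- 1) (op_char_poly T)"
proof -
  have *: ?thesis
    if "rotation_data s a r" "op_char_poly T = [:-1, 1:] ^ l * [:1, 1:] ^ m * (h * rotation_poly s a r)"
      "poly h 0 = 1" "even (degree h)" "poly h (- 1) \<noteq> 0" for l m s a r h
    using det_sign_factorization[OF that(2-4)] order_minus_one_factorization[OF that(1,5), of l m]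
    unfolding that(2) by simp
  consider h where "elliptic_isometry B p T h" | r u w where "hyperbolic_isometry B p T r u w"
    | u v e g where "parabolic_isometry B p T u v e g"
    using trichotomy by blast
  then show ?thesis
  proof cases
    case 1
    then obtain l m s a r where "elliptic_form T l m s a r"
      by (rule elliptic_isometry.elliptic_char_poly)
    then show ?thesis using *[of s a r l m 1] by (simp add: elliptic_form_def)
  next
    case 2
    interpret hyperbolic_isometry B p T r u w by fact
    obtain l m s a r' where f: "hyperbolic_form T r l m s a r'"
      by (rule hyperbolic_char_poly)
    let ?h = "[:- r, 1:] * [:- inverse r, 1:]"
    have "r > 0" using eigenvalue_cone_pos[OF _ nonzero(1) eigen(1)] light_like by simp
    \<comment> \<open>The value of \<open>?h\<close> at -1 is
      \<open>2 + r + inverse r\<close>.\<close>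
    then have "inverse r + r \<noteq> - 2" using positive_imp_inverse_positive[of r] by linarith
    then have "poly ?h 0 = 1" "poly ?h (- 1) \<noteq> 0" using \<open>r > 0\<close> by (auto simp: add_eq_0_iff)
    moreover have "degree ?h = 2" by (subst degree_mult_eq) auto
    ultimately show ?thesis
      using f *[of s a r' l m ?h] unfolding hyperbolic_form_def by (simp del: mult_pCons_left)
  next
    case 3
    then obtain l m s a r where "parabolic_form T l m s a r"
      by (rule parabolic_isometry.parabolic_char_poly)
    then show ?thesis using *[of s a r l m 1] by (simp add: parabolic_form_def)
  qed
qed

lemma orientation_preserving_iff:
  "orientation_preserving Q H T \<longleftrightarrow> even (order (- 1) (op_char_poly T))"
  "orientation_preserving Q H T \<longleftrightarrow> op_det T = 1"
proof -
  have "orientation_preserving Q H T \<longleftrightarrow> op_det T > 0"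
    using orientation_preserving_if orientation_preserving_only_if by blast
  then show "orientation_preserving Q H T \<longleftrightarrow> even (order (- 1) (op_char_poly T))"
    "orientation_preserving Q H T \<longleftrightarrow> op_det T = 1"
    unfolding op_det_eq by (simp_all add: minus_one_power_iff)
qed

lemma is_elliptic:
  assumes "elliptic_isometry B p T h"
  shows "elliptic Q H T"
proof -
  obtain l m s a r where f: "elliptic_form T l m s a r"
    using assms by (rule elliptic_isometry.elliptic_char_poly)
  have "has_time_like_eigenvector Q T" using assms time_like_eigenvector_iff by blast
  then show ?thesis
    using f T_hyp unfolding elliptic_def rotatory_elliptic_def rotatory_elliptic_inversion_def by metis
qed

end

section \<open>The three types in the form of the theorem\<close>

context hyperboloid_isometry
begin

lemma elliptic_case:
  assumes "elliptic_isometry B p T h"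
  shows "semisimple_op T \<and>
    (\<exists>(l::nat) (m::nat) (s::nat) (a::nat \<Rightarrow> real) (r::nat \<Rightarrow> nat).
       op_char_poly T = [:-1, 1:] ^ l * [:1, 1:] ^ m * (\<Prod>j=1..s. [:1, - 2 * a j, 1:] ^ r j) \<and>
       (\<forall>j\<in>{1..s}. \<bar>a j\<bar> < 1 \<and> r j \<ge> 1) \<and> inj_on a {1..s} \<and> l \<ge> 1 \<and>
       (let k = (\<Sum>j=1..s. r j) + m div 2 in
          (even m \<longrightarrow> rotatory_elliptic Q H k T) \<and>
          (odd m \<longrightarrow> rotatory_elliptic_inversion Q H k T)))"
    (is "_ \<and> ?ex")
proof
  show "semisimple_op T" using assms by (rule elliptic_isometry.elliptic_semisimple)
  obtain l m s a r where f: "elliptic_form T l m s a r"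
    using assms by (rule elliptic_isometry.elliptic_char_poly)
  have "has_time_like_eigenvector Q T" using assms time_like_eigenvector_iff by blast
  then have rotatory: "even m \<longrightarrow> rotatory_elliptic Q H (rotation_number m s r) T"
    "odd m \<longrightarrow> rotatory_elliptic_inversion Q H (rotation_number m s r) T"
    using f T_hyp unfolding rotatory_elliptic_def rotatory_elliptic_inversion_def by blast+
  show ?ex
    by (rule exI[of _ l], rule exI[of _ m], rule exI[of _ s], rule exI[of _ a], rule exI[of _ r])
      (use f rotatory in \<open>unfold elliptic_form_def rotation_data_def rotation_poly_def rotation_number_def Let_def, blast\<close>)
qed

lemma hyperbolic_case:
  assumes "hyperbolic_isometry B p T \<rho> u w"
  shows "is_eigenvalue T (of_real (inverse \<rho>)) \<and>
    (\<forall>\<rho>'. \<rho>' \<noteq> 1 \<and> \<rho>' \<noteq> -1 \<and> is_eigenvalue T (of_real \<rho>') \<longrightarrow> \<rho>' = \<rho> \<or> \<rho>' = inverse \<rho>) \<and>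
    \<rho> > 0 \<and>
    dim (real_eigenspace T \<rho>) = 1 \<and> light_like_space Q (real_eigenspace T \<rho>) \<and>
    dim (real_eigenspace T (inverse \<rho>)) = 1 \<and>
    light_like_space Q (real_eigenspace T (inverse \<rho>)) \<and>
    semisimple_op T \<and>
    (\<exists>(l::nat) (m::nat) (s::nat) (a::nat \<Rightarrow> real) (r::nat \<Rightarrow> nat).
       op_char_poly T = [:-1, 1:] ^ l * [:1, 1:] ^ m *
         ([:- \<rho>, 1:] * [:- inverse \<rho>, 1:] * (\<Prod>j=1..s. [:1, - 2 * a j, 1:] ^ r j)) \<and>
       (\<forall>j\<in>{1..s}. \<bar>a j\<bar> < 1 \<and> r j \<ge> 1) \<and> inj_on a {1..s} \<and>
       (let k = (\<Sum>j=1..s. r j) + m div 2 in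
          (even m \<longrightarrow> rotatory_hyperbolic Q H k T) \<and>
          (odd m \<longrightarrow> rotatory_hyperbolic_inversion Q H k T)))"
    (is "_ \<and> _ \<and> _ \<and> _ \<and> _ \<and> _ \<and> _ \<and> _ \<and> ?ex")
proof (intro conjI allI impI)
  interpret hyperbolic_isometry B p T \<rho> u w by fact
  interpret s: hyperbolic_isometry B p T "inverse \<rho>" w u by (rule swap)
  show "is_eigenvalue T (of_real (inverse \<rho>))" unfolding is_eigenvalue_of_real using eigen nonzero by blast
  show pos: "\<rho> > 0" using eigenvalue_cone_pos[OF _ nonzero(1) eigen(1)] light_like by simp
  show "\<rho>' = \<rho> \<or> \<rho>' = inverse \<rho>"
    if "\<rho>' \<noteq> 1 \<and> \<rho>' \<noteq> -1 \<and> is_eigenvalue T (of_real \<rho>')" for \<rho>'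
    using that hyperbolic_eigenvalue[of "of_real \<rho>'"] by (auto simp: abs_eq_iff' of_real_eq_iff simp flip: of_real_inverse)
  have light: "light_like_space Q (span {x})" if "B x x = 0" for x
    using that by (auto simp: light_like_space_def span_singleton Q form_scaleR)
  have dim: "dim (span {x}) = 1" if "x \<noteq> 0" for x :: 'a
    using that by simp
  show "dim (real_eigenspace T \<rho>) = 1" "dim (real_eigenspace T (inverse \<rho>)) = 1"
    unfolding real_eigenspace_eq s.real_eigenspace_eq using dim nonzero by blast+
  show "light_like_space Q (real_eigenspace T \<rho>)" "light_like_space Q (real_eigenspace T (inverse \<rho>))"
    unfolding real_eigenspace_eq s.real_eigenspace_eq using light light_like by blast+
  show "semisimple_op T" by (rule hyperbolic_semisimple)
  obtain l m s a r where f: "hyperbolic_form T \<rho> l m s a r" by (rule hyperbolic_char_poly)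
  have rotatory: "even m \<longrightarrow> rotatory_hyperbolic Q H (rotation_number m s r) T"
    "odd m \<longrightarrow> rotatory_hyperbolic_inversion Q H (rotation_number m s r) T"
    using f T_hyp hyperbolic_pair[OF assms]
    unfolding rotatory_hyperbolic_def rotatory_hyperbolic_inversion_def by blast+
  show ?ex
    by (rule exI[of _ l], rule exI[of _ m], rule exI[of _ s], rule exI[of _ a], rule exI[of _ r])
      (use f rotatory in \<open>unfold hyperbolic_form_def rotation_data_def rotation_poly_def rotation_number_def Let_def, blast\<close>)
qed

lemma parabolic_case:
  assumes "parabolic_isometry B p T u v e g"
  shows "(\<exists>W. subspace W \<and> dim W = 1 \<and> light_like_space Q W \<and> W \<subseteq> real_eigenspace T 1) \<and>
    (\<exists>Ts Tu. jordan_decomposition T Ts Tu \<and>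
       (\<forall>Ts' Tu'. jordan_decomposition T Ts' Tu' \<longrightarrow> Ts' = Ts \<and> Tu' = Tu) \<and>
       Tu \<noteq> id \<and> elliptic Q H Ts \<and> is_minimal_poly Tu ([:-1, 1:] ^ 3)) \<and>
    (\<exists>(l::nat) (m::nat) (s::nat) (a::nat \<Rightarrow> real) (r::nat \<Rightarrow> nat).
       op_char_poly T = [:-1, 1:] ^ l * [:1, 1:] ^ m * (\<Prod>j=1..s. [:1, - 2 * a j, 1:] ^ r j) \<and>
       (\<forall>j\<in>{1..s}. \<bar>a j\<bar> < 1 \<and> r j \<ge> 1) \<and> inj_on a {1..s} \<and> l \<ge> 3 \<and>
       (let k = (\<Sum>j=1..s. r j) + m div 2 in
          (even m \<longrightarrow> rotatory_parabolic Q H k T) \<and>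
          (odd m \<longrightarrow> rotatory_parabolic_inversion Q H k T)))"
    (is "_ \<and> _ \<and> ?ex")
proof (intro conjI)
  interpret parabolic_isometry B p T u v e g by fact
  have "subspace (span {u})" "dim (span {u}) = 1" using u_nonzero by simp_all
  moreover have "light_like_space Q (span {u})"
    by (auto simp: light_like_space_def span_singleton Q form_scaleR uu)
  moreover have "span {u} \<subseteq> real_eigenspace T 1"
    by (auto simp: real_eigenspace_def span_singleton lin Tu)
  ultimately show "\<exists>W. subspace W \<and> dim W = 1 \<and> light_like_space Q W \<and> W \<subseteq> real_eigenspace T 1" by blast
  interpret s: elliptic_isometry B p ss "u + v" by (rule ss_elliptic)
  interpret s: hyperboloid_isometry B p Q H ss by unfold_locales
  have "elliptic Q H ss" by (rule s.is_elliptic[OF ss_elliptic])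
  then show "\<exists>Ts Tu. jordan_decomposition T Ts Tu \<and>
       (\<forall>Ts' Tu'. jordan_decomposition T Ts' Tu' \<longrightarrow> Ts' = Ts \<and> Tu' = Tu) \<and>
       Tu \<noteq> id \<and> elliptic Q H Ts \<and> is_minimal_poly Tu ([:-1, 1:] ^ 3)"
    using jordan jordan_decomposition_unique[OF linear_T inj_T jordan] unip_not_id unip_minimal_poly
    by blast
  obtain l m s a r where f: "parabolic_form T l m s a r" by (rule parabolic_char_poly)
  have rotatory: "even m \<longrightarrow> rotatory_parabolic Q H (rotation_number m s r) T"
    "odd m \<longrightarrow> rotatory_parabolic_inversion Q H (rotation_number m s r) T"
    using f T_hyp not_semisimple
    unfolding rotatory_parabolic_def rotatory_parabolic_inversion_def by blast+
  show ?ex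
    by (rule exI[of _ l], rule exI[of _ m], rule exI[of _ s], rule exI[of _ a], rule exI[of _ r])
      (use f rotatory in \<open>unfold parabolic_form_def rotation_data_def rotation_poly_def rotation_number_def Let_def, blast\<close>)
qed

lemma semisimple_iff: "semisimple_op T \<longleftrightarrow> \<not> (\<exists>u v e g. parabolic_isometry B p T u v e g)"
  using trichotomy elliptic_isometry.elliptic_semisimple hyperbolic_isometry.hyperbolic_semisimple
    parabolic_isometry.not_semisimple by blast

lemma exclusive_types:
  "let A = has_time_like_eigenvector Q T; E = (\<exists>\<rho>. has_real_eigenvalue_pair T \<rho>); C = (\<not> semisimple_op T)
   in (A \<or> E \<or> C) \<and> \<not> (A \<and> E) \<and> \<not> (A \<and> C) \<and> \<not> (E \<and> C)"
proof -
  have A: "has_time_like_eigenvector Q T \<longleftrightarrow> (\<exists>h. elliptic_isometry B p T h)"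
    by (rule time_like_eigenvector_iff)
  have E: "(\<exists>\<rho>. has_real_eigenvalue_pair T \<rho>) \<longleftrightarrow> (\<exists>r u w. hyperbolic_isometry B p T r u w)"
    using hyperbolic_pair real_eigenvalue_hyperbolic unfolding has_real_eigenvalue_pair_def by metis
  have "\<not> (has_time_like_eigenvector Q T \<and> (\<exists>\<rho>. has_real_eigenvalue_pair T \<rho>))"
    unfolding A has_real_eigenvalue_pair_def using elliptic_not_hyperbolic by metis
  moreover have "\<not> (has_time_like_eigenvector Q T \<and> \<not> semisimple_op T)"
    unfolding A using elliptic_isometry.elliptic_semisimple by blast
  moreover have "\<not> ((\<exists>\<rho>. has_real_eigenvalue_pair T \<rho>) \<and> \<not> semisimple_op T)"
    unfolding E using hyperbolic_isometry.hyperbolic_semisimple by blast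
  moreover have "has_time_like_eigenvector Q T \<or> (\<exists>\<rho>. has_real_eigenvalue_pair T \<rho>) \<or> \<not> semisimple_op T"
    unfolding A E using trichotomy semisimple_iff by blast
  ultimately show ?thesis unfolding Let_def by blast
qed

lemma eigenvalue_minus_one_space_like:
  assumes "v \<noteq> 0" "v \<in> real_eigenspace T (- 1)"
  shows "space_like Q v"
proof (rule ccontr)
  assume "\<not> ?thesis"
  then have "B v v \<ge> 0" by (simp add: space_like_def Q)
  then have "(- 1 :: real) > 0"
    using assms by (intro eigenvalue_cone_pos[of v]) (auto simp: real_eigenspace_def)
  then show False by simp
qed

end

theorem theorem1p1:
  fixes Q :: "'a::euclidean_space \<Rightarrow> real" and H :: "'a set" and T :: "'a \<Rightarrow> 'a" and n :: nat
  assumes "DIM('a) = n + 1"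
    and "quadratic_form Q"
    and "has_signature Q 1 n"
    and "H \<in> components {v. Q v = 1}"
    and "T \<in> hyp_isometries Q H"
  shows
    "(\<forall>c. mixed_eigenvalue T c \<longrightarrow> c = 1) \<and>

     (\<forall>v. v \<noteq> 0 \<and> v \<in> real_eigenspace T (-1) \<longrightarrow> space_like Q v) \<and>
     (orientation_preserving Q H T \<longleftrightarrow> even (order (-1) (op_char_poly T))) \<and>
     (orientation_preserving Q H T \<longleftrightarrow> op_det T = 1) \<and>

     (has_time_like_eigenvector Q T \<longrightarrow>
        semisimple_op T \<and>
        (\<exists>(l::nat) (m::nat) (s::nat) (a::nat \<Rightarrow> real) (r::nat \<Rightarrow> nat).
           op_char_poly T = [:-1, 1:] ^ l * [:1, 1:] ^ m *
             (\<Prod>j=1..s. [:1, - 2 * a j, 1:] ^ r j) \<and>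
           (\<forall>j\<in>{1..s}. \<bar>a j\<bar> < 1 \<and> r j \<ge> 1) \<and> inj_on a {1..s} \<and> l \<ge> 1 \<and>
           (let k = (\<Sum>j=1..s. r j) + m div 2 in
              (even m \<longrightarrow> rotatory_elliptic Q H k T) \<and>
              (odd m \<longrightarrow> rotatory_elliptic_inversion Q H k T)))) \<and>

     (\<forall>\<rho>. \<rho> \<noteq> 1 \<and> \<rho> \<noteq> -1 \<and> is_eigenvalue T (of_real \<rho>) \<longrightarrow>
        is_eigenvalue T (of_real (inverse \<rho>)) \<and>
        (\<forall>\<rho>'. \<rho>' \<noteq> 1 \<and> \<rho>' \<noteq> -1 \<and> is_eigenvalue T (of_real \<rho>') \<longrightarrow>
           \<rho>' = \<rho> \<or> \<rho>' = inverse \<rho>) \<and>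
        \<rho> > 0 \<and>
        dim (real_eigenspace T \<rho>) = 1 \<and> light_like_space Q (real_eigenspace T \<rho>) \<and>
        dim (real_eigenspace T (inverse \<rho>)) = 1 \<and>
        light_like_space Q (real_eigenspace T (inverse \<rho>)) \<and>
        semisimple_op T \<and>
        (\<exists>(l::nat) (m::nat) (s::nat) (a::nat \<Rightarrow> real) (r::nat \<Rightarrow> nat).
           op_char_poly T = [:-1, 1:] ^ l * [:1, 1:] ^ m *
             ([:- \<rho>, 1:] * [:- inverse \<rho>, 1:] * (\<Prod>j=1..s. [:1, - 2 * a j, 1:] ^ r j)) \<and>
           (\<forall>j\<in>{1..s}. \<bar>a j\<bar> < 1 \<and> r j \<ge> 1) \<and> inj_on a {1..s} \<and>
           (let k = (\<Sum>j=1..s. r j) + m div 2 in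
              (even m \<longrightarrow> rotatory_hyperbolic Q H k T) \<and>
              (odd m \<longrightarrow> rotatory_hyperbolic_inversion Q H k T)))) \<and>

     (\<not> semisimple_op T \<longrightarrow>
        (\<exists>W. subspace W \<and> dim W = 1 \<and> light_like_space Q W \<and> W \<subseteq> real_eigenspace T 1) \<and>
        (\<exists>Ts Tu. jordan_decomposition T Ts Tu \<and>
           (\<forall>Ts' Tu'. jordan_decomposition T Ts' Tu' \<longrightarrow> Ts' = Ts \<and> Tu' = Tu) \<and>
           Tu \<noteq> id \<and> elliptic Q H Ts \<and> is_minimal_poly Tu ([:-1, 1:] ^ 3)) \<and>
        (\<exists>(l::nat) (m::nat) (s::nat) (a::nat \<Rightarrow> real) (r::nat \<Rightarrow> nat).
           op_char_poly T = [:-1, 1:] ^ l * [:1, 1:] ^ m *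
             (\<Prod>j=1..s. [:1, - 2 * a j, 1:] ^ r j) \<and>
           (\<forall>j\<in>{1..s}. \<bar>a j\<bar> < 1 \<and> r j \<ge> 1) \<and> inj_on a {1..s} \<and> l \<ge> 3 \<and>
           (let k = (\<Sum>j=1..s. r j) + m div 2 in
              (even m \<longrightarrow> rotatory_parabolic Q H k T) \<and>
              (odd m \<longrightarrow> rotatory_parabolic_inversion Q H k T)))) \<and>

     (let A = has_time_like_eigenvector Q T;
          B = (\<exists>\<rho>. has_real_eigenvalue_pair T \<rho>);
          C = (\<not> semisimple_op T)
      in (A \<or> B \<or> C) \<and> \<not> (A \<and> B) \<and> \<not> (A \<and> C) \<and> \<not> (B \<and> C))"
proof -
  obtain p where "hyperboloid_isometry (polar_form Q) p Q H T"
    using hyperboloid_isometry_of_component[OF assms(2-5)] by blast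
  then interpret hyperboloid_isometry "polar_form Q" p Q H T .
  show ?thesis
    apply (rule conjI)
    subgoal using mixed_eigenvalue_one by blast
    apply (rule conjI)
    subgoal using eigenvalue_minus_one_space_like by blast
    apply (rule conjI)
    subgoal by (rule orientation_preserving_iff)
    apply (rule conjI)
    subgoal by (rule orientation_preserving_iff)
    apply (rule conjI)
    subgoal unfolding time_like_eigenvector_iff by (rule impI, elim exE, rule elliptic_case)
    apply (rule conjI)
    subgoal by (intro allI impI, elim conjE, erule (2) real_eigenvalue_hyperbolic, rule hyperbolic_case)
    apply (rule conjI)
    subgoal unfolding semisimple_iff not_not by (rule impI, elim exE, rule parabolic_case)
    subgoal by (rule exclusive_types)
    done
qed

end
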